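(* Let $A=\langle\boldsymbol{\alpha},\mathbf{A},\boldsymbol{\beta}\rangle$ be a minimal WFA with $n$ states over a one-letter alphabet, with $\rho(\mathbf{A})<1$, and let $A$ be in its SVA form. Let $\mathbf{H}$ be its Hankel matrix, with singular numbers $\sigma_0\ge\dots\ge\sigma_{n-1}>0$, and let $k<n$. Let $\widehat{\boldsymbol{\alpha}}_+,\widehat{\mathbf{A}}_+,\widehat{\boldsymbol{\beta}}_+$ be constructed from $A$ and $k$ as described in the context. Then the optimal spectral-norm approximation of rank $k$ of $A$ is given by the WFA $\widehat{A}_k=\langle\widehat{\boldsymbol{\alpha}}_+,\widehat{\mathbf{A}}_+,\widehat{\boldsymbol{\beta}}_+\rangle$; that is, $\widehat{A}_k$ has $k$ states and its Hankel matrix $\mathbf{G}$ satisfies $\|\mathbf{H}-\mathbf{G}\|=\sigma_k$, where $\|\cdot\|$ is the spectral (operator) norm on $\ell^2$.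
   Context: A weighted finite automaton (WFA) with $n$ states over a one-letter alphabet is a triple $A=\langle\boldsymbol{\alpha},\mathbf{A},\boldsymbol{\beta}\rangle$ with $\boldsymbol{\alpha},\boldsymbol{\beta}\in\mathbb{R}^n$, $\mathbf{A}\in\mathbb{R}^{n\times n}$; $\rho(\mathbf{A})$ is the spectral radius. It computes $f:\mathbb{N}\to\mathbb{R}$, $f(x)=\boldsymbol{\alpha}^{\top}\mathbf{A}^x\boldsymbol{\beta}$. Its Hankel matrix is the infinite matrix $\mathbf{H}(i,j)=f(i+j)$, $i,j\ge0$, viewed as an operator $H$ on $\ell^2$. The forward matrix $\mathbf{F}$ has rows $\boldsymbol{\alpha}^{\top}\mathbf{A}^p$ and the backward matrix $\mathbf{B}$ has rows $(\mathbf{A}^s\boldsymbol{\beta})^{\top}$, $p,s\ge0$, so $\mathbf{H}=\mathbf{F}\mathbf{B}^{\top}$. The WFA is minimal if $\operatorname{rank}\mathbf{F}=\operatorname{rank}\mathbf{B}=n$. The Gramians are $\mathbf{P}=\mathbf{F}^{\top}\mathbf{F}$, $\mathbf{Q}=\mathbf{B}^{\top}\mathbf{B}$. A minimal WFA is in SVA (singular value automaton) form if $\mathbf{F}=\mathbf{U}\mathbf{D}^{1/2}$ and $\mathbf{B}=\mathbf{V}\mathbf{D}^{1/2}$ for a compact SVD $\mathbf{H}=\mathbf{U}\mathbf{D}\mathbf{V}^{\top}$; then $\mathbf{P}=\mathbf{Q}=\mathbf{D}$ is the diagonal matrix of singular numbers. Standing conventions for the SVA form (since $\mathbf{H}$ is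 symmetric): $\mathbf{A}=\mathbf{A}^{\top}$, and the $i$-th coordinates satisfy $\boldsymbol{\alpha}_i=\operatorname{sgn}(\lambda_i)\boldsymbol{\beta}_i$, where $\lambda_i$ is the $i$-th nonzero eigenvalue of $\mathbf{H}$. Construction. Let $\sigma_k$ have multiplicity $r$, with $\sigma_0\ge\dots>\sigma_k=\dots=\sigma_{k+r-1}>\sigma_{k+r}\ge\dots\ge\sigma_{n-1}>0$. Order coordinates so that $\mathbf{P}=\mathbf{Q}=\begin{pmatrix}\mathbf{\Sigma}&\mathbf{0}\\ \mathbf{0}&\sigma_k\mathbf{1}_r\end{pmatrix}$, with $\mathbf{\Sigma}$ the $(n-r)\times(n-r)$ diagonal matrix of the remaining singular numbers, and partition conformally $\mathbf{A}=\begin{pmatrix}\mathbf{A}_{11}&\mathbf{A}_{12}\\ \mathbf{A}_{12}^{\top}&\mathbf{A}_{22}\end{pmatrix}$, $\boldsymbol{\alpha}=\begin{pmatrix}\boldsymbol{\alpha}_1\\ \boldsymbol{\alpha}_2\end{pmatrix}$, $\boldsymbol{\beta}=\begin{pmatrix}\boldsymbol{\beta}_1\\ \boldsymbol{\beta}_2\end{pmatrix}$. Let $\mathbf{R}=\sigma_k^2\mathbf{1}_{n-r}-\mathbf{\Sigma}^2$, and let $(\cdot)^+$ be the Moore–Penrose pseudo-inverse. Let $\widehat{A}=\langle\widehat{\boldsymbol{\alpha}},\widehat{\mathbf{A}},\widehat{\boldsymbol{\beta}}\rangle$ be the WFA with $n-r$ states whose parameters are given by: if $\boldsymbol{\alpha}_2\ne\mathbf{0}$: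 $\widehat{\boldsymbol{\beta}}=-\widehat{\mathbf{A}}\mathbf{A}_{12}(\boldsymbol{\beta}_2^{\top})^+$, $\widehat{\boldsymbol{\alpha}}=\widehat{\mathbf{A}}^{\top}\mathbf{R}\mathbf{A}_{12}(\boldsymbol{\alpha}_2^{\top})^+$, $\widehat{\mathbf{A}}(\mathbf{A}_{11}-\mathbf{A}_{12}(\boldsymbol{\beta}_2^{\top})^+\boldsymbol{\beta}_1^{\top})=\mathbf{1}$; if $\boldsymbol{\alpha}_2=\mathbf{0}$: $\widehat{\boldsymbol{\beta}}=(\mathbf{1}-\widehat{\mathbf{A}}\mathbf{A}_{11})(\boldsymbol{\beta}_1^{\top})^+$, $\widehat{\boldsymbol{\alpha}}=-(\mathbf{R}-\widehat{\mathbf{A}}^{\top}\mathbf{R}\mathbf{A}_{11})(\boldsymbol{\alpha}_1^{\top})^+$, $\widehat{\mathbf{A}}\mathbf{A}_{12}=\mathbf{0}$. The auxiliary WFA $\widehat{A}$ is subject throughout to the standing requirements that $\widehat{\mathbf{A}}$ has no eigenvalue of modulus $1$ and that the WFA $\left\langle\begin{pmatrix}\boldsymbol{\alpha}\\-\widehat{\boldsymbol{\alpha}}\end{pmatrix},\begin{pmatrix}\mathbf{A}&\mathbf{0}\\ \mathbf{0}&\widehat{\mathbf{A}}\end{pmatrix},\begin{pmatrix}\boldsymbol{\beta}\\ \widehat{\boldsymbol{\beta}}\end{pmatrix}\right\rangle$ is minimal. Change basis by an invertible $\mathbf{S}$ so that $\mathbf{S}^{-1}\widehat{\mathbf{A}}\mathbf{S}=\begin{pmatrix}\widehat{\mathbf{A}}_+&\mathbf{0}\\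 \mathbf{0}&\widehat{\mathbf{A}}_-\end{pmatrix}$, where all eigenvalues of $\widehat{\mathbf{A}}_+$ (resp. $\widehat{\mathbf{A}}_-$) have modulus smaller (resp. greater) than one, and write conformally $\mathbf{S}^{\top}\widehat{\boldsymbol{\alpha}}=\begin{pmatrix}\widehat{\boldsymbol{\alpha}}_+\\ \widehat{\boldsymbol{\alpha}}_-\end{pmatrix}$, $\mathbf{S}^{-1}\widehat{\boldsymbol{\beta}}=\begin{pmatrix}\widehat{\boldsymbol{\beta}}_+\\ \widehat{\boldsymbol{\beta}}_-\end{pmatrix}$.
   Formalization: In the case α₂ = 0 the equation β̂β₁ᵀ = 1 − ÂA₁₁, of which the printed β̂ is the pseudo-inverse solution, is required to hold exactly; with only the printed conditions Â is underdetermined and Â₊ can have more than k states. *)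

theory Defs
  imports
    "Jordan_Normal_Form.Spectral_Radius"
    "Jordan_Normal_Form.DL_Rank"
begin

section \<open>Infinite matrices as operators on real square-summable sequences\<close>

type_synonym inf_mat = "nat \<Rightarrow> nat \<Rightarrow> real"

definition ell2 :: "(nat \<Rightarrow> real) set" where
  "ell2 = {x. summable (\<lambda>i. (x i)\<^sup>2)}"

definition ell2_norm :: "(nat \<Rightarrow> real) \<Rightarrow> real" where
  "ell2_norm x = sqrt (\<Sum>i. (x i)\<^sup>2)"

definition inf_mat_apply :: "inf_mat \<Rightarrow> (nat \<Rightarrow> real) \<Rightarrow> nat \<Rightarrow> real" where
  "inf_mat_apply M x i = (\<Sum>j. M i j * x j)"

text \<open>The summability clauses exclude the junk values of \<^const>\<open>suminf\<close>.
  The operator norm below is only meaningful for matrices with this property.\<close>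

definition bounded_operator :: "inf_mat \<Rightarrow> bool" where
  "bounded_operator M \<longleftrightarrow>
     (\<exists>C. \<forall>x\<in>ell2. (\<forall>i. summable (\<lambda>j. M i j * x j)) \<and> inf_mat_apply M x \<in> ell2 \<and>
        ell2_norm (inf_mat_apply M x) \<le> C * ell2_norm x)"

definition spectral_norm :: "inf_mat \<Rightarrow> real" where
  "spectral_norm M = Sup {ell2_norm (inf_mat_apply M x) | x. x \<in> ell2 \<and> ell2_norm x \<le> 1}"

text \<open>\<open>U\<close> stands for the matrix with columns \<open>0, \<dots>, n - 1\<close>; its other entries are ignored.\<close>

definition orthonormal_columns :: "nat \<Rightarrow> inf_mat \<Rightarrow> bool" where
  "orthonormal_columns n U \<longleftrightarrow>
     (\<forall>l<n. (\<lambda>i. U i l) \<in> ell2) \<and>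
     (\<forall>l<n. \<forall>l'<n. (\<Sum>i. U i l * U i l') = (if l = l' then 1 else 0))"

text \<open>\<open>M = U D V\<^sup>T\<close> with \<open>D = diag(\<sigma> 0, \<dots>, \<sigma> (n - 1))\<close>, so that \<open>\<sigma> 0 \<ge> \<dots> \<ge> \<sigma> (n - 1) > 0\<close>
  are the nonzero singular numbers of \<open>M\<close>, repeated according to multiplicity.\<close>

definition compact_svd :: "nat \<Rightarrow> inf_mat \<Rightarrow> inf_mat \<Rightarrow> (nat \<Rightarrow> real) \<Rightarrow> inf_mat \<Rightarrow> bool" where
  "compact_svd n M U \<sigma> V \<longleftrightarrow>
     orthonormal_columns n U \<and> orthonormal_columns n V \<and>
     (\<forall>l<n. \<sigma> l > 0) \<and> (\<forall>l l'. l \<le> l' \<and> l' < n \<longrightarrow> \<sigma> l' \<le> \<sigma> l) \<and>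
     (\<forall>i j. M i j = (\<Sum>l<n. U i l * \<sigma> l * V j l))"


section \<open>Weighted finite automata over a one-letter alphabet\<close>

record wfa =
  init_wt :: "real vec"
  trans_wt :: "real mat"
  final_wt :: "real vec"

definition is_wfa :: "nat \<Rightarrow> wfa \<Rightarrow> bool" where
  "is_wfa n W \<longleftrightarrow>
     init_wt W \<in> carrier_vec n \<and> trans_wt W \<in> carrier_mat n n \<and> final_wt W \<in> carrier_vec n"

definition wfa_fun :: "wfa \<Rightarrow> nat \<Rightarrow> real" where
  "wfa_fun W x = init_wt W \<bullet> ((trans_wt W ^\<^sub>m x) *\<^sub>v final_wt W)"

definition hankel :: "wfa \<Rightarrow> inf_mat" where
  "hankel W i j = wfa_fun W (i + j)"

text \<open>Row \<open>p\<close> of the forward matrix, \<open>\<alpha>\<^sup>T A\<^sup>p\<close>, and row \<open>s\<close> of the backward matrix,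
  \<open>(A\<^sup>s \<beta>)\<^sup>T\<close>, both written as vectors.\<close>

definition forward_row :: "wfa \<Rightarrow> nat \<Rightarrow> real vec" where
  "forward_row W p = (trans_wt W ^\<^sub>m p)\<^sup>T *\<^sub>v init_wt W"

definition backward_row :: "wfa \<Rightarrow> nat \<Rightarrow> real vec" where
  "backward_row W s = (trans_wt W ^\<^sub>m s) *\<^sub>v final_wt W"

text \<open>Rank of the matrix with infinitely many rows \<open>M 0, M 1, \<dots>\<close> of length \<open>n\<close>:
  the dimension of its row space.\<close>

definition (in vec_space) rank_of_rows :: "(nat \<Rightarrow> 'a vec) \<Rightarrow> nat" where
  "rank_of_rows M = vectorspace.dim class_ring (span_vs (range M))"

definition minimal_wfa :: "nat \<Rightarrow> wfa \<Rightarrow> bool" where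
  "minimal_wfa n W \<longleftrightarrow> is_wfa n W \<and>
     vec_space.rank_of_rows n (forward_row W) = n \<and>
     vec_space.rank_of_rows n (backward_row W) = n"

text \<open>SVA form, with the conventions for a symmetric Hankel matrix. The column \<open>V\<^sub>l\<close> is an
  eigenvector for \<open>\<mu> l\<close>, and \<open>V\<^sub>0, \<dots>, V\<^bsub>n-1\<^esub>\<close> is an orthonormal basis of the range of the
  Hankel matrix; hence \<open>\<mu>\<close> enumerates its nonzero eigenvalues with multiplicity, in the order of
  the singular numbers \<open>\<sigma> l = \<bar>\<mu> l\<bar>\<close>.\<close>

definition sva_form :: "nat \<Rightarrow> wfa \<Rightarrow> (nat \<Rightarrow> real) \<Rightarrow> bool" where
  "sva_form n W \<sigma> \<longleftrightarrow> minimal_wfa n W \<and>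
     (\<exists>U V \<mu>. compact_svd n (hankel W) U \<sigma> V \<and>
        (\<forall>p. \<forall>l<n. forward_row W p $ l = U p l * sqrt (\<sigma> l)) \<and>
        (\<forall>s. \<forall>l<n. backward_row W s $ l = V s l * sqrt (\<sigma> l)) \<and>
        (trans_wt W)\<^sup>T = trans_wt W \<and>
        (\<forall>l<n. \<mu> l \<noteq> 0 \<and> (\<forall>i. inf_mat_apply (hankel W) (\<lambda>j. V j l) i = \<mu> l * V i l)) \<and>
        (\<forall>l<n. init_wt W $ l = sgn (\<mu> l) * final_wt W $ l))"

text \<open>Renumbering of the states: the new state \<open>i\<close> is the old state \<open>\<pi> i\<close>.\<close>

definition reorder :: "nat \<Rightarrow> (nat \<Rightarrow> nat) \<Rightarrow> wfa \<Rightarrow> wfa" where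
  "reorder n \<pi> W =
     \<lparr>init_wt = vec n (\<lambda>i. init_wt W $ \<pi> i),
      trans_wt = mat n n (\<lambda>(i,j). trans_wt W $$ (\<pi> i, \<pi> j)),
      final_wt = vec n (\<lambda>i. final_wt W $ \<pi> i)\<rparr>"

text \<open>The automaton computing the difference \<open>wfa_fun W - wfa_fun W'\<close>.\<close>

definition wfa_diff :: "wfa \<Rightarrow> wfa \<Rightarrow> wfa" where
  "wfa_diff W W' =
     \<lparr>init_wt = init_wt W @\<^sub>v (- init_wt W'),
      trans_wt = four_block_mat (trans_wt W)
        (0\<^sub>m (dim_row (trans_wt W)) (dim_col (trans_wt W')))
        (0\<^sub>m (dim_row (trans_wt W')) (dim_col (trans_wt W))) (trans_wt W'),
      final_wt = final_wt W @\<^sub>v final_wt W'\<rparr>"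


section \<open>Pseudo-inverse and eigenvalues of real matrices\<close>

definition is_pseudo_inverse :: "real mat \<Rightarrow> real mat \<Rightarrow> bool" where
  "is_pseudo_inverse A X \<longleftrightarrow> X \<in> carrier_mat (dim_col A) (dim_row A) \<and>
     A * X * A = A \<and> X * A * X = X \<and> (A * X)\<^sup>T = A * X \<and> (X * A)\<^sup>T = X * A"

definition pseudo_inverse :: "real mat \<Rightarrow> real mat" where
  "pseudo_inverse A = (THE X. is_pseudo_inverse A X)"

definition row_mat :: "real vec \<Rightarrow> real mat" where
  "row_mat v = mat_of_rows (dim_vec v) [v]"

definition col_mat :: "real vec \<Rightarrow> real mat" where
  "col_mat v = mat_of_cols (dim_vec v) [v]"

abbreviation complexify :: "real mat \<Rightarrow> complex mat" where
  "complexify A \<equiv> map_mat complex_of_real A"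


section \<open>The auxiliary automaton with \<open>q = n - r\<close> states\<close>

text \<open>The column vectors \<open>\<beta>'\<close> and \<open>\<alpha>'\<close> are written as one-column matrices, and \<open>A\<^sub>2\<^sub>2\<close> does not
  enter. In the second case \<open>(1 - A' A\<^sub>1\<^sub>1) (\<beta>\<^sub>1\<^sup>T)\<^sup>+\<close> is the pseudo-inverse formula for the solution of
  \<open>\<beta>' \<beta>\<^sub>1\<^sup>T = 1 - A' A\<^sub>1\<^sub>1\<close>. That this equation is solvable is a restriction on \<open>A'\<close> which is not
  implied by \<open>A' A\<^sub>1\<^sub>2 = 0\<close>, so it is required explicitly. The corresponding equation in the first
  case, \<open>\<beta>' \<beta>\<^sub>2\<^sup>T = - A' A\<^sub>1\<^sub>2\<close>, needs no such requirement.\<close>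

definition auxiliary_wfa ::
  "nat \<Rightarrow> nat \<Rightarrow> real mat \<Rightarrow> real mat \<Rightarrow> real vec \<Rightarrow> real vec \<Rightarrow> real vec \<Rightarrow> real vec \<Rightarrow>
   real mat \<Rightarrow> wfa \<Rightarrow> bool" where
  "auxiliary_wfa q r A\<^sub>1\<^sub>1 A\<^sub>1\<^sub>2 \<alpha>\<^sub>1 \<alpha>\<^sub>2 \<beta>\<^sub>1 \<beta>\<^sub>2 R W' \<longleftrightarrow> is_wfa q W' \<and>
     (let \<alpha>' = init_wt W'; A' = trans_wt W'; \<beta>' = final_wt W' in
      if \<alpha>\<^sub>2 \<noteq> 0\<^sub>v r then
        col_mat \<beta>' = - (A' * A\<^sub>1\<^sub>2 * pseudo_inverse (row_mat \<beta>\<^sub>2)) \<and>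
        col_mat \<alpha>' = A'\<^sup>T * R * A\<^sub>1\<^sub>2 * pseudo_inverse (row_mat \<alpha>\<^sub>2) \<and>
        A' * (A\<^sub>1\<^sub>1 - A\<^sub>1\<^sub>2 * pseudo_inverse (row_mat \<beta>\<^sub>2) * row_mat \<beta>\<^sub>1) = 1\<^sub>m q
      else
        col_mat \<beta>' = (1\<^sub>m q - A' * A\<^sub>1\<^sub>1) * pseudo_inverse (row_mat \<beta>\<^sub>1) \<and>
        col_mat \<alpha>' = - ((R - A'\<^sup>T * R * A\<^sub>1\<^sub>1) * pseudo_inverse (row_mat \<alpha>\<^sub>1)) \<and>
        A' * A\<^sub>1\<^sub>2 = 0\<^sub>m q r \<and>
        col_mat \<beta>' * row_mat \<beta>\<^sub>1 = 1\<^sub>m q - A' * A\<^sub>1\<^sub>1)"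

end

theory Submission
  imports Defs
begin

text \<open>
  In SVA form the two Lyapunov equations \<open>D - A D A = \<alpha> \<alpha>\<^sup>T\<close> and \<open>D - A D A = \<beta> \<beta>\<^sup>T\<close> hold with the same
  \<open>A = A\<^sup>T\<close> and \<open>D = diag(\<sigma>\<^sub>i)\<close>, so \<open>\<alpha> = \<plusminus>\<beta>\<close> and the Hankel matrix is semidefinite. This forces
  every singular number to be simple, so that \<open>r = 1\<close>. Both cases of the construction then amount to
  the single Sylvester equation \<open>A' A + \<beta>' \<beta>\<^sup>T = (1 | 0)\<close>, which determines \<open>A'\<close> and \<open>\<beta>'\<close> and
  makes \<open>R A'\<close> symmetric.

  As in Glover's theory, the difference system with a suitable constant \<open>c\<close> added is all-pass: for
  the indefinite form \<open>V(x, x') = x\<^sup>T D x + 2 x\<^sup>T R x' - x'\<^sup>T D R x'\<close> and input \<open>u\<close>, output \<open>y\<close>,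
  one has \<open>V(next state) + y\<^sup>2 = V(state) + \<sigma>\<^sub>k\<^sup>2 u\<^sup>2\<close>. Steering the antistable part to \<open>0\<close> at time \<open>0\<close>
  and summing this balance over all times bounds \<open>H - G\<close> by \<open>\<sigma>\<^sub>k\<close>. The signs of \<open>V\<close> on the stable and
  antistable subspaces show that there are exactly \<open>k\<close> stable states. Finally \<open>G\<close> annihilates the
  singular vector of \<open>H\<close> for \<open>\<sigma>\<^sub>k\<close>, so the bound is attained.
\<close>

text \<open>The balance for V consists of six identities: three blocks of a Lyapunov equation for
  the symmetric matrix with blocks D, R, R, -D R, two state-input terms and one input-input term.
  Only the block for D is given; the other five have to be extracted from the Sylvester equation by
  cancellation. This works because the matrix formed by the first n - 1 rows of A and the row
  \<beta>^T is invertible: the Sylvester equation leaves only multiples of the last unit vector as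
  kernel vectors, and A would have that vector as an eigenvector for 1 or -1, which the convergent
  Gramian excludes. The estimate stays in the time domain. The antistable block is invertible, so
  its state can be prescribed at time 0 and its past computed backwards. The antistable state from
  which this past starts has energy at most 0, so it costs nothing.\<close>

section \<open>The algebra of finitely supported matrices\<close>

text \<open>Padding with zeros embeds all real matrices into one algebra. Matrix identities can be
  manipulated there by ring rewriting, without side conditions on dimensions.\<close>

typedef fmat = "{f :: nat \<Rightarrow> nat \<Rightarrow> real. \<exists>N. \<forall>i j. N \<le> i \<or> N \<le> j \<longrightarrow> f i j = 0}"
  morphisms entry Fmat
  by (rule exI[of _ "\<lambda>_ _. 0"]) simp

setup_lifting type_definition_fmat

lemma fmat_eqI: "(\<And>i j. entry x i j = entry y i j) \<Longrightarrow> x = y"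
  by (metis entry_inject ext)

instantiation fmat :: real_vector
begin

lift_definition zero_fmat :: fmat is "\<lambda>_ _. 0" by simp

lift_definition plus_fmat :: "fmat \<Rightarrow> fmat \<Rightarrow> fmat" is "\<lambda>f g i j. f i j + g i j"
proof -
  fix f g :: "nat \<Rightarrow> nat \<Rightarrow> real"
  assume "\<exists>N. \<forall>i j. N \<le> i \<or> N \<le> j \<longrightarrow> f i j = 0" "\<exists>N. \<forall>i j. N \<le> i \<or> N \<le> j \<longrightarrow> g i j = 0"
  then obtain N M where "\<forall>i j. N \<le> i \<or> N \<le> j \<longrightarrow> f i j = 0"
    "\<forall>i j. M \<le> i \<or> M \<le> j \<longrightarrow> g i j = 0" by blast
  then show "\<exists>N. \<forall>i j. N \<le> i \<or> N \<le> j \<longrightarrow> f i j + g i j = 0"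
    by (intro exI[of _ "max N M"]) auto
qed

lift_definition uminus_fmat :: "fmat \<Rightarrow> fmat" is "\<lambda>f i j. - f i j" by simp

lift_definition scaleR_fmat :: "real \<Rightarrow> fmat \<Rightarrow> fmat" is "\<lambda>c f i j. c * f i j" by auto

definition minus_fmat :: "fmat \<Rightarrow> fmat \<Rightarrow> fmat" where "minus_fmat x y = x + - y"

instance
  by standard
    (auto intro!: fmat_eqI simp: plus_fmat.rep_eq zero_fmat.rep_eq uminus_fmat.rep_eq
      scaleR_fmat.rep_eq minus_fmat_def algebra_simps)

end

lift_definition tr :: "fmat \<Rightarrow> fmat" is "\<lambda>f i j. f j i" by auto

text \<open>An infinite sum avoids choosing a bound on the supports inside the definition. All but
  finitely many terms vanish, and \<open>entry_times\<close> recovers a finite sum for any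
  sufficient bound.\<close>

lift_definition times_fmat' :: "fmat \<Rightarrow> fmat \<Rightarrow> fmat" is "\<lambda>f g i j. \<Sum>k. f i k * g k j"
proof -
  fix f g :: "nat \<Rightarrow> nat \<Rightarrow> real"
  assume "\<exists>N. \<forall>i j. N \<le> i \<or> N \<le> j \<longrightarrow> f i j = 0" "\<exists>N. \<forall>i j. N \<le> i \<or> N \<le> j \<longrightarrow> g i j = 0"
  then obtain N M where NM: "\<forall>i j. N \<le> i \<or> N \<le> j \<longrightarrow> f i j = 0"
    "\<forall>i j. M \<le> i \<or> M \<le> j \<longrightarrow> g i j = 0" by blast
  have "(\<Sum>k. f i k * g k j) = 0" if "max N M \<le> i \<or> max N M \<le> j" for i j
  proof -
    have "(\<lambda>k. f i k * g k j) = (\<lambda>k. 0)"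
      using that NM by (intro ext) auto
    then show ?thesis by simp
  qed
  then show "\<exists>N. \<forall>i j. N \<le> i \<or> N \<le> j \<longrightarrow> (\<Sum>k. f i k * g k j) = 0" by blast
qed

lemma entry_times':
  assumes "\<And>k. N \<le> k \<Longrightarrow> entry x i k = 0 \<or> entry y k j = 0"
  shows "entry (times_fmat' x y) i j = (\<Sum>k<N. entry x i k * entry y k j)"
  unfolding times_fmat'.rep_eq
  by (rule suminf_finite) (use assms in \<open>auto simp: not_less\<close>)

lemma entry_bounded: "\<exists>N. \<forall>i j. N \<le> i \<or> N \<le> j \<longrightarrow> entry x i j = 0"
  using entry[of x] by simp

lemma ex_common_bound:
  "\<exists>N. \<forall>x\<in>{x, y, z}. \<forall>i j. N \<le> i \<or> N \<le> j \<longrightarrow> entry x i j = 0"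
proof -
  obtain N M L where
    "\<forall>i j. N \<le> i \<or> N \<le> j \<longrightarrow> entry x i j = 0" "\<forall>i j. M \<le> i \<or> M \<le> j \<longrightarrow> entry y i j = 0"
    "\<forall>i j. L \<le> i \<or> L \<le> j \<longrightarrow> entry z i j = 0"
    using entry_bounded by metis
  then show ?thesis by (intro exI[of _ "max N (max M L)"]) auto
qed

instantiation fmat :: real_algebra
begin

definition times_fmat :: "fmat \<Rightarrow> fmat \<Rightarrow> fmat" where "times_fmat = times_fmat'"

instance
proof
  fix x y z :: fmat and c :: real
  obtain N where N: "\<forall>x\<in>{x, y, z}. \<forall>i j. N \<le> i \<or> N \<le> j \<longrightarrow> entry x i j = 0"
    using ex_common_bound by blast
  have e: "entry (times_fmat' u v) i j = (\<Sum>k<N. entry u i k * entry v k j)"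
    if "(\<forall>i j. N \<le> i \<or> N \<le> j \<longrightarrow> entry u i j = 0) \<or> (\<forall>i j. N \<le> i \<or> N \<le> j \<longrightarrow> entry v i j = 0)"
    for u v i j
    using that by (intro entry_times') auto
  have b: "\<forall>i j. N \<le> i \<or> N \<le> j \<longrightarrow> entry x i j = 0" "\<forall>i j. N \<le> i \<or> N \<le> j \<longrightarrow> entry y i j = 0"
    "\<forall>i j. N \<le> i \<or> N \<le> j \<longrightarrow> entry z i j = 0"
    using N by blast+
  note es = e[OF disjI1[OF b(1)]] e[OF disjI1[OF b(2)]] e[OF disjI2[OF b(2)]] e[OF disjI2[OF b(3)]]
  show "x * y * z = x * (y * z)"
  proof (rule fmat_eqI)
    fix i j
    have "entry (x * y * z) i j = (\<Sum>k<N. \<Sum>l<N. entry x i l * entry y l k * entry z k j)"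
      unfolding times_fmat_def by (simp add: es sum_distrib_right)
    also have "\<dots> = (\<Sum>l<N. \<Sum>k<N. entry x i l * entry y l k * entry z k j)"
      by (rule sum.swap)
    also have "\<dots> = entry (x * (y * z)) i j"
      unfolding times_fmat_def by (simp add: es sum_distrib_left mult.assoc)
    finally show "entry (x * y * z) i j = entry (x * (y * z)) i j" .
  qed
  show "(x + y) * z = x * z + y * z"
    unfolding times_fmat_def
    by (rule fmat_eqI) (simp add: es plus_fmat.rep_eq sum.distrib algebra_simps)
  show "x * (y + z) = x * y + x * z"
    unfolding times_fmat_def
    by (rule fmat_eqI) (simp add: es plus_fmat.rep_eq sum.distrib algebra_simps)
  show "(c *\<^sub>R x) * y = c *\<^sub>R (x * y)"
    unfolding times_fmat_def
    by (rule fmat_eqI) (simp add: es scaleR_fmat.rep_eq sum_distrib_left mult.assoc)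
  show "x * (c *\<^sub>R y) = c *\<^sub>R (x * y)"
    unfolding times_fmat_def
    by (rule fmat_eqI) (simp add: es scaleR_fmat.rep_eq sum_distrib_left algebra_simps)
qed

end

lemma entry_times:
  assumes "\<And>k. N \<le> k \<Longrightarrow> entry x i k = 0 \<or> entry y k j = 0"
  shows "entry (x * y) i j = (\<Sum>k<N. entry x i k * entry y k j)"
  using entry_times'[OF assms] by (simp add: times_fmat_def)

lemma entry_minus: "entry (x - y) i j = entry x i j - entry y i j"
  unfolding minus_fmat_def by (simp only: plus_fmat.rep_eq uminus_fmat.rep_eq diff_conv_add_uminus)

lemmas entry_simps = plus_fmat.rep_eq zero_fmat.rep_eq uminus_fmat.rep_eq scaleR_fmat.rep_eq
  entry_minus tr.rep_eq

lemma tr_simps [simp]: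
  "tr (tr x) = x" "tr (x + y) = tr x + tr y" "tr (x - y) = tr x - tr y" "tr (- x) = - tr x"
  "tr (c *\<^sub>R x) = c *\<^sub>R tr x" "tr 0 = 0"
  by (rule fmat_eqI; simp add: entry_simps)+

lemma tr_times [simp]: "tr (x * y) = tr y * tr x"
  unfolding times_fmat_def
  by (rule fmat_eqI) (simp add: tr.rep_eq times_fmat'.rep_eq mult.commute)

text \<open>The 1 x 1 identity. Multiples of it represent numbers, and columns are the elements that
  it fixes from the right, so statements about vectors and scalars become ring identities.\<close>

lift_definition unit00 :: fmat is "\<lambda>i j. if i = 0 \<and> j = 0 then 1 else 0"
  by (rule exI[of _ 1]) auto

lemma entry_times_unit00: "entry (x * unit00) i j = (if j = 0 then entry x i 0 else 0)"
  by (subst entry_times[of 1]) (auto simp: unit00.rep_eq)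

lemma entry_unit00_times: "entry (unit00 * x) i j = (if i = 0 then entry x 0 j else 0)"
  by (subst entry_times[of 1]) (auto simp: unit00.rep_eq)

lemma tr_unit00 [simp]: "tr unit00 = unit00"
  by (rule fmat_eqI) (auto simp: tr.rep_eq unit00.rep_eq)

definition is_col :: "fmat \<Rightarrow> bool" where "is_col x \<longleftrightarrow> x * unit00 = x"

lemma is_col_entry: "is_col x \<longleftrightarrow> (\<forall>i j. 0 < j \<longrightarrow> entry x i j = 0)"
proof
  assume "is_col x"
  then show "\<forall>i j. 0 < j \<longrightarrow> entry x i j = 0"
    unfolding is_col_def by (metis entry_times_unit00 less_irrefl)
next
  assume "\<forall>i j. 0 < j \<longrightarrow> entry x i j = 0"
  then show "is_col x"
    unfolding is_col_def by (intro fmat_eqI) (auto simp: entry_times_unit00)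
qed

lemma is_col_mult: "is_col y \<Longrightarrow> is_col (x * y)"
  by (simp add: is_col_def mult.assoc)

lemma is_col_add: "is_col x \<Longrightarrow> is_col y \<Longrightarrow> is_col (x + y)"
  by (simp add: is_col_def algebra_simps)

lemma is_col_minus: "is_col x \<Longrightarrow> is_col y \<Longrightarrow> is_col (x - y)"
  by (simp add: is_col_def algebra_simps)

lemma is_col_scaleR: "is_col x \<Longrightarrow> is_col (c *\<^sub>R x)"
  by (simp add: is_col_def algebra_simps)

lemma is_col_tr: "is_col x \<Longrightarrow> unit00 * tr x = tr x"
  unfolding is_col_def by (metis tr_times tr_unit00)

lemma entry_col_row:
  assumes "is_col x"
  shows "entry (x * y) i j = entry x i 0 * entry y 0 j"
  by (subst entry_times[of 1]) (use assms in \<open>auto simp: is_col_entry\<close>)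

lemma col_row_eq_0:
  assumes "is_col x" "x \<noteq> 0" "is_col y" "x * tr y = 0"
  shows "y = 0"
proof -
  obtain i j where "entry x i j \<noteq> 0"
    using assms(2) by (metis fmat_eqI zero_fmat.rep_eq)
  then have i: "entry x i 0 \<noteq> 0"
    using assms(1) by (cases "j = 0") (auto simp: is_col_entry)
  have "entry y k 0 = 0" for k
    using assms(4) i entry_col_row[OF assms(1), of "tr y" i k]
    by (auto simp: zero_fmat.rep_eq tr.rep_eq)
  then show ?thesis
    using assms(3) unfolding is_col_entry
    by (intro fmat_eqI) (metis neq0_conv zero_fmat.rep_eq)
qed

text \<open>The source of the feedthrough constant: comparing one column of the two rank-one
  products at an index where \<open>x\<close> is nonzero gives the factor.\<close>

lemma col_row_symmetric:
  assumes "is_col x" "x \<noteq> 0" "is_col y" "y * tr x = x * tr y"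
  shows "\<exists>c. y = c *\<^sub>R x"
proof -
  obtain i j where "entry x i j \<noteq> 0"
    using assms(2) by (metis fmat_eqI zero_fmat.rep_eq)
  then have i: "entry x i 0 \<noteq> 0"
    using assms(1) by (cases "j = 0") (auto simp: is_col_entry)
  have "entry y k 0 = entry y i 0 / entry x i 0 * entry x k 0" for k
  proof -
    have "entry y k 0 * entry x i 0 = entry x k 0 * entry y i 0"
      using arg_cong[OF assms(4), of "\<lambda>z. entry z k i"]
      unfolding entry_col_row[OF assms(1)] entry_col_row[OF assms(3)] tr.rep_eq .
    then show ?thesis using i by (simp add: field_simps)
  qed
  then have "entry y k l = entry ((entry y i 0 / entry x i 0) *\<^sub>R x) k l" for k l
    unfolding scaleR_fmat.rep_eq
    by (metis assms(1,3) is_col_entry mult_zero_right neq0_conv)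
  then show ?thesis by (metis fmat_eqI)
qed

lemma row_col_scalar:
  assumes "is_col x" "is_col y"
  shows "tr x * y = entry (tr x * y) 0 0 *\<^sub>R unit00"
proof (rule fmat_eqI)
  fix i j
  have "tr x * y = unit00 * (tr x * y) * unit00"
    using assms is_col_tr[of x] by (metis is_col_def mult.assoc)
  then have "entry (tr x * y) i j = entry (unit00 * (tr x * y) * unit00) i j"
    by simp
  also have "\<dots> = entry (entry (tr x * y) 0 0 *\<^sub>R unit00) i j"
    by (simp only: entry_times_unit00 entry_unit00_times scaleR_fmat.rep_eq unit00.rep_eq) simp
  finally show "entry (tr x * y) i j = entry (entry (tr x * y) 0 0 *\<^sub>R unit00) i j" .
qed

lemma row_col_commute:
  assumes "is_col x" "is_col y"
  shows "tr x * y = tr y * x"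
proof -
  have "tr (tr x * y) = tr (entry (tr x * y) 0 0 *\<^sub>R unit00)"
    using row_col_scalar[OF assms] by (rule arg_cong)
  also have "\<dots> = entry (tr x * y) 0 0 *\<^sub>R unit00"
    by (simp only: tr_simps tr_unit00)
  also have "\<dots> = tr x * y"
    using row_col_scalar[OF assms] by (rule sym)
  finally show ?thesis by simp
qed

section \<open>The all-pass dilation\<close>

text \<open>\<open>P\<close> is the projection onto the coordinates other than that of the singular
  number \<open>s\<close>, and \<open>X\<close> is R padded by a zero there. Because
  \<open>s\<^sup>2 - D\<^sup>2\<close> also vanishes at that coordinate, \<open>X\<close> acts as
  \<open>s\<^sup>2 - D\<^sup>2\<close> on all of \<open>A\<close> and \<open>b\<close>.
  \<open>Z\<close> witnesses that the rows of \<open>P * A\<close> together with \<open>tr b\<close>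
  can be inverted; its transpose is used to cancel \<open>A\<close> from the left.\<close>

locale all_pass =
  fixes A D P X A' b b' Z :: fmat and s :: real
  assumes symmetric [simp]: "tr A = A" "tr D = D" "tr P = P" "tr X = X"
    and lyapunov: "D = A * D * A + b * tr b"
    and sylvester: "P = A' * A + b' * tr b"
    and DX: "D * X = X * D" "P * X = X" "X * P = X" "P * D = D * P" "P * A' = A'" "A' * P = A'" "P * P = P"
    and P_b': "P * b' = b'"
    and X: "X * A = s\<^sup>2 *\<^sub>R A - D * D * A" "X * b = s\<^sup>2 *\<^sub>R b - D * D * b"
    and Z: "P * A * Z = P" "tr b * Z = 0"
    and cols: "is_col b" "is_col b'"
    and b_nonzero: "b \<noteq> 0"
begin

lemma P_tr_A': "P * tr A' = tr A'" "tr A' * P = tr A'"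
  using arg_cong[OF DX(6), of tr] arg_cong[OF DX(5), of tr] by simp_all

lemma absorb:
  "P * (X * w) = X * w" "X * (P * w) = X * w" "P * (D * w) = D * (P * w)"
  "D * (X * w) = X * (D * w)" "P * (A' * w) = A' * w" "A' * (P * w) = A' * w"
  "P * (P * w) = P * w" "P * (b' * w) = b' * w" "P * (tr A' * w) = tr A' * w"
  "tr A' * (P * w) = tr A' * w"
  using DX P_b' P_tr_A' by (metis mult.assoc)+

lemma sylvester_tr: "P = A * tr A' + b * tr b'"
  using arg_cong[OF sylvester, of tr] by simp

lemma Z_tr: "tr Z * A * P = P" "tr Z * b = 0"
  using arg_cong[OF Z(1), of tr] arg_cong[OF Z(2), of tr] by (simp_all add: mult.assoc)

text \<open>The commutator of \<open>A\<close> with \<open>X\<close> is that of \<open>D * D\<close>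
  with \<open>A\<close>. Expanding the last factor of \<open>A * D * D\<close> by the Lyapunov
  equation moves both factors \<open>D\<close> past \<open>A\<close> at the price of two rank-one
  terms.\<close>

lemma commutator: "A * X - X * A = b * (tr b * D * A) - A * D * b * tr b"
proof -
  have AX: "A * X = s\<^sup>2 *\<^sub>R A - A * D * D"
    using arg_cong[OF X(1), of tr] by (simp add: mult.assoc)
  have 1: "A * D * A = D - b * tr b" using lyapunov by (simp add: algebra_simps)
  have "A * D * D = A * D * (A * D * A + b * tr b)" using lyapunov by simp
  also have "\<dots> = (A * D * A) * D * A + A * D * b * tr b" by (simp add: algebra_simps)
  also have "\<dots> = D * D * A - b * (tr b * D * A) + A * D * b * tr b"
    unfolding 1 by (simp add: algebra_simps)
  finally show ?thesis unfolding AX X(1) by (simp add: algebra_simps)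
qed

text \<open>Multiplying the Sylvester equation by \<open>Z\<close> from the right removes the term
  with \<open>b'\<close>, so \<open>A'\<close> is determined by \<open>A\<close> and
  \<open>b\<close> alone.\<close>

lemma A'_eq: "A' = P * Z"
proof -
  have "P * Z = A' * (P * A * Z) + b' * (tr b * Z)"
    using arg_cong[OF sylvester, of "\<lambda>x. x * Z"] DX(6)
    by (simp add: algebra_simps) (metis mult.assoc)
  then show ?thesis by (simp add: Z DX)
qed

text \<open>Both sides are sandwiches between \<open>tr Z\<close> and \<open>Z\<close>, of
  \<open>A * X\<close> and of \<open>X * A\<close>. Each term of the commutator has \<open>b\<close>
  on the left or \<open>tr b\<close> on the right, and these are annihilated by \<open>tr Z\<close>
  and \<open>Z\<close>.\<close>

lemma X_A': "X * A' = tr A' * X"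
proof -
  have XZ: "X * A' = X * Z" by (metis A'_eq DX(3) mult.assoc)
  have "tr Z * A * X = X" by (metis DX(2) Z_tr(1) mult.assoc)
  then have 1: "X * A' = tr Z * (A * X) * Z" by (metis XZ mult.assoc)
  have 2: "tr A' * X = tr Z * (X * A) * Z"
    using arg_cong[OF 1, of tr] by (simp add: mult.assoc)
  have "X * A' - tr A' * X = tr Z * (A * X - X * A) * Z"
    unfolding 1 2 by (simp add: algebra_simps)
  also have "\<dots> = (tr Z * b) * (tr b * D * A) * Z - tr Z * A * D * b * (tr b * Z)"
    unfolding commutator by (simp add: algebra_simps)
  also have "\<dots> = 0" by (simp only: Z Z_tr mult_zero_left mult_zero_right diff_self)
  finally show ?thesis by simp
qed

text \<open>The off-diagonal block of the Lyapunov equation for V. The transposed Sylvester equation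
  contains \<open>tr A'\<close>, and the symmetry of \<open>X * A'\<close> converts it.\<close>

lemma X_expand: "X = A * X * A' + b * tr b' * X"
  using arg_cong[OF sylvester_tr, of "\<lambda>x. x * X"]
  by (simp add: DX X_A' algebra_simps)

lemma X_expand_tr: "X = tr A' * X * A + X * b' * tr b"
  using arg_cong[OF X_expand, of tr] by (simp add: algebra_simps)

text \<open>The constant \<open>c\<close> is the direct input-output term of the all-pass system, up to sign the
  constant Fourier coefficient of its transfer function, which the Hankel matrix does not see.\<close>

lemma ex_feedthrough: "\<exists>c. A * D * b + A * X * b' = - c *\<^sub>R b"
proof -
  \<comment> \<open>Expanding \<open>A * X\<close> from the right and \<open>X * A\<close> from the
    left produces the common term \<open>A * X * A' * A\<close>. It drops out of the commutator, and
    what remains says that a product of a column with \<open>tr b\<close> is symmetric.\<close>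
  have "A * X = A * X * P" by (simp add: DX mult.assoc)
  also have "\<dots> = A * X * A' * A + A * X * b' * tr b"
    by (subst sylvester) (simp add: algebra_simps)
  finally have 1: "A * X * A' * A + A * X * b' * tr b = A * X" by (rule sym)
  have 2: "A * X * A' * A + b * tr b' * X * A = X * A"
    by (subst (3) X_expand) (simp add: algebra_simps)
  have "A * X * b' * tr b - b * tr b' * X * A
      = (A * X * A' * A + A * X * b' * tr b) - (A * X * A' * A + b * tr b' * X * A)"
    by simp
  also have "\<dots> = b * (tr b * D * A) - A * D * b * tr b"
    unfolding 1 2 by (rule commutator)
  finally have "A * X * b' * tr b - b * tr b' * X * A = b * (tr b * D * A) - A * D * b * tr b" .
  then have "(A * D * b + A * X * b') * tr b = b * tr (A * D * b + A * X * b')"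
    by (simp add: algebra_simps)
  then obtain c where "A * D * b + A * X * b' = c *\<^sub>R b"
    using col_row_symmetric[of b "A * D * b + A * X * b'"] cols b_nonzero
    by (auto simp: is_col_mult is_col_add)
  then show ?thesis by (intro exI[of _ "- c"]) simp
qed

definition c :: real where "c = (SOME c. A * D * b + A * X * b' = - c *\<^sub>R b)"

lemma c: "A * D * b = - A * X * b' - c *\<^sub>R b"
proof -
  have "A * D * b = (A * D * b + A * X * b') - A * X * b'" by simp
  also have "\<dots> = - c *\<^sub>R b - A * X * b'"
    using someI_ex[OF ex_feedthrough] unfolding c_def[symmetric] by (simp only:)
  finally show ?thesis by simp
qed

text \<open>The first equation, multiplied by \<open>X\<close>, is the block of the Lyapunov
  equation for V on the auxiliary states; the second is the corresponding state-input term. The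
  residuals \<open>w\<close> (transposed) and \<open>p\<close> are eliminated together: two
  expansions of \<open>D * tr A'\<close> give \<open>A * w = b * tr p\<close>, then
  \<open>tr Z\<close> cancels \<open>A\<close> and kills \<open>b\<close>, so \<open>w = 0\<close>,
  and \<open>p = 0\<close> because \<open>b\<close> is nonzero.\<close>

lemma dual_equations:
  "A' * D * A' = P * D + b' * tr b' * X"
  "A' * b = A' * D * b' - c *\<^sub>R b'"
proof -
  define w where "w = P * D - tr A' * D * tr A' + X * b' * tr b'"
  define p where "p = A' * D * b' - c *\<^sub>R b' - A' * b"
  have Pw: "P * w = w"
    by (simp add: w_def DX P_tr_A' P_b' absorb algebra_simps)
  have P1: "A * tr A' = P - b * tr b'" using sylvester_tr by (simp add: algebra_simps)
  have 1: "A * D * A * tr A' = A * D * P - A * D * b * tr b'"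
    using arg_cong[OF P1, of "\<lambda>x. A * D * x"] by (simp add: algebra_simps)
  have "D * tr A' = (A * D * A + b * tr b) * tr A'" using lyapunov by simp
  also have "\<dots> = A * D * P - A * D * b * tr b' + b * tr b * tr A'"
    using 1 by (simp add: algebra_simps)
  finally have 2: "D * tr A' = A * D * P + A * X * b' * tr b' + c *\<^sub>R b * tr b' + b * tr b * tr A'"
    unfolding c by (simp add: algebra_simps)
  have "D * tr A' = P * D * tr A'"
    by (simp add: DX absorb P_tr_A' mult.assoc)
  also have "\<dots> = A * (tr A' * D * tr A') + b * tr b' * D * tr A'"
    by (subst sylvester_tr) (simp add: algebra_simps)
  finally have 3: "D * tr A' = A * (tr A' * D * tr A') + b * tr b' * D * tr A'" .
  have Aw: "A * w = b * tr p"
  proof -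
    have "A * w - b * tr p = (A * D * P + A * X * b' * tr b' + c *\<^sub>R b * tr b' + b * tr b * tr A')
        - (A * (tr A' * D * tr A') + b * tr b' * D * tr A')"
      by (simp add: w_def p_def DX algebra_simps)
    also have "\<dots> = 0" unfolding 2[symmetric] 3[symmetric] by simp
    finally show ?thesis by simp
  qed
  have "w = tr Z * A * P * w" by (simp add: Z_tr Pw)
  also have "\<dots> = tr Z * (A * w)" by (simp add: Pw mult.assoc)
  also have "\<dots> = (tr Z * b) * tr p" unfolding Aw by (simp add: mult.assoc)
  finally have w: "w = 0" by (simp add: Z_tr)
  have "is_col p" unfolding p_def
    by (intro is_col_minus is_col_mult is_col_scaleR cols)
  then have p: "p = 0"
    using Aw w col_row_eq_0[of b p] cols b_nonzero by simp
  have "tr w = 0" using w by simp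
  then show "A' * D * A' = P * D + b' * tr b' * X"
    by (simp add: w_def DX algebra_simps)
  show "A' * b = A' * D * b' - c *\<^sub>R b'" using p by (simp add: p_def algebra_simps)
qed

text \<open>The input-input term of the balance. The vectors \<open>y\<close> and \<open>x\<close>
  of the proof are chosen so that \<open>A * y\<close> and \<open>A' * x\<close> are multiples of
  \<open>b\<close> and \<open>b'\<close> with the same factor \<open>- c\<close>. Evaluating
  \<open>D * y\<close> by the Lyapunov equation, and again through
  \<open>X = s\<^sup>2 - D\<^sup>2\<close> and \<open>X_expand\<close>, gives \<open>b\<close> times
  the defect \<open>e\<close>.\<close>

lemma feedthrough_equation:
  "tr b * D * b + 2 *\<^sub>R (tr b * X * b') - tr b' * D * X * b' + c\<^sup>2 *\<^sub>R unit00 = s\<^sup>2 *\<^sub>R unit00"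
proof -
  define e where "e = tr b * D * b + 2 *\<^sub>R (tr b * X * b') - tr b' * D * X * b' + c\<^sup>2 *\<^sub>R unit00
    - s\<^sup>2 *\<^sub>R unit00"
  define y where "y = D * b + X * b'"
  define x where "x = b - D * b'"
  have "A * y = A * D * b + A * X * b'" by (simp add: y_def algebra_simps)
  then have Ay: "A * y = - c *\<^sub>R b" unfolding c by simp
  have "A' * x = A' * b - A' * D * b'" by (simp add: x_def algebra_simps)
  then have A'x: "A' * x = - c *\<^sub>R b'" unfolding dual_equations(2) by simp
  have "D * y = A * D * (A * y) + b * (tr b * y)"
    using arg_cong[OF lyapunov, of "\<lambda>z. z * y"] by (simp add: algebra_simps)
  also have "\<dots> = - c *\<^sub>R (A * D * b) + b * (tr b * y)" unfolding Ay by simp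
  also have "\<dots> = c *\<^sub>R (A * X * b') + c\<^sup>2 *\<^sub>R b + b * (tr b * y)"
    unfolding c by (simp add: algebra_simps power2_eq_square)
  finally have Dy: "D * y = c *\<^sub>R (A * X * b') + c\<^sup>2 *\<^sub>R b + b * (tr b * y)" .
  have "D * y = s\<^sup>2 *\<^sub>R b - X * x"
    by (simp add: y_def x_def algebra_simps X DX absorb)
  also have "X * x = A * X * (A' * x) + b * (tr b' * X * x)"
    by (subst X_expand) (simp add: algebra_simps)
  also have "\<dots> = - c *\<^sub>R (A * X * b') + b * (tr b' * X * x)" unfolding A'x by simp
  finally have Dy': "D * y = s\<^sup>2 *\<^sub>R b - (- c *\<^sub>R (A * X * b') + b * (tr b' * X * x))" .
  have "b * (tr b * y + tr b' * X * x + c\<^sup>2 *\<^sub>R unit00 - s\<^sup>2 *\<^sub>R unit00)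
    = c *\<^sub>R (A * X * b') + c\<^sup>2 *\<^sub>R b + b * (tr b * y)
      - (s\<^sup>2 *\<^sub>R b - (- c *\<^sub>R (A * X * b') + b * (tr b' * X * x)))"
    using cols(1) by (simp add: algebra_simps is_col_def)
  also have "\<dots> = 0" unfolding Dy[symmetric] Dy'[symmetric] by simp
  finally have "b * (tr b * y + tr b' * X * x + c\<^sup>2 *\<^sub>R unit00 - s\<^sup>2 *\<^sub>R unit00) = 0" .
  moreover have "tr b' * X * b = tr b * X * b'"
    using row_col_commute[of "X * b'" b] cols by (simp add: is_col_mult mult.assoc)
  ultimately have "b * e = 0"
    by (simp add: e_def y_def x_def algebra_simps scaleR_2 DX absorb)
  \<comment> \<open>The cancellation lemma for \<open>b\<close> expects a row on its right; symmetry
    lets the scalar \<open>e\<close> serve as one.\<close>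
  moreover have "tr e = e"
  proof -
    have "tr b' * (X * D * b') = tr b' * (D * X * b')" by (simp add: DX)
    moreover have "tr b' * X * b = tr b * X * b'"
      using row_col_commute[of "X * b'" b] cols by (simp add: is_col_mult mult.assoc)
    ultimately show ?thesis by (simp add: e_def algebra_simps)
  qed
  moreover have "is_col e"
    unfolding e_def using cols
    by (intro is_col_minus is_col_add is_col_scaleR is_col_mult) (auto simp: is_col_def fmat_eqI entry_unit00_times unit00.rep_eq)
  ultimately have "e = 0" using col_row_eq_0[of b e] cols b_nonzero by simp
  then show ?thesis by (simp add: e_def)
qed

definition storage :: "fmat \<Rightarrow> fmat \<Rightarrow> fmat" where
  "storage x y = tr x * D * x + tr x * X * y + tr y * X * x - tr y * D * X * y"

lemma storage_step:
  fixes x x' u :: fmat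
  assumes u: "unit00 * u = u"
  defines "y \<equiv> tr b * x + tr b' * X * x' + c *\<^sub>R u"
  shows "storage (A * x + b * u) (A' * x' + b' * u) + tr y * y = storage x x' + s\<^sup>2 *\<^sub>R (tr u * u)"
proof -
  \<comment> \<open>The coefficients of the balance as right-associated rewrite rules:
    \<open>r1\<close>, \<open>r2\<close>, \<open>r2'\<close>, \<open>r4\<close> for pairs of states,
    \<open>r3\<close>, \<open>r3'\<close>, \<open>r5\<close>, \<open>r5'\<close> for a state and the
    input, \<open>r6\<close> for the square of the input.\<close>
  have r1: "A * (D * (A * w)) = D * w - b * (tr b * w)" for w
    using arg_cong[OF lyapunov, of "\<lambda>x. x * w"] by (simp add: algebra_simps)
  have r2: "A * (X * (A' * w)) = X * w - b * (tr b' * (X * w))" for w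
    using arg_cong[OF X_expand, of "\<lambda>x. x * w"] by (simp add: algebra_simps)
  have r2': "tr A' * (X * (A * w)) = X * w - X * (b' * (tr b * w))" for w
    using arg_cong[OF X_expand_tr, of "\<lambda>x. x * w"] by (simp add: algebra_simps)
  have r3: "A * (D * (b * w)) = - A * (X * (b' * w)) - c *\<^sub>R (b * w)" for w
    using arg_cong[OF c, of "\<lambda>x. x * w"] by (simp add: algebra_simps)
  have r3': "tr b * (D * (A * w)) = - tr b' * (X * (A * w)) - c *\<^sub>R (tr b * w)" for w
    using arg_cong[OF c, of "\<lambda>x. tr x * w"] by (simp add: algebra_simps)
  have r4: "tr A' * (D * (X * (A' * w))) = D * (X * w) + X * (b' * (tr b' * (X * w)))" for w
  proof -
    have "tr A' * (D * (X * (A' * w))) = tr (A' * D * A') * (X * w)"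
      using arg_cong[OF X_A', of "\<lambda>x. tr A' * D * x * w"] by (simp add: mult.assoc)
    also have "\<dots> = D * (P * X) * w + X * b' * tr b' * X * w"
      unfolding dual_equations by (simp add: algebra_simps)
    finally show ?thesis by (simp add: DX absorb mult.assoc)
  qed
  have e: "tr A' * X * b = tr A' * D * X * b' - c *\<^sub>R (X * b')"
  proof -
    have "tr A' * X * b = X * (A' * D * b') - c *\<^sub>R (X * b')"
      using arg_cong[OF dual_equations(2), of "\<lambda>x. X * x"] X_A' by (simp add: algebra_simps)
        (metis mult.assoc)
    also have "X * (A' * D * b') = tr A' * D * X * b'"
      by (metis DX(1) X_A' mult.assoc)
    finally show ?thesis .
  qed
  have r5: "tr A' * (X * (b * w)) = tr A' * (D * (X * (b' * w))) - c *\<^sub>R (X * (b' * w))" for w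
    using arg_cong[OF e, of "\<lambda>x. x * w"] by (simp add: algebra_simps)
  have r5': "tr b * (X * (A' * w)) = tr b' * (D * (X * (A' * w))) - c *\<^sub>R (tr b' * (X * w))" for w
    using arg_cong[OF e, of "\<lambda>x. tr x * w"] by (simp add: algebra_simps)
      (metis DX(1) mult.assoc)
  have "tr b' * X * b = tr b * X * b'"
    using row_col_commute[of "X * b'" b] cols by (simp add: is_col_mult mult.assoc)
  then have r6a: "tr b' * (X * (b * w)) = tr b * (X * (b' * w))" for w
    by (metis mult.assoc)
  have r6: "tr b * (D * (b * u)) = s\<^sup>2 *\<^sub>R u - 2 *\<^sub>R (tr b * (X * (b' * u)))
      + tr b' * (D * (X * (b' * u))) - c\<^sup>2 *\<^sub>R u"
    using arg_cong[OF feedthrough_equation, of "\<lambda>x. x * u"] u by (simp add: algebra_simps)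
  show ?thesis
    unfolding storage_def y_def
    by (simp add: algebra_simps r1 r2 r2' r3 r3' r4 r5 r5' r6a r6 scaleR_2 power2_eq_square)
qed

end

section \<open>Transfer from matrices with dimensions\<close>

lift_definition of_mat :: "real mat \<Rightarrow> fmat" is
  "\<lambda>M i j. if i < dim_row M \<and> j < dim_col M then M $$ (i, j) else 0"
  subgoal for M by (rule exI[of _ "max (dim_row M) (dim_col M)"]) auto
  done

definition of_vec :: "real vec \<Rightarrow> fmat" where "of_vec v = of_mat (col_mat v)"

lift_definition fdiag :: "nat \<Rightarrow> (nat \<Rightarrow> real) \<Rightarrow> fmat" is
  "\<lambda>n d i j. if i = j \<and> i < n then d i else 0"
  subgoal for n d by (rule exI[of _ n]) auto
  done

lemma entry_fdiag_times: "entry (fdiag n d * M) i j = (if i < n then d i * entry M i j else 0)"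
  by (subst entry_times[of "Suc i"]) (auto simp: fdiag.rep_eq)

lemma entry_times_fdiag: "entry (M * fdiag n d) i j = (if j < n then entry M i j * d j else 0)"
  by (subst entry_times[of "Suc j"]) (auto simp: fdiag.rep_eq)

lemma tr_fdiag [simp]: "tr (fdiag n d) = fdiag n d"
  by (rule fmat_eqI) (auto simp: tr.rep_eq fdiag.rep_eq)

lemma col_mat_carrier: "v \<in> carrier_vec n \<Longrightarrow> col_mat v \<in> carrier_mat n 1"
  by (auto simp: col_mat_def)

lemma col_mat_index: "i < dim_vec v \<Longrightarrow> col_mat v $$ (i, 0) = v $ i"
  by (simp add: col_mat_def mat_of_cols_index)

lemma row_mat_eq: "row_mat v = (col_mat v)\<^sup>T"
  by (rule eq_matI) (auto simp: row_mat_def col_mat_def mat_of_cols_index mat_of_rows_index)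

lemma of_mat_mult:
  assumes "A \<in> carrier_mat a b" "B \<in> carrier_mat b c"
  shows "of_mat (A * B) = of_mat A * of_mat B"
proof (rule fmat_eqI)
  fix i j
  show "entry (of_mat (A * B)) i j = entry (of_mat A * of_mat B) i j"
    by (subst entry_times[of b])
      (use assms in \<open>auto simp: of_mat.rep_eq scalar_prod_def lessThan_atLeast0 intro!: sum.cong\<close>)
qed

lemma of_mat_transpose: "of_mat (A\<^sup>T) = tr (of_mat A)"
  by (rule fmat_eqI) (auto simp: of_mat.rep_eq tr.rep_eq)

lemma of_mat_add:
  assumes "A \<in> carrier_mat a b" "B \<in> carrier_mat a b"
  shows "of_mat (A + B) = of_mat A + of_mat B"
  by (rule fmat_eqI) (use assms in \<open>auto simp: of_mat.rep_eq plus_fmat.rep_eq\<close>)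

lemma of_mat_minus:
  assumes "A \<in> carrier_mat a b" "B \<in> carrier_mat a b"
  shows "of_mat (A - B) = of_mat A - of_mat B"
  by (rule fmat_eqI) (use assms in \<open>auto simp: of_mat.rep_eq entry_minus\<close>)

lemma of_mat_uminus: "of_mat (- A) = - of_mat A"
  by (rule fmat_eqI) (auto simp: of_mat.rep_eq uminus_fmat.rep_eq)

lemma of_mat_one: "of_mat (1\<^sub>m n) = fdiag n (\<lambda>_. 1)"
  by (rule fmat_eqI) (auto simp: of_mat.rep_eq fdiag.rep_eq)

lemma of_mat_zero: "of_mat (0\<^sub>m a b) = 0"
  by (rule fmat_eqI) (auto simp: of_mat.rep_eq zero_fmat.rep_eq)

lemma of_mat_inject:
  assumes "of_mat A = of_mat B" "A \<in> carrier_mat a b" "B \<in> carrier_mat a b"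
  shows "A = B"
proof (rule eq_matI)
  fix i j assume "i < dim_row B" "j < dim_col B"
  then show "A $$ (i, j) = B $$ (i, j)"
    using arg_cong[OF assms(1), of "\<lambda>x. entry x i j"] assms(2,3)
    by (simp add: of_mat.rep_eq)
qed (use assms in auto)

lemma entry_of_vec: "entry (of_vec v) i j = (if j = 0 \<and> i < dim_vec v then v $ i else 0)"
  by (auto simp: of_vec_def of_mat.rep_eq col_mat_index) (auto simp: col_mat_def)

lemma is_col_of_vec: "is_col (of_vec v)"
  by (simp add: is_col_entry entry_of_vec)

lemma of_vec_mult:
  assumes "A \<in> carrier_mat a b" "v \<in> carrier_vec b"
  shows "of_vec (A *\<^sub>v v) = of_mat A * of_vec v"
proof (rule fmat_eqI)
  fix i j
  show "entry (of_vec (A *\<^sub>v v)) i j = entry (of_mat A * of_vec v) i j"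
    by (subst entry_times[of b])
      (use assms in \<open>auto simp: entry_of_vec of_mat.rep_eq scalar_prod_def lessThan_atLeast0
        intro!: sum.cong\<close>)
qed

lemma of_vec_add:
  "v \<in> carrier_vec n \<Longrightarrow> w \<in> carrier_vec n \<Longrightarrow> of_vec (v + w) = of_vec v + of_vec w"
  by (rule fmat_eqI) (auto simp: entry_of_vec plus_fmat.rep_eq)

lemma of_vec_smult: "of_vec (c \<cdot>\<^sub>v v) = c *\<^sub>R of_vec v"
  by (rule fmat_eqI) (auto simp: entry_of_vec scaleR_fmat.rep_eq)

lemma of_vec_zero: "of_vec (0\<^sub>v n) = 0"
  by (rule fmat_eqI) (auto simp: entry_of_vec zero_fmat.rep_eq)

lemma of_vec_inject:
  assumes "of_vec v = of_vec w" "v \<in> carrier_vec n" "w \<in> carrier_vec n"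
  shows "v = w"
proof (rule eq_vecI)
  fix i assume "i < dim_vec w"
  then show "v $ i = w $ i"
    using arg_cong[OF assms(1), of "\<lambda>x. entry x i 0"] assms(2,3)
    by (simp add: entry_of_vec)
qed (use assms in auto)

lemma row_times_of_vec:
  assumes "v \<in> carrier_vec n" "w \<in> carrier_vec n"
  shows "tr (of_vec v) * of_vec w = (v \<bullet> w) *\<^sub>R unit00"
proof -
  have "entry (tr (of_vec v) * of_vec w) 0 0 = v \<bullet> w"
    by (subst entry_times[of n])
      (use assms in \<open>auto simp: entry_of_vec tr.rep_eq scalar_prod_def lessThan_atLeast0
        intro!: sum.cong\<close>)
  then show ?thesis using row_col_scalar[OF is_col_of_vec is_col_of_vec] by metis
qed

lemma entry_quadratic:
  "entry (tr (of_vec v) * fdiag q d * of_vec w) 0 0 =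
    (\<Sum>i<q. d i * entry (of_vec v) i 0 * entry (of_vec w) i 0)"
  by (subst entry_times[of q]) (auto simp: entry_times_fdiag tr.rep_eq algebra_simps intro!: sum.cong)

text \<open>Uniqueness of the Moore-Penrose inverse. \<open>A * X\<close> and \<open>A * Y\<close>
  are orthogonal projections onto the same range, hence equal, and likewise \<open>X * A\<close> and
  \<open>Y * A\<close>. Then X = X A X = X A Y = Y A Y = Y.\<close>

lemma pseudo_inverse_eqI:
  assumes X: "is_pseudo_inverse A X"
  shows "pseudo_inverse A = X"
  unfolding pseudo_inverse_def
proof (rule the_equality)
  show "is_pseudo_inverse A X" by (rule X)
next
  fix Y assume Y: "is_pseudo_inverse A Y"
  define m n where "m = dim_row A" and "n = dim_col A"
  have A: "A \<in> carrier_mat m n" by (auto simp: m_def n_def)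
  have car: "X \<in> carrier_mat n m" "Y \<in> carrier_mat n m"
    using X Y unfolding is_pseudo_inverse_def m_def n_def by auto
  have fm: "of_mat A * of_mat Z * of_mat A = of_mat A" "of_mat Z * of_mat A * of_mat Z = of_mat Z"
    "tr (of_mat A * of_mat Z) = of_mat A * of_mat Z" "tr (of_mat Z * of_mat A) = of_mat Z * of_mat A"
    if Z: "is_pseudo_inverse A Z" for Z
  proof -
    have Zc: "Z \<in> carrier_mat n m" using Z unfolding is_pseudo_inverse_def m_def n_def by auto
    have e: "A * Z * A = A" "Z * A * Z = Z" "(A * Z)\<^sup>T = A * Z" "(Z * A)\<^sup>T = Z * A"
      using Z unfolding is_pseudo_inverse_def by auto
    have AZ: "A * Z \<in> carrier_mat m m" and ZA: "Z * A \<in> carrier_mat n n" using A Zc by auto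
    show "of_mat A * of_mat Z * of_mat A = of_mat A" "of_mat Z * of_mat A * of_mat Z = of_mat Z"
      "tr (of_mat A * of_mat Z) = of_mat A * of_mat Z"
      "tr (of_mat Z * of_mat A) = of_mat Z * of_mat A"
      using arg_cong[OF e(1), of of_mat] arg_cong[OF e(2), of of_mat]
        arg_cong[OF e(3), of of_mat] arg_cong[OF e(4), of of_mat]
      unfolding of_mat_transpose of_mat_mult[OF AZ A] of_mat_mult[OF ZA Zc]
        of_mat_mult[OF A Zc] of_mat_mult[OF Zc A] by blast+
  qed
  let ?a = "of_mat A" and ?x = "of_mat X" and ?y = "of_mat Y"
  note x = fm[OF X] and y = fm[OF Y]
  have "?a * ?x = (?a * ?y) * (?a * ?x)" by (metis y(1) mult.assoc)
  also have "\<dots> = tr ((?a * ?x) * (?a * ?y))" by (metis tr_times x(3) y(3))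
  also have "\<dots> = ?a * ?y" by (metis x(1) y(3) mult.assoc)
  finally have 1: "?a * ?x = ?a * ?y" .
  have "?x * ?a = (?x * ?a) * (?y * ?a)" by (metis y(1) mult.assoc)
  also have "\<dots> = tr ((?y * ?a) * (?x * ?a))" by (metis tr_times x(4) y(4))
  also have "\<dots> = ?y * ?a" by (metis x(1) y(4) mult.assoc)
  finally have 2: "?x * ?a = ?y * ?a" .
  have "?y = ?x" by (metis 1 2 x(2) y(2) mult.assoc)
  then show "Y = X" using of_mat_inject car by blast
qed

lemma pseudo_inverse_row_mat:
  assumes v: "v \<in> carrier_vec n" "v \<noteq> 0\<^sub>v n"
  shows "pseudo_inverse (row_mat v) \<in> carrier_mat n 1"
    and "row_mat v * pseudo_inverse (row_mat v) = 1\<^sub>m 1"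
proof -
  define X where "X = col_mat ((1 / (v \<bullet> v)) \<cdot>\<^sub>v v)"
  have vv: "v \<bullet> v \<noteq> 0"
    using conjugate_square_eq_0_vec[OF v(1)] v(2) by simp
  have c: "col_mat v \<in> carrier_mat n 1" "row_mat v \<in> carrier_mat 1 n" "X \<in> carrier_mat n 1"
    using v col_mat_carrier unfolding X_def by (auto simp: row_mat_eq)
  have fX: "of_mat X = (1 / (v \<bullet> v)) *\<^sub>R of_vec v"
    using of_vec_smult unfolding X_def of_vec_def by simp
  have fv: "of_mat (row_mat v) = tr (of_vec v)"
    by (simp add: row_mat_eq of_mat_transpose of_vec_def)
  have u1: "fdiag 1 (\<lambda>_. 1) = unit00"
    by (rule fmat_eqI) (auto simp: fdiag.rep_eq unit00.rep_eq)
  have "of_mat (row_mat v * X) = of_mat (1\<^sub>m 1)"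
    unfolding of_mat_mult[OF c(2,3)] fX fv of_mat_one u1
    using row_times_of_vec[OF v(1) v(1)] vv by simp
  then have 1: "row_mat v * X = 1\<^sub>m 1" using c by (intro of_mat_inject) auto
  have "of_mat ((X * row_mat v)\<^sup>T) = of_mat (X * row_mat v)"
    unfolding of_mat_transpose of_mat_mult[OF c(3,2)] fX fv by simp
  then have 2: "(X * row_mat v)\<^sup>T = X * row_mat v"
    by (rule of_mat_inject) (use c in auto)
  have 3: "X * row_mat v * X = X"
    using 1 c by (metis assoc_mult_mat right_mult_one_mat)
  have "is_pseudo_inverse (row_mat v) X"
    unfolding is_pseudo_inverse_def 1 using c 2 3 by auto
  then have "pseudo_inverse (row_mat v) = X" by (rule pseudo_inverse_eqI)
  then show "pseudo_inverse (row_mat v) \<in> carrier_mat n 1"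
    "row_mat v * pseudo_inverse (row_mat v) = 1\<^sub>m 1" using c 1 by auto
qed

section \<open>Balanced realizations and the Sylvester equation\<close>

lemma symmetric_index:
  assumes "A \<in> carrier_mat n n" "A\<^sup>T = A" "i < n" "j < n"
  shows "A $$ (i, j) = A $$ (j, i)"
  using assms by (metis carrier_matD index_transpose_mat(1))

text \<open>The Lyapunov equation with positive \<open>d\<close> already confines the spectrum of
  the symmetric matrix \<open>A\<close> to the interval from -1 to 1. \<open>no_period_two\<close>
  excludes the end points, so it expresses strict stability without mentioning eigenvalues.\<close>

locale balanced =
  fixes n :: nat and A :: "real mat" and \<beta> :: "real vec" and d :: "nat \<Rightarrow> real"
  assumes A [simp]: "A \<in> carrier_mat n n" and A_symmetric: "A\<^sup>T = A"
    and \<beta> [simp]: "\<beta> \<in> carrier_vec n" and \<beta>_nonzero: "\<beta> \<noteq> 0\<^sub>v n"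
    and d_pos: "\<And>i. i < n \<Longrightarrow> 0 < d i"
    and lyapunov: "\<And>i j. i < n \<Longrightarrow> j < n \<Longrightarrow>
      (\<Sum>k<n. A $$ (i, k) * d k * A $$ (k, j)) + \<beta> $ i * \<beta> $ j = (if i = j then d i else 0)"
    and no_period_two: "\<And>x. x \<in> carrier_vec n \<Longrightarrow> A *\<^sub>v (A *\<^sub>v x) = x \<Longrightarrow> x = 0\<^sub>v n"
begin

lemma dims [simp]: "dim_row A = n" "dim_col A = n" "dim_vec \<beta> = n"
  using carrier_matD[OF A] carrier_vecD[OF \<beta>] by blast+

abbreviation "D \<equiv> fdiag n d"

lemma entry_A: "entry (of_mat A) i j = (if i < n \<and> j < n then A $$ (i, j) else 0)"
  by (simp add: of_mat.rep_eq)

lemma entry_\<beta>: "entry (of_vec \<beta>) i j = (if j = 0 \<and> i < n then \<beta> $ i else 0)"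
  by (simp add: entry_of_vec)

lemma fmat_lyapunov: "D = of_mat A * D * of_mat A + of_vec \<beta> * tr (of_vec \<beta>)"
proof (rule fmat_eqI)
  fix i j
  have "entry (of_mat A * D * of_mat A) i j =
      (if i < n \<and> j < n then (\<Sum>k<n. A $$ (i, k) * d k * A $$ (k, j)) else 0)"
    by (subst entry_times[of n])
      (auto simp: entry_A entry_times_fdiag intro!: sum.cong)
  moreover have "entry (of_vec \<beta> * tr (of_vec \<beta>)) i j = (if i < n \<and> j < n then \<beta> $ i * \<beta> $ j else 0)"
    by (simp add: entry_col_row is_col_of_vec entry_\<beta> tr.rep_eq)
  ultimately show "entry D i j = entry (of_mat A * D * of_mat A + of_vec \<beta> * tr (of_vec \<beta>)) i j"
    using lyapunov[of i j] by (auto simp: plus_fmat.rep_eq fdiag.rep_eq)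
qed

text \<open>What follows rests on the identity \<open>(A D)\<^sup>2 = D\<^sup>2 - \<beta> \<beta>\<^sup>T D\<close>.\<close>

lemma singular_vector_defect:
  assumes x: "x \<in> carrier_vec n" and Dx: "\<And>i. i < n \<Longrightarrow> d i * x $ i = s * x $ i"
    and \<beta>x: "\<beta> \<bullet> x = 0" and i: "i < n"
  shows "((d i)\<^sup>2 - s\<^sup>2) * (A *\<^sub>v x) $ i = \<beta> $ i * entry (tr (of_vec \<beta>) * D * of_mat A * of_vec x) 0 0"
proof -
  let ?A = "of_mat A" and ?b = "of_vec \<beta>" and ?x = "of_vec x"
  have 1: "D * ?x = s *\<^sub>R ?x"
    by (rule fmat_eqI) (use Dx x in \<open>auto simp: entry_fdiag_times entry_of_vec scaleR_fmat.rep_eq\<close>)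
  have "?b * (tr ?b * ?x) = 0" using row_times_of_vec[OF \<beta> x] \<beta>x by simp
  then have 2: "?A * (D * (?A * ?x)) = s *\<^sub>R ?x"
    using 1 arg_cong[OF fmat_lyapunov, of "\<lambda>z. z * ?x"] by (simp add: algebra_simps)
  \<comment> \<open>The Lyapunov equation a second time, now on D A x. The inner A D A x is s x by
    the first application, which used that \<beta> is orthogonal to x.\<close>
  have "D * (D * (?A * ?x)) = ?A * (D * (?A * (D * (?A * ?x)))) + ?b * (tr ?b * (D * (?A * ?x)))"
    using arg_cong[OF fmat_lyapunov, of "\<lambda>z. z * (D * (?A * ?x))"] by (simp add: algebra_simps)
  also have "\<dots> = s\<^sup>2 *\<^sub>R (?A * ?x) + ?b * (tr ?b * D * ?A * ?x)"
    unfolding 2 using 1 by (simp add: algebra_simps power2_eq_square)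
  finally have "entry (D * (D * of_vec (A *\<^sub>v x))) i 0 =
      entry (s\<^sup>2 *\<^sub>R of_vec (A *\<^sub>v x) + ?b * (tr ?b * D * ?A * ?x)) i 0"
    using of_vec_mult[OF A x] by simp
  then show ?thesis
    using i by (simp add: entry_simps entry_fdiag_times entry_of_vec entry_col_row is_col_of_vec
        algebra_simps power2_eq_square del: index_mult_mat_vec)
qed

text \<open>Without defect, D^2 - s^2 annihilates A x, and since D + s is invertible, A x is again
  an eigenvector of D for s. Hence s A A x = A D A x = s x, and A has no nonzero vector of period
  two.\<close>

lemma singular_vector_zero:
  assumes x: "x \<in> carrier_vec n" and Dx: "\<And>i. i < n \<Longrightarrow> d i * x $ i = s * x $ i"
    and s: "0 < s" and \<beta>x: "\<beta> \<bullet> x = 0"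
    and defect: "entry (tr (of_vec \<beta>) * D * of_mat A * of_vec x) 0 0 = 0"
  shows "x = 0\<^sub>v n"
proof -
  have DAx: "d i * (A *\<^sub>v x) $ i = s * (A *\<^sub>v x) $ i" if i: "i < n" for i
  proof -
    have "((d i)\<^sup>2 - s\<^sup>2) * (A *\<^sub>v x) $ i = 0"
      using singular_vector_defect[OF x Dx \<beta>x i] defect by simp
    then have "(d i - s) * (d i + s) * (A *\<^sub>v x) $ i = 0"
      by (simp add: algebra_simps power2_eq_square)
    moreover have "d i + s \<noteq> 0" using s d_pos[OF i] by simp
    ultimately have "d i = s \<or> (A *\<^sub>v x) $ i = 0" by (simp del: index_mult_mat_vec)
    then show ?thesis by auto
  qed
  let ?A = "of_mat A" and ?x = "of_vec x"
  have Ax: "A *\<^sub>v x \<in> carrier_vec n" by (rule mult_mat_vec_carrier[OF A x])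
  have 1: "D * ?x = s *\<^sub>R ?x"
    by (rule fmat_eqI) (use Dx x in \<open>auto simp: entry_fdiag_times entry_of_vec scaleR_fmat.rep_eq\<close>)
  have 2: "D * of_vec (A *\<^sub>v x) = s *\<^sub>R of_vec (A *\<^sub>v x)"
    by (rule fmat_eqI)
      (use DAx in \<open>auto simp: entry_fdiag_times entry_of_vec scaleR_fmat.rep_eq simp del: index_mult_mat_vec\<close>)
  have "of_vec \<beta> * (tr (of_vec \<beta>) * ?x) = 0" using row_times_of_vec[OF \<beta> x] \<beta>x by simp
  then have "?A * (D * of_vec (A *\<^sub>v x)) = s *\<^sub>R ?x"
    using 1 arg_cong[OF fmat_lyapunov, of "\<lambda>z. z * ?x"] of_vec_mult[OF A x] by (simp add: algebra_simps)
  then have "s *\<^sub>R of_vec (A *\<^sub>v (A *\<^sub>v x)) = s *\<^sub>R ?x"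
    unfolding 2 using of_vec_mult[OF A Ax] by simp
  then have "of_vec (A *\<^sub>v (A *\<^sub>v x)) = ?x" using s by simp
  then have "A *\<^sub>v (A *\<^sub>v x) = x"
    by (rule of_vec_inject) (use mult_mat_vec_carrier[OF A Ax] x in auto)
  then show ?thesis by (rule no_period_two[OF x])
qed

text \<open>A two-dimensional eigenspace of \<open>D\<close> would contain a nonzero vector on which
  both \<beta> and the defect functional \<open>g\<close> vanish, contradicting
  \<open>singular_vector_zero\<close>.\<close>

lemma simple_singular_number:
  assumes ij: "i < n" "j < n" "d i = d j"
  shows "i = j"
proof (rule ccontr)
  assume neq: "i \<noteq> j"
  define v where "v a b = a \<cdot>\<^sub>v unit_vec n i + b \<cdot>\<^sub>v unit_vec n j" for a b :: real
  have v: "v a b \<in> carrier_vec n" for a b by (simp add: v_def)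
  have v_index: "v a b $ l = (if l = i then a else if l = j then b else 0)" if "l < n" for a b l
    using that neq ij by (simp add: v_def unit_vec_def)
  have Dv: "d l * v a b $ l = d i * v a b $ l" if "l < n" for a b l
    using ij(3) v_index[OF that] by simp
  have \<beta>v: "\<beta> \<bullet> v a b = a * \<beta> $ i + b * \<beta> $ j" for a b
    using ij by (simp add: v_def scalar_prod_add_distrib[of _ n] scalar_prod_right_unit[of _ n])
  define g where "g x = entry (tr (of_vec \<beta>) * D * of_mat A * of_vec x) 0 0" for x
  have g: "g (v a b) = a * g (unit_vec n i) + b * g (unit_vec n j)" for a b
  proof -
    have "of_vec (v a b) = a *\<^sub>R of_vec (unit_vec n i) + b *\<^sub>R of_vec (unit_vec n j)"
      unfolding v_def by (subst of_vec_add[of _ n]) (auto simp: of_vec_smult)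
    then show ?thesis by (simp add: g_def entry_simps distrib_left)
  qed
  have no_zero: "a = 0 \<and> b = 0" if "\<beta> \<bullet> v a b = 0" "g (v a b) = 0" for a b
  proof -
    have "v a b = 0\<^sub>v n"
      using singular_vector_zero[OF v Dv d_pos[OF ij(1)] that[unfolded g_def]] by blast
    then have "v a b $ i = 0" "v a b $ j = 0" using ij by auto
    then show ?thesis using v_index ij neq by auto
  qed
  show False
  proof (cases "\<beta> $ i = 0 \<and> \<beta> $ j = 0")
    case True
    \<comment> \<open>Here \<beta> vanishes on the whole plane, so a kernel vector of
      \<open>g\<close> suffices; if the obvious one is zero, then \<open>g\<close> itself is zero
      and any vector will do.\<close>
    then have "\<beta> \<bullet> v a b = 0" for a b using \<beta>v by simp
    then have "g (unit_vec n j) = 0 \<and> g (unit_vec n i) = 0"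
      using no_zero[of "g (unit_vec n j)" "- g (unit_vec n i)"] g by simp
    then show False using no_zero[of 1 1] g \<open>\<And>a b. \<beta> \<bullet> v a b = 0\<close> by simp
  next
    case False
    \<comment> \<open>This vector spans the kernel of \<beta> in the plane. In the defect identity
      at coordinates i and j the left side is zero, and one of the two entries of \<beta> is not, so
      the defect vanishes without further choice.\<close>
    let ?x = "v (\<beta> $ j) (- \<beta> $ i)"
    have 0: "\<beta> \<bullet> ?x = 0" using \<beta>v by simp
    have "((d i)\<^sup>2 - (d i)\<^sup>2) * (A *\<^sub>v ?x) $ i = \<beta> $ i * g ?x"
      unfolding g_def by (rule singular_vector_defect[OF v Dv 0 ij(1)])
    moreover have "((d j)\<^sup>2 - (d i)\<^sup>2) * (A *\<^sub>v ?x) $ j = \<beta> $ j * g ?x"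
      unfolding g_def by (rule singular_vector_defect[OF v Dv 0 ij(2)])
    ultimately have "g ?x = 0" using False ij(3) by auto
    then show False using no_zero[OF 0] False by simp
  qed
qed

end

section \<open>The Sylvester solution and its energy balance\<close>

locale sylvester_solution = balanced +
  fixes q :: nat and A' :: "real mat" and \<beta>' :: "real vec" and s :: real
  assumes n_def: "n = Suc q" and A' [simp]: "A' \<in> carrier_mat q q" and \<beta>' [simp]: "\<beta>' \<in> carrier_vec q"
    and d_q: "d q = s"
    and sylvester: "\<And>i j. i < q \<Longrightarrow> j < n \<Longrightarrow>
      (\<Sum>k<q. A' $$ (i, k) * A $$ (k, j)) + \<beta>' $ i * \<beta> $ j = (if i = j then 1 else 0)"
begin

lemma dims' [simp]: "dim_row A' = q" "dim_col A' = q" "dim_vec \<beta>' = q"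
  using carrier_matD[OF A'] carrier_vecD[OF \<beta>'] by blast+

definition \<rho> :: "nat \<Rightarrow> real" where "\<rho> i = s\<^sup>2 - (d i)\<^sup>2"

lemma \<rho>_q: "\<rho> q = 0"
  by (simp add: \<rho>_def d_q)

abbreviation "P \<equiv> fdiag q (\<lambda>_. 1)"
abbreviation "X \<equiv> fdiag q \<rho>"

lemma entry_A': "entry (of_mat A') i j = (if i < q \<and> j < q then A' $$ (i, j) else 0)"
  by (simp add: of_mat.rep_eq)

lemma entry_\<beta>': "entry (of_vec \<beta>') i j = (if j = 0 \<and> i < q then \<beta>' $ i else 0)"
  by (simp add: entry_of_vec)

lemma fmat_sylvester: "P = of_mat A' * of_mat A + of_vec \<beta>' * tr (of_vec \<beta>)"
proof (rule fmat_eqI)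
  fix i j
  have "entry (of_mat A' * of_mat A) i j =
      (if i < q \<and> j < n then (\<Sum>k<q. A' $$ (i, k) * A $$ (k, j)) else 0)"
    by (subst entry_times[of q]) (auto simp: entry_A entry_A' n_def intro!: sum.cong)
  moreover have "entry (of_vec \<beta>' * tr (of_vec \<beta>)) i j =
      (if i < q \<and> j < n then \<beta>' $ i * \<beta> $ j else 0)"
    by (simp add: entry_col_row is_col_of_vec entry_\<beta> entry_\<beta>' tr.rep_eq)
  ultimately show "entry P i j = entry (of_mat A' * of_mat A + of_vec \<beta>' * tr (of_vec \<beta>)) i j"
    using sylvester[of i j] by (auto simp: plus_fmat.rep_eq fdiag.rep_eq n_def)
qed

text \<open>The Sylvester equation provides a left inverse up to the last coordinate, so only a
  multiple of the last unit vector could be in the kernel. Then the last column of \<open>A\<close>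
  is zero off the diagonal and the last entry of \<beta> is zero, and the Lyapunov equation at (q,
  q) makes the diagonal entry 1 or -1, against \<open>no_period_two\<close>.\<close>

lemma stacked_injective:
  assumes x: "x \<in> carrier_vec n" and Ax: "\<And>i. i < q \<Longrightarrow> (A *\<^sub>v x) $ i = 0" and \<beta>x: "\<beta> \<bullet> x = 0"
  shows "x = 0\<^sub>v n"
proof -
  have x0: "x $ i = 0" if i: "i < q" for i
  proof -
    have "P * of_mat A * of_vec x = 0"
    proof (rule fmat_eqI)
      fix i j
      have "entry (of_vec (A *\<^sub>v x)) i j = 0" if "i < q"
        using Ax[OF that] by (auto simp: entry_of_vec simp del: index_mult_mat_vec)
      then show "entry (P * of_mat A * of_vec x) i j = entry 0 i j"
        using of_vec_mult[OF A x] by (simp add: mult.assoc entry_fdiag_times zero_fmat.rep_eq)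
    qed
    moreover have "of_mat A' * P = of_mat A'"
      by (rule fmat_eqI) (auto simp: entry_times_fdiag entry_A')
    ultimately have "of_mat A' * of_mat A * of_vec x = 0"
      by (metis mult.assoc mult_zero_right)
    moreover have "of_vec \<beta>' * tr (of_vec \<beta>) * of_vec x = 0"
      using row_times_of_vec[OF \<beta> x] \<beta>x by (simp add: mult.assoc)
    ultimately have "P * of_vec x = 0"
      unfolding fmat_sylvester by (simp add: distrib_right)
    then have "entry (P * of_vec x) i 0 = 0" by (simp add: zero_fmat.rep_eq)
    then show ?thesis using i x by (simp add: entry_fdiag_times entry_of_vec n_def)
  qed
  show ?thesis
  proof (cases "x $ q = 0")
    case True
    then show ?thesis using x0 x by (intro eq_vecI) (auto simp: n_def less_Suc_eq)
  next
    case False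
    have Ax_i: "(A *\<^sub>v x) $ i = A $$ (i, q) * x $ q" if "i < n" for i
    proof -
      have "(A *\<^sub>v x) $ i = (\<Sum>j<n. A $$ (i, j) * x $ j)"
        using that A x by (simp add: scalar_prod_def lessThan_atLeast0 del: A)
      then show ?thesis using x0 by (simp add: n_def)
    qed
    have a0: "A $$ (i, q) = 0" if "i < q" for i
      using Ax_i[of i] Ax[of i] that False by (simp add: n_def)
    have "\<beta> \<bullet> x = \<beta> $ q * x $ q"
      using x x0 by (simp add: scalar_prod_def lessThan_atLeast0[symmetric] n_def)
    then have \<beta>q: "\<beta> $ q = 0" using \<beta>x False by simp
    have a0': "A $$ (q, i) = 0" if "i < q" for i
      using a0[OF that] symmetric_index[OF A A_symmetric, of q i] that by (simp add: n_def)
    have "(\<Sum>k<n. A $$ (q, k) * d k * A $$ (k, q)) = A $$ (q, q) * s * A $$ (q, q)"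
      using a0' by (simp add: n_def d_q)
    then have "A $$ (q, q) * s * A $$ (q, q) = s"
      using lyapunov[of q q] \<beta>q by (simp add: n_def d_q)
    moreover have "s > 0" using d_pos[of q] by (simp add: n_def d_q)
    ultimately have aa: "A $$ (q, q) * A $$ (q, q) = 1" by (simp add: field_simps)
    have Axx: "A *\<^sub>v x = A $$ (q, q) \<cdot>\<^sub>v x"
    proof (rule eq_vecI)
      fix i assume "i < dim_vec (A $$ (q, q) \<cdot>\<^sub>v x)"
      then have i: "i < n" using x by simp
      then show "(A *\<^sub>v x) $ i = (A $$ (q, q) \<cdot>\<^sub>v x) $ i"
        using Ax_i[OF i] a0[of i] x0[of i] x by (cases "i = q") (auto simp: n_def)
    qed (use A x in \<open>auto simp del: A\<close>)
    have "A *\<^sub>v (A *\<^sub>v x) = (A $$ (q, q) * A $$ (q, q)) \<cdot>\<^sub>v x"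
      unfolding Axx using Axx mult_mat_vec[OF A x] by (simp add: smult_smult_assoc)
    then show ?thesis using no_period_two[OF x] aa by simp
  qed
qed

lemma ex_right_inverse:
  "\<exists>Z. P * of_mat A * Z = P \<and> tr (of_vec \<beta>) * Z = 0"
proof -
  \<comment> \<open>The required \<open>Z\<close> consists of the first q columns of the inverse of
    \<open>N\<close>: the upper rows of \<open>N\<close> reproduce the identity on them, and the
    last row \<beta> is orthogonal to them.\<close>
  define N where "N = mat n n (\<lambda>(i, j). if i < q then A $$ (i, j) else \<beta> $ j)"
  have N: "N \<in> carrier_mat n n" by (simp add: N_def)
  have "det N \<noteq> 0"
  proof
    assume "det N = 0"
    then obtain x where x: "x \<in> carrier_vec n" "x \<noteq> 0\<^sub>v n" "N *\<^sub>v x = 0\<^sub>v n"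
      using det_0_iff_vec_prod_zero_field[OF N] by auto
    have "(A *\<^sub>v x) $ i = 0" if "i < q" for i
      using arg_cong[OF x(3), of "\<lambda>v. v $ i"] that A x(1)
      by (simp add: N_def n_def scalar_prod_def del: A)
    moreover have "\<beta> \<bullet> x = 0"
      using arg_cong[OF x(3), of "\<lambda>v. v $ q"] x(1)
      by (simp add: N_def n_def scalar_prod_def)
    ultimately show False using stacked_injective x(1,2) by blast
  qed
  then have "N \<in> Units (ring_mat TYPE(real) n ())" by (rule det_non_zero_imp_unit[OF N])
  then obtain M where M: "M \<in> carrier_mat n n" "N * M = 1\<^sub>m n"
    unfolding Units_def ring_mat_def by auto
  define E where "E = of_vec (unit_vec n q)"
  have NM: "of_mat N * of_mat M = fdiag n (\<lambda>_. 1)"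
    using of_mat_mult[OF N M(1)] M(2) by (simp add: of_mat_one)
  have "P * of_mat N = P * of_mat A"
    by (rule fmat_eqI)
      (use carrier_matD[OF A] in \<open>auto simp: entry_fdiag_times of_mat.rep_eq N_def n_def simp del: A\<close>)
  then have "P * of_mat A * (of_mat M * P) = P * fdiag n (\<lambda>_. 1) * P"
    using NM by (metis mult.assoc)
  also have "\<dots> = P"
    by (rule fmat_eqI) (auto simp: entry_fdiag_times entry_times_fdiag fdiag.rep_eq n_def)
  finally have 1: "P * of_mat A * (of_mat M * P) = P" .
  have "tr E * of_mat N = tr (of_vec \<beta>)"
  proof (rule fmat_eqI)
    fix i j
    show "entry (tr E * of_mat N) i j = entry (tr (of_vec \<beta>)) i j"
      by (subst entry_times[of n])
        (auto simp: E_def entry_of_vec tr.rep_eq of_mat.rep_eq N_def n_def entry_\<beta>)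
  qed
  then have "tr (of_vec \<beta>) * (of_mat M * P) = tr E * fdiag n (\<lambda>_. 1) * P"
    using NM by (metis mult.assoc)
  also have "\<dots> = 0"
    by (rule fmat_eqI)
      (auto simp: entry_times_fdiag E_def entry_of_vec tr.rep_eq zero_fmat.rep_eq unit_vec_def)
  finally show ?thesis using 1 by blast
qed

lemma all_pass_solution: "\<exists>Z. all_pass (of_mat A) D P X (of_mat A') (of_vec \<beta>) (of_vec \<beta>') Z s"
proof -
  obtain Z where Z: "P * of_mat A * Z = P" "tr (of_vec \<beta>) * Z = 0"
    using ex_right_inverse by blast
  have sym: "tr (of_mat A) = of_mat A"
    using of_mat_transpose[of A] A_symmetric by simp
  \<comment> \<open>The padding of \<open>X\<close> by zero is harmless in row q, where the right
    side vanishes as well because \<open>d q = s\<close>.\<close>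
  have X: "X * M = s\<^sup>2 *\<^sub>R M - D * D * M" if "\<And>i j. \<not> i < n \<Longrightarrow> entry M i j = 0" for M
  proof (rule fmat_eqI)
    fix i j
    show "entry (X * M) i j = entry (s\<^sup>2 *\<^sub>R M - D * D * M) i j"
      using that[of i j] \<rho>_q
      by (cases "i = q")
        (auto simp: mult.assoc entry_fdiag_times entry_minus scaleR_fmat.rep_eq n_def d_q \<rho>_def
          algebra_simps power2_eq_square less_Suc_eq)
  qed
  have XA: "X * of_mat A = s\<^sup>2 *\<^sub>R of_mat A - D * D * of_mat A"
    by (rule X) (simp add: entry_A)
  have X\<beta>: "X * of_vec \<beta> = s\<^sup>2 *\<^sub>R of_vec \<beta> - D * D * of_vec \<beta>"
    by (rule X) (simp add: entry_\<beta>)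
  have diag: "D * X = X * D" "P * X = X" "X * P = X" "P * D = D * P" "P * of_mat A' = of_mat A'"
    "of_mat A' * P = of_mat A'" "P * P = P" "P * of_vec \<beta>' = of_vec \<beta>'"
    by (rule fmat_eqI; auto simp: entry_fdiag_times entry_times_fdiag fdiag.rep_eq entry_A' entry_\<beta>')+
  have "of_vec \<beta> \<noteq> 0"
    using \<beta>_nonzero of_vec_inject[of \<beta> "0\<^sub>v n" n] of_vec_zero by fastforce
  then have "all_pass (of_mat A) D P X (of_mat A') (of_vec \<beta>) (of_vec \<beta>') Z s"
    using sym XA X\<beta> diag Z fmat_lyapunov fmat_sylvester is_col_of_vec
    by (intro all_pass.intro) (assumption | rule tr_fdiag)+
  then show ?thesis ..
qed

text \<open>Symmetry of R A' in entries. It is what later simplifies the prescribed initial weights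
  of the auxiliary automaton.\<close>

lemma \<rho>_symmetric:
  assumes "i < q" "j < q"
  shows "\<rho> i * A' $$ (i, j) = A' $$ (j, i) * \<rho> j"
proof -
  obtain Z where "all_pass (of_mat A) D P X (of_mat A') (of_vec \<beta>) (of_vec \<beta>') Z s"
    using all_pass_solution by blast
  then have "entry (X * of_mat A') i j = entry (tr (of_mat A') * X) i j"
    using all_pass.X_A' by metis
  then show ?thesis
    using assms by (simp add: entry_fdiag_times entry_times_fdiag tr.rep_eq entry_A')
qed

definition energy :: "real vec \<Rightarrow> real vec \<Rightarrow> real" where
  "energy x x' = (\<Sum>i<n. d i * (x $ i)\<^sup>2) + (\<Sum>i<q. \<rho> i * (2 * x $ i * x' $ i - d i * (x' $ i)\<^sup>2))"

text \<open>Only the existence of \<open>c\<close> matters. It multiplies the input, which is zero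
  at all times whose outputs are counted; at the other times the squared output is merely dropped as
  nonnegative.\<close>

lemma energy_step:
  obtains c where "\<And>x x' u. x \<in> carrier_vec n \<Longrightarrow> x' \<in> carrier_vec q \<Longrightarrow>
    energy (A *\<^sub>v x + u \<cdot>\<^sub>v \<beta>) (A' *\<^sub>v x' + u \<cdot>\<^sub>v \<beta>')
      + (\<beta> \<bullet> x + (\<Sum>i<q. \<rho> i * \<beta>' $ i * x' $ i) + c * u)\<^sup>2 = energy x x' + s\<^sup>2 * u\<^sup>2"
proof -
  obtain Z where Z: "all_pass (of_mat A) D P X (of_mat A') (of_vec \<beta>) (of_vec \<beta>') Z s"
    using all_pass_solution by blast
  interpret all_pass "of_mat A" D P X "of_mat A'" "of_vec \<beta>" "of_vec \<beta>'" Z s by (rule Z)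
  have entry_storage: "entry (storage (of_vec x) (of_vec x')) 0 0 = energy x x'"
    if "x \<in> carrier_vec n" "x' \<in> carrier_vec q" for x x'
  proof -
    have e: "entry (tr (of_vec v) * fdiag m w * of_vec u) 0 0 = (\<Sum>i<m. w i * v $ i * u $ i)"
      if "m \<le> dim_vec v" "m \<le> dim_vec u" for v u m w
      using that by (auto simp: entry_quadratic entry_of_vec intro!: sum.cong)
    have "D * X = fdiag q (\<lambda>i. d i * \<rho> i)"
      by (rule fmat_eqI) (auto simp: entry_fdiag_times fdiag.rep_eq n_def)
    then have DX': "tr (of_vec x') * D * X = tr (of_vec x') * fdiag q (\<lambda>i. d i * \<rho> i)"
      by (simp add: mult.assoc)
    have "q \<le> n" "dim_vec x = n" "dim_vec x' = q" using that by (auto simp: n_def)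
    then have "entry (storage (of_vec x) (of_vec x')) 0 0 = (\<Sum>i<n. d i * x $ i * x $ i)
        + (\<Sum>i<q. \<rho> i * x $ i * x' $ i) + (\<Sum>i<q. \<rho> i * x' $ i * x $ i)
        - (\<Sum>i<q. d i * \<rho> i * x' $ i * x' $ i)"
      unfolding storage_def DX' by (simp only: entry_simps e)
    also have "\<dots> = energy x x'"
      by (simp add: energy_def power2_eq_square algebra_simps sum.distrib sum_subtractf
          sum_distrib_left)
    finally show ?thesis .
  qed
  show thesis
  proof (rule that)
    fix x x' :: "real vec" and u :: real
    assume x: "x \<in> carrier_vec n" and x': "x' \<in> carrier_vec q"
    define U where "U = u *\<^sub>R unit00"
    define y where "y = \<beta> \<bullet> x + (\<Sum>i<q. \<rho> i * \<beta>' $ i * x' $ i) + c * u"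
    have uU: "unit00 * unit00 = unit00"
      by (rule fmat_eqI) (simp add: entry_unit00_times unit00.rep_eq)
    have b: "of_vec (u \<cdot>\<^sub>v v) = of_vec v * U" for v
      using is_col_of_vec[of v] by (simp add: of_vec_smult U_def is_col_def)
    have 1: "of_vec (A *\<^sub>v x + u \<cdot>\<^sub>v \<beta>) = of_mat A * of_vec x + of_vec \<beta> * U"
      using x A by (subst of_vec_add[of _ n]) (auto simp: of_vec_mult[OF A] b simp del: A)
    have 2: "of_vec (A' *\<^sub>v x' + u \<cdot>\<^sub>v \<beta>') = of_mat A' * of_vec x' + of_vec \<beta>' * U"
      using x' A' by (subst of_vec_add[of _ q]) (auto simp: of_vec_mult[OF A'] b simp del: A')
    have "tr (of_vec \<beta>') * X * of_vec x' = (\<Sum>i<q. \<rho> i * \<beta>' $ i * x' $ i) *\<^sub>R unit00"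
    proof -
      have "entry (tr (of_vec \<beta>') * X * of_vec x') 0 0 = (\<Sum>i<q. \<rho> i * \<beta>' $ i * x' $ i)"
        using x' carrier_vecD[OF \<beta>']
        by (auto simp: entry_quadratic entry_of_vec simp del: \<beta>' intro!: sum.cong)
      then show ?thesis
        using row_col_scalar[of "X * of_vec \<beta>'" "of_vec x'"]
        by (simp add: is_col_mult is_col_of_vec)
    qed
    then have 3: "tr (of_vec \<beta>) * of_vec x + tr (of_vec \<beta>') * X * of_vec x' + c *\<^sub>R U = y *\<^sub>R unit00"
      using row_times_of_vec[OF \<beta> x] by (simp add: U_def y_def algebra_simps)
    have "storage (of_vec (A *\<^sub>v x + u \<cdot>\<^sub>v \<beta>)) (of_vec (A' *\<^sub>v x' + u \<cdot>\<^sub>v \<beta>')) + (y\<^sup>2) *\<^sub>R unit00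
        = storage (of_vec x) (of_vec x') + (s\<^sup>2 * u\<^sup>2) *\<^sub>R unit00"
      using storage_step[of U "of_vec x" "of_vec x'"]
      unfolding 1 2 3 by (simp add: U_def uU power2_eq_square)
    then have "entry (storage (of_vec (A *\<^sub>v x + u \<cdot>\<^sub>v \<beta>)) (of_vec (A' *\<^sub>v x' + u \<cdot>\<^sub>v \<beta>'))) 0 0 + y\<^sup>2
        = entry (storage (of_vec x) (of_vec x')) 0 0 + s\<^sup>2 * u\<^sup>2"
      by (metis (no_types, lifting) mult.right_neutral plus_fmat.rep_eq scaleR_fmat.rep_eq unit00.rep_eq)
    then show "energy (A *\<^sub>v x + u \<cdot>\<^sub>v \<beta>) (A' *\<^sub>v x' + u \<cdot>\<^sub>v \<beta>')
        + (\<beta> \<bullet> x + (\<Sum>i<q. \<rho> i * \<beta>' $ i * x' $ i) + c * u)\<^sup>2 = energy x x' + s\<^sup>2 * u\<^sup>2"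
      using x x' A A' by (simp add: entry_storage y_def del: A A')
  qed
qed

end

section \<open>Iterating a matrix\<close>

abbreviation iter :: "real mat \<Rightarrow> nat \<Rightarrow> real vec \<Rightarrow> real vec" where
  "iter A k v \<equiv> ((*\<^sub>v) A ^^ k) v"

lemma pow_mat_mult_vec:
  assumes "A \<in> carrier_mat n n" "v \<in> carrier_vec n"
  shows "(A ^\<^sub>m k) *\<^sub>v v = iter A k v"
  using assms(2)
proof (induction k arbitrary: v)
  case (Suc k)
  have "(A ^\<^sub>m Suc k) *\<^sub>v v = (A ^\<^sub>m k) *\<^sub>v (A *\<^sub>v v)"
    using assms(1) Suc.prems by (simp add: assoc_mult_mat_vec[of _ n n _ n])
  then show ?case
    using Suc.IH[of "A *\<^sub>v v"] assms(1) Suc.prems by (simp add: funpow_Suc_right del: funpow.simps)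
qed (use assms in auto)

lemma iter_carrier [simp]:
  "A \<in> carrier_mat n n \<Longrightarrow> v \<in> carrier_vec n \<Longrightarrow> iter A k v \<in> carrier_vec n"
  by (induction k) auto

lemma iter_add_vec:
  assumes "A \<in> carrier_mat n n" "v \<in> carrier_vec n" "w \<in> carrier_vec n"
  shows "iter A k (v + w) = iter A k v + iter A k w"
  by (induction k) (use assms in \<open>simp_all add: mult_add_distrib_mat_vec[of _ n n]\<close>)

lemma iter_smult:
  assumes "A \<in> carrier_mat n n" "v \<in> carrier_vec n"
  shows "iter A k (c \<cdot>\<^sub>v v) = c \<cdot>\<^sub>v iter A k v"
  by (induction k) (use assms in \<open>simp_all add: mult_mat_vec[of _ n n]\<close>)

lemma iter_zero: "A \<in> carrier_mat n n \<Longrightarrow> iter A k (0\<^sub>v n) = 0\<^sub>v n"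
  by (induction k) auto

lemma iter_iter: "iter A k (iter A l v) = iter A (k + l) v"
  by (simp add: funpow_add)

lemma iter_commute: "iter A k (A *\<^sub>v v) = iter A (Suc k) v"
  by (simp add: funpow_swap1)

lemma scalar_prod_symmetric:
  fixes A :: "real mat"
  assumes "A \<in> carrier_mat n n" "A\<^sup>T = A" "v \<in> carrier_vec n" "w \<in> carrier_vec n"
  shows "(A *\<^sub>v v) \<bullet> w = v \<bullet> (A *\<^sub>v w)"
  using assms transpose_vec_mult_scalar[of A n n w v]
  by (metis comm_scalar_prod mult_mat_vec_carrier)

lemma iter_symmetric:
  assumes "A \<in> carrier_mat n n" "A\<^sup>T = A" "v \<in> carrier_vec n" "w \<in> carrier_vec n"
  shows "iter A k v \<bullet> w = v \<bullet> iter A k w"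
  using assms(4)
proof (induction k arbitrary: w)
  case (Suc k)
  have "iter A (Suc k) v \<bullet> w = iter A k v \<bullet> (A *\<^sub>v w)"
    using assms Suc.prems by (simp add: scalar_prod_symmetric[of _ n])
  also have "\<dots> = v \<bullet> iter A (Suc k) w"
    using Suc.IH[of "A *\<^sub>v w"] assms Suc.prems iter_commute by simp
  finally show ?case .
qed simp

section \<open>Decay of powers of stable matrices, and inverses of antistable ones\<close>

lemma smult_pow_mat:
  fixes M :: "complex mat"
  assumes "M \<in> carrier_mat m m"
  shows "(c \<cdot>\<^sub>m M) ^\<^sub>m k = c ^ k \<cdot>\<^sub>m (M ^\<^sub>m k)"
proof (induction k)
  case (Suc k)
  have "(c \<cdot>\<^sub>m M) ^\<^sub>m Suc k = (c ^ k \<cdot>\<^sub>m (M ^\<^sub>m k)) * (c \<cdot>\<^sub>m M)" using Suc by simp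
  also have "\<dots> = c ^ k \<cdot>\<^sub>m (c \<cdot>\<^sub>m (M ^\<^sub>m k * M))"
    using assms mult_smult_assoc_mat[of "M ^\<^sub>m k" m m "c \<cdot>\<^sub>m M" m]
      mult_smult_distrib[of "M ^\<^sub>m k" m m M m] by simp
  also have "\<dots> = c ^ Suc k \<cdot>\<^sub>m (M ^\<^sub>m Suc k)"
    by (rule eq_matI) (simp_all add: mult_ac)
  finally show ?case .
qed (use assms in \<open>auto intro!: eq_matI\<close>)

lemma null_comparison:
  fixes f g :: "nat \<Rightarrow> real"
  assumes "\<And>k. \<bar>f k\<bar> \<le> g k" "g \<longlonglongrightarrow> 0"
  shows "f \<longlonglongrightarrow> 0"
proof (rule tendsto_rabs_zero_cancel)
  show "(\<lambda>k. \<bar>f k\<bar>) \<longlonglongrightarrow> 0"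
    by (rule tendsto_sandwich[OF _ _ tendsto_const assms(2)]) (use assms(1) in auto)
qed

lemma stable_pow_entry_tendsto_0:
  fixes M :: "real mat"
  assumes M: "M \<in> carrier_mat m m" and stable: "\<forall>z. eigenvalue (complexify M) z \<longrightarrow> cmod z < 1"
    and ij: "i < m" "j < m"
  shows "(\<lambda>k. (M ^\<^sub>m k) $$ (i, j)) \<longlonglongrightarrow> 0"
proof -
  let ?M = "complexify M"
  have cM: "?M \<in> carrier_mat m m" using M by simp
  have m0: "m > 0" using ij by simp
  define r where "r = spectral_radius ?M"
  have "r \<in> norm ` spectrum ?M" unfolding r_def by (rule spectral_radius_mem_max(1)[OF cM m0])
  then have r: "0 \<le> r" "r < 1" using stable by (auto simp: spectrum_def)
  \<comment> \<open>A spectral radius below 1 only yields bounded powers. After division by a number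
    strictly between r and 1 it is still below 1, and the boundedness of the scaled powers becomes
    the geometric rate t^k for M. The midpoint is positive even when r = 0.\<close>
  define t where "t = (1 + r) / 2"
  have t: "0 < t" "t < 1" "r < t" using r by (auto simp: t_def)
  define B where "B = complex_of_real (1 / t) \<cdot>\<^sub>m ?M"
  have cB: "B \<in> carrier_mat m m" using cM by (simp add: B_def)
  have "spectral_radius B < 1"
  proof -
    obtain z where z: "z \<in> spectrum B" "spectral_radius B = norm z"
      using spectral_radius_mem_max(1)[OF cB m0] by auto
    then obtain v where v: "v \<in> carrier_vec m" "v \<noteq> 0\<^sub>v m" "B *\<^sub>v v = z \<cdot>\<^sub>v v"
      using cB by (auto simp: spectrum_def eigenvalue_def eigenvector_def)
    have "?M *\<^sub>v v = complex_of_real t \<cdot>\<^sub>v (B *\<^sub>v v)"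
      using cM v(1) t by (auto simp: B_def intro!: eq_vecI)
    also have "\<dots> = (complex_of_real t * z) \<cdot>\<^sub>v v" using v(3) by (simp add: smult_smult_assoc)
    finally have "eigenvalue ?M (complex_of_real t * z)"
      using cM v by (auto simp: eigenvalue_def eigenvector_def)
    then have "norm (complex_of_real t * z) \<in> norm ` spectrum ?M"
      by (simp add: spectrum_def)
    then have "norm (complex_of_real t * z) \<le> r"
      unfolding r_def by (rule spectral_radius_mem_max(2)[OF cM m0])
    then have "t * norm z \<le> r" using t by (simp add: norm_mult)
    then have "t * norm z < t * 1" using t(3) by linarith
    then show ?thesis using z(2) t(1) by (simp only: mult_less_cancel_left_pos)
  qed
  then obtain b where b: "\<And>k. norm_bound (B ^\<^sub>m k) b"
    using spectral_radius_jnf_norm_bound_less_1_upper_triangular[OF cB] by blast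
  have bound: "norm ((M ^\<^sub>m k) $$ (i, j)) \<le> b * t ^ k" for k
  proof -
    have "norm ((B ^\<^sub>m k) $$ (i, j)) \<le> b"
      using b[of k] cB ij pow_carrier_mat[OF cB, of k] unfolding norm_bound_def by (metis carrier_matD)
    moreover have "B ^\<^sub>m k = complex_of_real (1 / t) ^ k \<cdot>\<^sub>m complexify (M ^\<^sub>m k)"
      unfolding B_def smult_pow_mat[OF cM] using of_real_hom.mat_hom_pow[OF M, where 'a = complex] by simp
    ultimately have "\<bar>(M ^\<^sub>m k) $$ (i, j)\<bar> / t ^ k \<le> b"
      using t ij carrier_matD[OF pow_carrier_mat[OF M, of k]]
      by (simp add: norm_mult norm_power power_divide norm_divide)
    then show ?thesis using t by (simp add: field_simps)
  qed
  have "(\<lambda>k. b * t ^ k) \<longlonglongrightarrow> b * 0"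
    using t by (intro tendsto_intros LIMSEQ_power_zero) simp
  then show ?thesis
    using bound null_comparison[of "\<lambda>k. (M ^\<^sub>m k) $$ (i, j)" "\<lambda>k. b * t ^ k"] by simp
qed

lemma stable_iter_tendsto_0:
  fixes M :: "real mat"
  assumes M: "M \<in> carrier_mat m m" and stable: "\<forall>z. eigenvalue (complexify M) z \<longrightarrow> cmod z < 1"
    and v: "v \<in> carrier_vec m" and i: "i < m"
  shows "(\<lambda>k. iter M k v $ i) \<longlonglongrightarrow> 0"
proof -
  have "(\<lambda>k. \<Sum>j = 0..<m. (M ^\<^sub>m k) $$ (i, j) * v $ j) \<longlonglongrightarrow> (\<Sum>j = 0..<m. 0 * v $ j)"
    using stable_pow_entry_tendsto_0[OF M stable i] by (intro tendsto_intros) auto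
  moreover have "iter M k v $ i = (\<Sum>j = 0..<m. (M ^\<^sub>m k) $$ (i, j) * v $ j)" for k
    using v i carrier_matD[OF pow_carrier_mat[OF M, of k]]
    by (simp add: pow_mat_mult_vec[OF M v, symmetric] scalar_prod_def)
  ultimately show ?thesis by simp
qed

text \<open>The entries of the powers decay, so the vector may change with the exponent as long as
  it stays bounded. This serves trajectories that are followed back from a later and later
  state.\<close>

lemma stable_iter_bounded_tendsto_0:
  fixes M :: "real mat" and v :: "nat \<Rightarrow> real vec"
  assumes M: "M \<in> carrier_mat m m" and stable: "\<forall>z. eigenvalue (complexify M) z \<longrightarrow> cmod z < 1"
    and v: "\<And>k. v k \<in> carrier_vec m" "\<And>k j. j < m \<Longrightarrow> \<bar>v k $ j\<bar> \<le> C" and i: "i < m"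
  shows "(\<lambda>k. iter M k (v k) $ i) \<longlonglongrightarrow> 0"
proof -
  have "(\<lambda>k. \<Sum>j = 0..<m. \<bar>(M ^\<^sub>m k) $$ (i, j)\<bar> * C) \<longlonglongrightarrow> (\<Sum>j = 0..<m. \<bar>0\<bar> * C)"
    using stable_pow_entry_tendsto_0[OF M stable i] by (intro tendsto_intros) auto
  then have lim: "(\<lambda>k. \<Sum>j = 0..<m. \<bar>(M ^\<^sub>m k) $$ (i, j)\<bar> * C) \<longlonglongrightarrow> 0"
    by simp
  have bound: "\<bar>iter M k (v k) $ i\<bar> \<le> (\<Sum>j = 0..<m. \<bar>(M ^\<^sub>m k) $$ (i, j)\<bar> * C)" for k
  proof -
    have "iter M k (v k) $ i = (\<Sum>j = 0..<m. (M ^\<^sub>m k) $$ (i, j) * v k $ j)"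
      using v(1)[of k] i carrier_matD[OF pow_carrier_mat[OF M, of k]]
      by (simp add: pow_mat_mult_vec[OF M v(1), symmetric] scalar_prod_def)
    also have "\<bar>\<dots>\<bar> \<le> (\<Sum>j = 0..<m. \<bar>(M ^\<^sub>m k) $$ (i, j) * v k $ j\<bar>)" by (rule sum_abs)
    also have "\<dots> \<le> (\<Sum>j = 0..<m. \<bar>(M ^\<^sub>m k) $$ (i, j)\<bar> * C)"
      using v(2) by (intro sum_mono) (simp add: abs_mult mult_left_mono)
    finally show ?thesis .
  qed
  show ?thesis by (rule null_comparison[OF bound lim])
qed

text \<open>An antistable matrix has no eigenvalue 0, and the eigenvalues of its inverse are the
  reciprocals. Running antistable dynamics backwards is therefore stable.\<close>

lemma antistable_inverse:
  fixes M :: "real mat"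
  assumes M: "M \<in> carrier_mat m m" and antistable: "\<forall>z. eigenvalue (complexify M) z \<longrightarrow> cmod z > 1"
  obtains N where "N \<in> carrier_mat m m" "M * N = 1\<^sub>m m"
    "\<forall>z. eigenvalue (complexify N) z \<longrightarrow> cmod z < 1"
proof -
  have "det M \<noteq> 0"
  proof
    assume "det M = 0"
    then obtain v where v: "v \<in> carrier_vec m" "v \<noteq> 0\<^sub>v m" "M *\<^sub>v v = 0\<^sub>v m"
      using det_0_iff_vec_prod_zero_field[OF M] by auto
    have "complexify M *\<^sub>v map_vec complex_of_real v = 0 \<cdot>\<^sub>v map_vec complex_of_real v"
      using of_real_hom.mult_mat_vec_hom[OF M v(1), symmetric, where 'a = complex] v
      by (auto intro!: eq_vecI)
    moreover have "map_vec complex_of_real v \<noteq> 0\<^sub>v m"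
    proof
      assume *: "map_vec complex_of_real v = 0\<^sub>v m"
      have "v $ i = 0" if "i < m" for i
        using arg_cong[OF *, of "\<lambda>v. v $ i"] that v(1) by simp
      then show False using v by (metis eq_vecI carrier_vecD index_zero_vec)
    qed
    ultimately have "eigenvalue (complexify M) 0"
      using M v(1) unfolding eigenvalue_def eigenvector_def
      by (intro exI[of _ "map_vec complex_of_real v"]) simp
    then show False using antistable by fastforce
  qed
  then have "M \<in> Units (ring_mat TYPE(real) m ())" by (rule det_non_zero_imp_unit[OF M])
  then obtain N where N: "N \<in> carrier_mat m m" "N * M = 1\<^sub>m m" "M * N = 1\<^sub>m m"
    unfolding Units_def ring_mat_def by auto
  have "cmod z < 1" if z: "eigenvalue (complexify N) z" for z
  proof -
    obtain v where v: "v \<in> carrier_vec m" "v \<noteq> 0\<^sub>v m" "complexify N *\<^sub>v v = z \<cdot>\<^sub>v v"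
      using z N by (auto simp: eigenvalue_def eigenvector_def)
    have MN: "complexify M * complexify N = 1\<^sub>m m"
      using of_real_hom.mat_hom_mult[OF M N(1), where 'a = complex] N(3) of_real_hom.mat_hom_one by metis
    have "v = (complexify M * complexify N) *\<^sub>v v" unfolding MN using v by simp
    also have "\<dots> = complexify M *\<^sub>v (z \<cdot>\<^sub>v v)"
      using M N v by (subst assoc_mult_mat_vec[of _ m m _ m]) auto
    also have "\<dots> = z \<cdot>\<^sub>v (complexify M *\<^sub>v v)"
      using M v by (subst mult_mat_vec[of _ m m]) auto
    finally have e: "v = z \<cdot>\<^sub>v (complexify M *\<^sub>v v)" .
    have z0: "z \<noteq> 0"
    proof
      assume "z = 0"
      then have "v = 0\<^sub>v m" using e M v by (intro eq_vecI) (auto, metis index_smult_vec(1) mult_zero_left carrier_vecD dim_mult_mat_vec carrier_matD(1) index_map_mat(2))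
      then show False using v by simp
    qed
    have "complexify M *\<^sub>v v = (1 / z) \<cdot>\<^sub>v v"
      by (subst e) (use z0 in \<open>simp add: smult_smult_assoc\<close>)
    then have "eigenvalue (complexify M) (1 / z)"
      using M v unfolding eigenvalue_def eigenvector_def by auto
    then have "1 < cmod (1 / z)" using antistable by blast
    then show ?thesis using z0 by (simp add: norm_divide)
  qed
  then show thesis using that N by blast
qed

lemma homogeneous_system:
  fixes f :: "nat \<Rightarrow> nat \<Rightarrow> real"
  assumes J: "finite J" "card J < N"
  obtains v where "v \<in> carrier_vec N" "v \<noteq> 0\<^sub>v N" "\<And>i. i \<in> J \<Longrightarrow> (\<Sum>j<N. f i j * v $ j) = 0"
proof -
  obtain g where g: "bij_betw g {0..<card J} J"
    using J(1) ex_bij_betw_nat_finite by blast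
  \<comment> \<open>The equations are padded by zero rows to a square system. Row
    \<open>card J\<close> is zero, so a right inverse \<open>L\<close> would make a diagonal entry
    of the identity equal to 0.\<close>
  define M where "M = mat N N (\<lambda>(i, j). if i < card J then f (g i) j else 0)"
  have M: "M \<in> carrier_mat N N" by (simp add: M_def)
  have "det M = 0"
  proof (rule ccontr)
    assume "det M \<noteq> 0"
    then have "M \<in> Units (ring_mat TYPE(real) N ())" by (rule det_non_zero_imp_unit[OF M])
    then obtain L where L: "L \<in> carrier_mat N N" "M * L = 1\<^sub>m N"
      unfolding Units_def ring_mat_def by auto
    have "(M * L) $$ (card J, card J) = 0"
      using J(2) L(1) by (simp add: M_def scalar_prod_def)
    then show False using L(2) J(2) by simp
  qed
  then obtain v where v: "v \<in> carrier_vec N" "v \<noteq> 0\<^sub>v N" "M *\<^sub>v v = 0\<^sub>v N"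
    using det_0_iff_vec_prod_zero_field[OF M] by auto
  have "(\<Sum>j<N. f i j * v $ j) = 0" if i: "i \<in> J" for i
  proof -
    have "i \<in> g ` {0..<card J}" using g i by (simp add: bij_betw_def)
    then obtain k where k: "k < card J" "i = g k" by auto
    then have "k < N" using J by simp
    then show ?thesis
      using arg_cong[OF v(3), of "\<lambda>w. w $ k"] k v(1)
      by (simp add: M_def scalar_prod_def lessThan_atLeast0)
  qed
  then show thesis using that v by blast
qed

text \<open>The state reached from \<open>0\<close> under the input \<open>x (N - 1), \<dots>, x 1, x 0\<close>.\<close>

fun drive :: "real mat \<Rightarrow> real vec \<Rightarrow> (nat \<Rightarrow> real) \<Rightarrow> nat \<Rightarrow> real vec" where
  "drive M b x 0 = 0\<^sub>v (dim_vec b)"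
| "drive M b x (Suc N) = M *\<^sub>v drive M b (\<lambda>j. x (Suc j)) N + x 0 \<cdot>\<^sub>v b"

lemma drive_carrier [simp]:
  "M \<in> carrier_mat n n \<Longrightarrow> b \<in> carrier_vec n \<Longrightarrow> drive M b x N \<in> carrier_vec n"
  by (induction N arbitrary: x) auto

text \<open>A Hankel matrix maps past inputs to future outputs through the state at time 0:
  \<open>x j\<close> is the input j + 1 steps before that time, and the left side is the free output
  at time i.\<close>

lemma scalar_prod_iter_drive:
  assumes "M \<in> carrier_mat n n" "b \<in> carrier_vec n" "a \<in> carrier_vec n"
  shows "a \<bullet> iter M i (drive M b x N) = (\<Sum>j<N. (a \<bullet> iter M (i + j) b) * x j)"
proof (induction N arbitrary: x i)
  case 0
  then show ?case using assms by (simp add: iter_zero)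
next
  case (Suc N)
  have "iter M i (drive M b x (Suc N)) =
      iter M (Suc i) (drive M b (\<lambda>j. x (Suc j)) N) + x 0 \<cdot>\<^sub>v iter M i b"
    using assms
    by (simp add: iter_add_vec[of M n] iter_smult[of M n] iter_commute[symmetric] del: funpow.simps)
  then have "a \<bullet> iter M i (drive M b x (Suc N)) =
      a \<bullet> iter M (Suc i) (drive M b (\<lambda>j. x (Suc j)) N) + x 0 * (a \<bullet> iter M i b)"
    using assms by (simp add: scalar_prod_add_distrib[of _ n] del: funpow.simps)
  also have "\<dots> = (\<Sum>j<N. (a \<bullet> iter M (Suc i + j) b) * x (Suc j)) + x 0 * (a \<bullet> iter M i b)"
    unfolding Suc.IH ..
  also have "\<dots> = (\<Sum>j<Suc N. (a \<bullet> iter M (i + j) b) * x j)"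
    unfolding sum.lessThan_Suc_shift by simp
  finally show ?case .
qed

section \<open>Stable and antistable part\<close>

lemma split_vec:
  assumes "v \<in> carrier_vec (a + b)"
  obtains x y where "x \<in> carrier_vec a" "y \<in> carrier_vec b" "v = x @\<^sub>v y"
  using assms that vec_first_last_append[OF assms] by (metis vec_first_carrier vec_last_carrier)

lemma append_vec_add_smult:
  fixes x y x' y' :: "real vec"
  assumes "x \<in> carrier_vec a" "x' \<in> carrier_vec a" "y \<in> carrier_vec b" "y' \<in> carrier_vec b"
  shows "(x @\<^sub>v y) + r \<cdot>\<^sub>v (x' @\<^sub>v y') = (x + r \<cdot>\<^sub>v x') @\<^sub>v (y + r \<cdot>\<^sub>v y')"
  by (rule eq_vecI) (use assms in auto)

lemma add_zero_smult:
  fixes v b :: "real vec"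
  shows "v \<in> carrier_vec k \<Longrightarrow> b \<in> carrier_vec k \<Longrightarrow> v + 0 \<cdot>\<^sub>v b = v"
  by (auto intro!: eq_vecI)

locale split_solution = sylvester_solution +
  fixes \<alpha> \<alpha>' :: "real vec" and t :: real and m :: nat
    and S S_inv A\<^sub>p A\<^sub>m :: "real mat" and \<alpha>\<^sub>p \<alpha>\<^sub>m \<beta>\<^sub>p \<beta>\<^sub>m :: "real vec"
  assumes t: "t * t = 1" and \<alpha>_eq: "\<alpha> = t \<cdot>\<^sub>v \<beta>"
    and \<alpha>'_carrier: "\<alpha>' \<in> carrier_vec q" and \<alpha>'_eq: "\<And>i. i < q \<Longrightarrow> \<alpha>' $ i = - (t * \<rho> i * \<beta>' $ i)"
    and decay: "\<And>i. i < n \<Longrightarrow> (\<lambda>j. iter A j \<beta> $ i) \<longlonglongrightarrow> 0"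
    and m: "m \<le> q"
    and blocks [simp]: "A\<^sub>p \<in> carrier_mat m m" "A\<^sub>m \<in> carrier_mat (q - m) (q - m)"
      "\<alpha>\<^sub>p \<in> carrier_vec m" "\<alpha>\<^sub>m \<in> carrier_vec (q - m)"
      "\<beta>\<^sub>p \<in> carrier_vec m" "\<beta>\<^sub>m \<in> carrier_vec (q - m)"
    and S [simp]: "S \<in> carrier_mat q q" "S_inv \<in> carrier_mat q q"
    and S_inverse: "S * S_inv = 1\<^sub>m q" "S_inv * S = 1\<^sub>m q"
    and block_diag: "S_inv * A' * S =
      four_block_mat A\<^sub>p (0\<^sub>m m (q - m)) (0\<^sub>m (q - m) m) A\<^sub>m"
    and stable: "\<forall>z. eigenvalue (complexify A\<^sub>p) z \<longrightarrow> cmod z < 1"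
    and antistable: "\<forall>z. eigenvalue (complexify A\<^sub>m) z \<longrightarrow> cmod z > 1"
    and split: "S\<^sup>T *\<^sub>v \<alpha>' = \<alpha>\<^sub>p @\<^sub>v \<alpha>\<^sub>m" "S_inv *\<^sub>v \<beta>' = \<beta>\<^sub>p @\<^sub>v \<beta>\<^sub>m"
begin

lemma append_carrier: "u \<in> carrier_vec m \<Longrightarrow> w \<in> carrier_vec (q - m) \<Longrightarrow> u @\<^sub>v w \<in> carrier_vec q"
  using append_carrier_vec[of u m w "q - m"] m by simp

definition emb :: "real vec \<Rightarrow> real vec \<Rightarrow> real vec" where "emb u w = S *\<^sub>v (u @\<^sub>v w)"

lemma emb_carrier [simp]: "u \<in> carrier_vec m \<Longrightarrow> w \<in> carrier_vec (q - m) \<Longrightarrow> emb u w \<in> carrier_vec q"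
  using append_carrier[of u w] mult_mat_vec_carrier[OF S(1)] by (simp add: emb_def del: S)

lemma emb_step:
  assumes u: "u \<in> carrier_vec m" and w: "w \<in> carrier_vec (q - m)"
  shows "A' *\<^sub>v emb u w + r \<cdot>\<^sub>v \<beta>' = emb (A\<^sub>p *\<^sub>v u + r \<cdot>\<^sub>v \<beta>\<^sub>p) (A\<^sub>m *\<^sub>v w + r \<cdot>\<^sub>v \<beta>\<^sub>m)"
proof -
  let ?B = "four_block_mat A\<^sub>p (0\<^sub>m m (q - m)) (0\<^sub>m (q - m) m) A\<^sub>m"
  have B: "?B \<in> carrier_mat q q"
    using four_block_carrier_mat[OF blocks(1,2)] m by simp
  have uw: "u @\<^sub>v w \<in> carrier_vec q" using append_carrier u w by blast
  have "S * ?B = (S * S_inv) * (A' * S)"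
    unfolding block_diag[symmetric] assoc_mult_mat[OF S(2) A' S(1)]
    by (rule assoc_mult_mat[OF S mult_carrier_mat[OF A' S(1)], symmetric])
  also have "\<dots> = A' * S"
    unfolding S_inverse by (rule left_mult_one_mat) (rule mult_carrier_mat[OF A' S(1)])
  finally have "A' *\<^sub>v emb u w = S *\<^sub>v (?B *\<^sub>v (u @\<^sub>v w))"
    unfolding emb_def using assoc_mult_mat_vec[OF S(1) B uw] assoc_mult_mat_vec[OF A' S(1) uw] by simp
  also have "?B *\<^sub>v (u @\<^sub>v w) = (A\<^sub>p *\<^sub>v u) @\<^sub>v (A\<^sub>m *\<^sub>v w)"
    by (rule mult_mat_vec_split) (use u w in auto)
  finally have 1: "A' *\<^sub>v emb u w = S *\<^sub>v ((A\<^sub>p *\<^sub>v u) @\<^sub>v (A\<^sub>m *\<^sub>v w))" .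
  have "\<beta>' = (S * S_inv) *\<^sub>v \<beta>'" unfolding S_inverse by simp
  also have "\<dots> = S *\<^sub>v (\<beta>\<^sub>p @\<^sub>v \<beta>\<^sub>m)"
    using assoc_mult_mat_vec[OF S(1,2) \<beta>'] split(2) by simp
  finally have 2: "\<beta>' = S *\<^sub>v (\<beta>\<^sub>p @\<^sub>v \<beta>\<^sub>m)" .
  have c: "(A\<^sub>p *\<^sub>v u) @\<^sub>v (A\<^sub>m *\<^sub>v w) \<in> carrier_vec q" "\<beta>\<^sub>p @\<^sub>v \<beta>\<^sub>m \<in> carrier_vec q"
    using u w by (auto intro!: append_carrier mult_mat_vec_carrier[OF blocks(1)]
        mult_mat_vec_carrier[OF blocks(2)] simp del: blocks simp: blocks(5,6))
  have c3: "r \<cdot>\<^sub>v (\<beta>\<^sub>p @\<^sub>v \<beta>\<^sub>m) \<in> carrier_vec q" using c(2) by simp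
  have "A' *\<^sub>v emb u w + r \<cdot>\<^sub>v \<beta>' =
      S *\<^sub>v (((A\<^sub>p *\<^sub>v u) @\<^sub>v (A\<^sub>m *\<^sub>v w)) + r \<cdot>\<^sub>v (\<beta>\<^sub>p @\<^sub>v \<beta>\<^sub>m))"
    unfolding 1 by (subst 2)
      (simp only: mult_add_distrib_mat_vec[OF S(1) c(1) c3] mult_mat_vec[OF S(1) c(2)])
  also have "((A\<^sub>p *\<^sub>v u) @\<^sub>v (A\<^sub>m *\<^sub>v w)) + r \<cdot>\<^sub>v (\<beta>\<^sub>p @\<^sub>v \<beta>\<^sub>m) =
      (A\<^sub>p *\<^sub>v u + r \<cdot>\<^sub>v \<beta>\<^sub>p) @\<^sub>v (A\<^sub>m *\<^sub>v w + r \<cdot>\<^sub>v \<beta>\<^sub>m)"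
    by (rule append_vec_add_smult[of _ m _ _ "q - m"]) (use u w mult_mat_vec_carrier blocks in blast)+
  finally show ?thesis unfolding emb_def .
qed

lemma \<alpha>'_emb:
  assumes u: "u \<in> carrier_vec m" and w: "w \<in> carrier_vec (q - m)"
  shows "\<alpha>' \<bullet> emb u w = \<alpha>\<^sub>p \<bullet> u + \<alpha>\<^sub>m \<bullet> w"
proof -
  have uw: "u @\<^sub>v w \<in> carrier_vec q" using append_carrier u w by blast
  have "\<alpha>' \<bullet> emb u w = (S\<^sup>T *\<^sub>v \<alpha>') \<bullet> (u @\<^sub>v w)"
    unfolding emb_def by (rule transpose_vec_mult_scalar[OF S(1) uw \<alpha>'_carrier, symmetric])
  also have "\<dots> = \<alpha>\<^sub>p \<bullet> u + \<alpha>\<^sub>m \<bullet> w"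
    unfolding split by (rule scalar_prod_append) (use u w in auto)
  finally show ?thesis .
qed

lemma \<alpha>_carrier [simp]: "\<alpha> \<in> carrier_vec n"
  by (simp add: \<alpha>_eq)

text \<open>Since \<alpha> = t \<beta> and \<alpha>' = - t R \<beta>', the output of the difference
  automaton is t times the output in \<open>energy_step\<close>. The squares agree, and the constant
  becomes \<open>t * c\<close>.\<close>

lemma energy_emb_step:
  obtains c where "\<And>x u w r. x \<in> carrier_vec n \<Longrightarrow> u \<in> carrier_vec m \<Longrightarrow> w \<in> carrier_vec (q - m) \<Longrightarrow>
    energy (A *\<^sub>v x + r \<cdot>\<^sub>v \<beta>) (emb (A\<^sub>p *\<^sub>v u + r \<cdot>\<^sub>v \<beta>\<^sub>p) (A\<^sub>m *\<^sub>v w + r \<cdot>\<^sub>v \<beta>\<^sub>m))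
      + (\<alpha> \<bullet> x - \<alpha>\<^sub>p \<bullet> u - \<alpha>\<^sub>m \<bullet> w + c * r)\<^sup>2 = energy x (emb u w) + s\<^sup>2 * r\<^sup>2"
proof -
  obtain c where c: "\<And>x x' r. x \<in> carrier_vec n \<Longrightarrow> x' \<in> carrier_vec q \<Longrightarrow>
    energy (A *\<^sub>v x + r \<cdot>\<^sub>v \<beta>) (A' *\<^sub>v x' + r \<cdot>\<^sub>v \<beta>')
      + (\<beta> \<bullet> x + (\<Sum>i<q. \<rho> i * \<beta>' $ i * x' $ i) + c * r)\<^sup>2 = energy x x' + s\<^sup>2 * r\<^sup>2"
    using energy_step by blast
  show thesis
  proof (rule that[of "t * c"])
    fix x u w :: "real vec" and r :: real
    assume x: "x \<in> carrier_vec n" and u: "u \<in> carrier_vec m" and w: "w \<in> carrier_vec (q - m)"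
    have "\<alpha>' \<bullet> emb u w = (\<Sum>i<q. - (t * \<rho> i * \<beta>' $ i) * emb u w $ i)"
      using carrier_vecD[OF emb_carrier[OF u w]] \<alpha>'_eq
      by (simp add: scalar_prod_def lessThan_atLeast0)
    also have "\<dots> = - t * (\<Sum>i<q. \<rho> i * \<beta>' $ i * emb u w $ i)"
      by (simp add: sum_distrib_left sum_negf mult.assoc)
    finally have "- \<alpha>\<^sub>p \<bullet> u - \<alpha>\<^sub>m \<bullet> w = t * (\<Sum>i<q. \<rho> i * \<beta>' $ i * emb u w $ i)"
      using \<alpha>'_emb[OF u w] u by simp
    moreover have "\<alpha> \<bullet> x = t * (\<beta> \<bullet> x)" using x by (simp add: \<alpha>_eq)
    ultimately have "\<alpha> \<bullet> x - \<alpha>\<^sub>p \<bullet> u - \<alpha>\<^sub>m \<bullet> w + t * c * r =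
        t * (\<beta> \<bullet> x + (\<Sum>i<q. \<rho> i * \<beta>' $ i * emb u w $ i) + c * r)"
      using u by (simp add: algebra_simps)
    then have "(\<alpha> \<bullet> x - \<alpha>\<^sub>p \<bullet> u - \<alpha>\<^sub>m \<bullet> w + t * c * r)\<^sup>2 =
        (\<beta> \<bullet> x + (\<Sum>i<q. \<rho> i * \<beta>' $ i * emb u w $ i) + c * r)\<^sup>2"
      using t by (simp add: power_mult_distrib power2_eq_square[of t])
    then show "energy (A *\<^sub>v x + r \<cdot>\<^sub>v \<beta>) (emb (A\<^sub>p *\<^sub>v u + r \<cdot>\<^sub>v \<beta>\<^sub>p) (A\<^sub>m *\<^sub>v w + r \<cdot>\<^sub>v \<beta>\<^sub>m))
      + (\<alpha> \<bullet> x - \<alpha>\<^sub>p \<bullet> u - \<alpha>\<^sub>m \<bullet> w + t * c * r)\<^sup>2 = energy x (emb u w) + s\<^sup>2 * r\<^sup>2"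
      using c[OF x emb_carrier[OF u w], of r] emb_step[OF u w, of r] by simp
  qed
qed

lemma energy_free_step:
  assumes "x \<in> carrier_vec n" "u \<in> carrier_vec m" "w \<in> carrier_vec (q - m)"
  shows "energy (A *\<^sub>v x) (emb (A\<^sub>p *\<^sub>v u) (A\<^sub>m *\<^sub>v w)) + (\<alpha> \<bullet> x - \<alpha>\<^sub>p \<bullet> u - \<alpha>\<^sub>m \<bullet> w)\<^sup>2
    = energy x (emb u w)"
proof -
  obtain c where c: "\<And>x u w r. x \<in> carrier_vec n \<Longrightarrow> u \<in> carrier_vec m \<Longrightarrow> w \<in> carrier_vec (q - m) \<Longrightarrow>
    energy (A *\<^sub>v x + r \<cdot>\<^sub>v \<beta>) (emb (A\<^sub>p *\<^sub>v u + r \<cdot>\<^sub>v \<beta>\<^sub>p) (A\<^sub>m *\<^sub>v w + r \<cdot>\<^sub>v \<beta>\<^sub>m))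
      + (\<alpha> \<bullet> x - \<alpha>\<^sub>p \<bullet> u - \<alpha>\<^sub>m \<bullet> w + c * r)\<^sup>2 = energy x (emb u w) + s\<^sup>2 * r\<^sup>2"
    using energy_emb_step by blast
  have "A *\<^sub>v x + 0 \<cdot>\<^sub>v \<beta> = A *\<^sub>v x" "A\<^sub>p *\<^sub>v u + 0 \<cdot>\<^sub>v \<beta>\<^sub>p = A\<^sub>p *\<^sub>v u" "A\<^sub>m *\<^sub>v w + 0 \<cdot>\<^sub>v \<beta>\<^sub>m = A\<^sub>m *\<^sub>v w"
    by (rule add_zero_smult[OF mult_mat_vec_carrier[OF A assms(1)] \<beta>]
        add_zero_smult[OF mult_mat_vec_carrier[OF blocks(1) assms(2)] blocks(5)]
        add_zero_smult[OF mult_mat_vec_carrier[OF blocks(2) assms(3)] blocks(6)])+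
  then show ?thesis using c[OF assms, of 0] by simp
qed

lemma energy_tendsto_0:
  assumes x: "\<And>i. i < n \<Longrightarrow> (\<lambda>k. x k $ i) \<longlonglongrightarrow> 0"
    and u: "\<And>k. u k \<in> carrier_vec m" "\<And>i. i < m \<Longrightarrow> (\<lambda>k. u k $ i) \<longlonglongrightarrow> 0"
    and w: "\<And>k. w k \<in> carrier_vec (q - m)" "\<And>i. i < q - m \<Longrightarrow> (\<lambda>k. w k $ i) \<longlonglongrightarrow> 0"
  shows "(\<lambda>k. energy (x k) (emb (u k) (w k))) \<longlonglongrightarrow> 0"
proof -
  have uw: "(\<lambda>k. (u k @\<^sub>v w k) $ j) \<longlonglongrightarrow> 0" if "j < q" for j
  proof -
    have "(u k @\<^sub>v w k) $ j = (if j < m then u k $ j else w k $ (j - m))" for k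
      using u(1)[of k] w(1)[of k] that m by (auto simp: index_append_vec)
    then show ?thesis using u(2) w(2) that m by (cases "j < m") auto
  qed
  have e: "(\<lambda>k. emb (u k) (w k) $ i) \<longlonglongrightarrow> 0" if i: "i < q" for i
  proof -
    have "emb (u k) (w k) $ i = (\<Sum>j = 0..<q. S $$ (i, j) * (u k @\<^sub>v w k) $ j)" for k
      using carrier_vecD[OF append_carrier[OF u(1) w(1), of k k]] i carrier_matD[OF S(1)]
      by (simp add: emb_def scalar_prod_def del: index_append_vec)
    moreover have "(\<lambda>k. \<Sum>j = 0..<q. S $$ (i, j) * (u k @\<^sub>v w k) $ j)
        \<longlonglongrightarrow> (\<Sum>j = 0..<q. S $$ (i, j) * 0)"
      using uw by (intro tendsto_intros) auto
    ultimately show ?thesis by simp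
  qed
  have "(\<lambda>k. energy (x k) (emb (u k) (w k))) \<longlonglongrightarrow>
      (\<Sum>i<n. d i * 0\<^sup>2) + (\<Sum>i<q. \<rho> i * (2 * 0 * 0 - d i * 0\<^sup>2))"
    unfolding energy_def using x e by (intro tendsto_intros) (auto simp: n_def)
  then show ?thesis by simp
qed

lemma iter_drive_tendsto_0:
  assumes "i < n"
  shows "(\<lambda>k. iter A k (drive A \<beta> x N) $ i) \<longlonglongrightarrow> 0"
proof -
  have "iter A k (drive A \<beta> x N) $ i = (\<Sum>j<N. iter A (k + j) \<beta> $ i * x j)" for k
    using scalar_prod_iter_drive[OF A \<beta> unit_vec_carrier[of n i], of k x N] assms by simp
  moreover have "(\<lambda>k. \<Sum>j<N. iter A (k + j) \<beta> $ i * x j) \<longlonglongrightarrow> (\<Sum>j<N. 0 * x j)"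
    by (intro tendsto_intros LIMSEQ_ignore_initial_segment[OF decay[OF assms]])
  ultimately show ?thesis by simp
qed

section \<open>From the energy balance to the norm bound\<close>

lemma output_le_energy:
  assumes x: "x \<in> carrier_vec n" "\<And>i. i < n \<Longrightarrow> (\<lambda>k. iter A k x $ i) \<longlonglongrightarrow> 0"
    and u: "u \<in> carrier_vec m"
  shows "(\<Sum>i<I. (\<alpha> \<bullet> iter A i x - \<alpha>\<^sub>p \<bullet> iter A\<^sub>p i u)\<^sup>2) \<le> energy x (emb u (0\<^sub>v (q - m)))"
proof -
  define E where "E k = energy (iter A k x) (emb (iter A\<^sub>p k u) (0\<^sub>v (q - m)))" for k
  have step: "E (Suc k) + (\<alpha> \<bullet> iter A k x - \<alpha>\<^sub>p \<bullet> iter A\<^sub>p k u)\<^sup>2 = E k" for k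
    using energy_free_step[of "iter A k x" "iter A\<^sub>p k u" "0\<^sub>v (q - m)"] x(1) u
      iter_zero[OF blocks(2), of 1] by (simp add: E_def)
  \<comment> \<open>With no input and no antistable component, the energy decreases by the squared
    outputs and tends to 0 with the state. It is therefore never negative, and the total output
    cannot exceed its initial value.\<close>
  have "E (Suc k) \<le> E k" for k
    using step[of k] zero_le_power2[of "\<alpha> \<bullet> iter A k x - \<alpha>\<^sub>p \<bullet> iter A\<^sub>p k u"] by linarith
  then have "decseq E" by (rule decseq_SucI)
  moreover have "E \<longlonglongrightarrow> 0"
    unfolding E_def by (rule energy_tendsto_0) (use x u stable_iter_tendsto_0[OF blocks(1) stable] in auto)
  ultimately have "0 \<le> E I" using decseq_ge by blast
  moreover have "E I + (\<Sum>i<I. (\<alpha> \<bullet> iter A i x - \<alpha>\<^sub>p \<bullet> iter A\<^sub>p i u)\<^sup>2) = E 0"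
  proof (induction I)
    case (Suc I)
    then show ?case using step[of I] by simp
  qed simp
  ultimately show ?thesis by (simp add: E_def)
qed

lemma energy_stable_nonneg:
  assumes u: "u \<in> carrier_vec m"
  shows "0 \<le> energy (0\<^sub>v n) (emb u (0\<^sub>v (q - m)))"
  using output_le_energy[of "0\<^sub>v n" u 0] u by (simp add: iter_zero[OF A])

text \<open>The same argument with time reversed: along backward iterates of the antistable block
  the energy increases to its limit 0.\<close>

lemma energy_antistable_nonpos:
  assumes w: "w \<in> carrier_vec (q - m)"
  shows "energy (0\<^sub>v n) (emb (0\<^sub>v m) w) \<le> 0"
proof -
  obtain B where B: "B \<in> carrier_mat (q - m) (q - m)" "A\<^sub>m * B = 1\<^sub>m (q - m)"
    "\<forall>z. eigenvalue (complexify B) z \<longrightarrow> cmod z < 1"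
    using antistable_inverse[OF blocks(2) antistable] by blast
  define E where "E k = energy (0\<^sub>v n) (emb (0\<^sub>v m) (iter B k w))" for k
  have "E k \<le> E (Suc k)" for k
  proof -
    have "A\<^sub>m *\<^sub>v iter B (Suc k) w = (A\<^sub>m * B) *\<^sub>v iter B k w"
      using assoc_mult_mat_vec[OF blocks(2) B(1), of "iter B k w"] B(1) w by simp
    also have "\<dots> = iter B k w" using B w by simp
    finally have 1: "A\<^sub>m *\<^sub>v iter B (Suc k) w = iter B k w" .
    have 2: "A *\<^sub>v 0\<^sub>v n = 0\<^sub>v n" "A\<^sub>p *\<^sub>v 0\<^sub>v m = 0\<^sub>v m" using iter_zero[OF A, of 1] iter_zero[OF blocks(1), of 1] by simp_all
    have "E k + (\<alpha>\<^sub>m \<bullet> iter B (Suc k) w)\<^sup>2 = E (Suc k)"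
      using energy_free_step[of "0\<^sub>v n" "0\<^sub>v m" "iter B (Suc k) w"] iter_carrier[OF B(1) w, of "Suc k"]
      unfolding 1 2 E_def[symmetric] by simp
    then show ?thesis
      using zero_le_power2[of "\<alpha>\<^sub>m \<bullet> iter B (Suc k) w"] by linarith
  qed
  then have "incseq E" by (intro incseq_SucI)
  moreover have "E \<longlonglongrightarrow> 0"
    unfolding E_def by (rule energy_tendsto_0) (use B w stable_iter_tendsto_0[OF B(1,3) w] in auto)
  ultimately have "E 0 \<le> 0" by (rule incseq_le)
  then show ?thesis by (simp add: E_def)
qed

text \<open>The final antistable state is arbitrary, and its past is computed backwards, which is
  why \<open>w\<close> varies in the induction. Before the first input only an antistable component
  is present, with energy at most 0, so the final energy is at most what the inputs supply.\<close>

lemma energy_drive_le: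
  assumes w: "w \<in> carrier_vec (q - m)"
  shows "energy (drive A \<beta> x N) (emb (drive A\<^sub>p \<beta>\<^sub>p x N) w) \<le> s\<^sup>2 * (\<Sum>j<N. (x j)\<^sup>2)"
  using w
proof (induction N arbitrary: x w)
  case 0
  then show ?case using energy_antistable_nonpos by (simp add: carrier_vecD[OF blocks(5)])
next
  case (Suc N)
  obtain c where c: "\<And>x u w r. x \<in> carrier_vec n \<Longrightarrow> u \<in> carrier_vec m \<Longrightarrow> w \<in> carrier_vec (q - m) \<Longrightarrow>
    energy (A *\<^sub>v x + r \<cdot>\<^sub>v \<beta>) (emb (A\<^sub>p *\<^sub>v u + r \<cdot>\<^sub>v \<beta>\<^sub>p) (A\<^sub>m *\<^sub>v w + r \<cdot>\<^sub>v \<beta>\<^sub>m))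
      + (\<alpha> \<bullet> x - \<alpha>\<^sub>p \<bullet> u - \<alpha>\<^sub>m \<bullet> w + c * r)\<^sup>2 = energy x (emb u w) + s\<^sup>2 * r\<^sup>2"
    using energy_emb_step by blast
  obtain B where B: "B \<in> carrier_mat (q - m) (q - m)" "A\<^sub>m * B = 1\<^sub>m (q - m)"
    using antistable_inverse[OF blocks(2) antistable] by blast
  \<comment> \<open>The antistable state just before the last input \<open>x 0\<close> has to be
    \<open>B\<close> applied to \<open>v\<close>, so that the step ends in \<open>w\<close>.\<close>
  define v where "v = w - x 0 \<cdot>\<^sub>v \<beta>\<^sub>m"
  have v: "v \<in> carrier_vec (q - m)" using Suc.prems by (simp add: v_def)
  have Bv: "B *\<^sub>v v \<in> carrier_vec (q - m)" using B v by (metis mult_mat_vec_carrier)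
  have "A\<^sub>m *\<^sub>v (B *\<^sub>v v) = (A\<^sub>m * B) *\<^sub>v v" using assoc_mult_mat_vec[OF blocks(2) B(1) v] by simp
  also have "\<dots> = v" using B v by simp
  finally have "A\<^sub>m *\<^sub>v (B *\<^sub>v v) = v" .
  moreover have "v + x 0 \<cdot>\<^sub>v \<beta>\<^sub>m = w"
    unfolding v_def
    by (rule eq_vecI) (simp_all add: carrier_vecD[OF Suc.prems] carrier_vecD[OF blocks(6)])
  ultimately have "A\<^sub>m *\<^sub>v (B *\<^sub>v v) + x 0 \<cdot>\<^sub>v \<beta>\<^sub>m = w" by simp
  then have "energy (drive A \<beta> x (Suc N)) (emb (drive A\<^sub>p \<beta>\<^sub>p x (Suc N)) w)
      + (\<alpha> \<bullet> drive A \<beta> (\<lambda>j. x (Suc j)) N - \<alpha>\<^sub>p \<bullet> drive A\<^sub>p \<beta>\<^sub>p (\<lambda>j. x (Suc j)) N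
        - \<alpha>\<^sub>m \<bullet> (B *\<^sub>v v) + c * x 0)\<^sup>2
      = energy (drive A \<beta> (\<lambda>j. x (Suc j)) N) (emb (drive A\<^sub>p \<beta>\<^sub>p (\<lambda>j. x (Suc j)) N) (B *\<^sub>v v)) + s\<^sup>2 * (x 0)\<^sup>2"
    using c[of "drive A \<beta> (\<lambda>j. x (Suc j)) N" "drive A\<^sub>p \<beta>\<^sub>p (\<lambda>j. x (Suc j)) N" "B *\<^sub>v v" "x 0"] Bv
    by simp
  then have "energy (drive A \<beta> x (Suc N)) (emb (drive A\<^sub>p \<beta>\<^sub>p x (Suc N)) w)
      \<le> energy (drive A \<beta> (\<lambda>j. x (Suc j)) N) (emb (drive A\<^sub>p \<beta>\<^sub>p (\<lambda>j. x (Suc j)) N) (B *\<^sub>v v)) + s\<^sup>2 * (x 0)\<^sup>2"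
    using zero_le_power2[of "\<alpha> \<bullet> drive A \<beta> (\<lambda>j. x (Suc j)) N
      - \<alpha>\<^sub>p \<bullet> drive A\<^sub>p \<beta>\<^sub>p (\<lambda>j. x (Suc j)) N - \<alpha>\<^sub>m \<bullet> (B *\<^sub>v v) + c * x 0"] by linarith
  also have "\<dots> \<le> s\<^sup>2 * (\<Sum>j<N. (x (Suc j))\<^sup>2) + s\<^sup>2 * (x 0)\<^sup>2"
    using Suc.IH[OF Bv] by simp
  also have "\<dots> = s\<^sup>2 * (\<Sum>j<Suc N. (x j)\<^sup>2)"
    unfolding sum.lessThan_Suc_shift by (simp add: algebra_simps)
  finally show ?case .
qed

text \<open>The past inputs \<open>x\<close> are combined with antistable state 0 at time 0. The
  future output is then that of H - G, and its total is bounded by the energy at time 0, hence by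
  the supply from the past.\<close>

theorem section_bound:
  "(\<Sum>i<I. (\<Sum>j<N. (\<alpha> \<bullet> iter A (i + j) \<beta> - \<alpha>\<^sub>p \<bullet> iter A\<^sub>p (i + j) \<beta>\<^sub>p) * x j)\<^sup>2)
    \<le> s\<^sup>2 * (\<Sum>j<N. (x j)\<^sup>2)"
proof -
  have "(\<Sum>i<I. (\<Sum>j<N. (\<alpha> \<bullet> iter A (i + j) \<beta> - \<alpha>\<^sub>p \<bullet> iter A\<^sub>p (i + j) \<beta>\<^sub>p) * x j)\<^sup>2) =
      (\<Sum>i<I. (\<alpha> \<bullet> iter A i (drive A \<beta> x N) - \<alpha>\<^sub>p \<bullet> iter A\<^sub>p i (drive A\<^sub>p \<beta>\<^sub>p x N))\<^sup>2)"
    by (simp add: scalar_prod_iter_drive[of _ n] scalar_prod_iter_drive[of _ m] left_diff_distrib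
        sum_subtractf)
  also have "\<dots> \<le> energy (drive A \<beta> x N) (emb (drive A\<^sub>p \<beta>\<^sub>p x N) (0\<^sub>v (q - m)))"
    by (rule output_le_energy) (auto intro: iter_drive_tendsto_0)
  also have "\<dots> \<le> s\<^sup>2 * (\<Sum>j<N. (x j)\<^sup>2)" by (rule energy_drive_le) simp
  finally show ?thesis .
qed

lemma energy_zero: "x' \<in> carrier_vec q \<Longrightarrow> energy (0\<^sub>v n) x' = (\<Sum>i<q. - (\<rho> i * d i) * (x' $ i)\<^sup>2)"
  unfolding energy_def by (simp add: n_def mult.assoc)

lemma emb_eq_0:
  assumes u: "u \<in> carrier_vec m" and w: "w \<in> carrier_vec (q - m)"
    and "\<And>i. i < q \<Longrightarrow> emb u w $ i = 0"
  shows "u = 0\<^sub>v m" "w = 0\<^sub>v (q - m)"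
proof -
  have uw: "u @\<^sub>v w \<in> carrier_vec q" using append_carrier u w by blast
  have "emb u w = 0\<^sub>v q" using assms(3) carrier_vecD[OF emb_carrier[OF u w]] by (intro eq_vecI) auto
  then have "(S_inv * S) *\<^sub>v (u @\<^sub>v w) = S_inv *\<^sub>v 0\<^sub>v q"
    unfolding emb_def using assoc_mult_mat_vec[OF S(2,1) uw] by simp
  then have e: "u @\<^sub>v w = 0\<^sub>v q"
    unfolding S_inverse using uw iter_zero[OF S(2), of 1] by simp
  have 1: "(u @\<^sub>v w) $ i = (if i < m then u $ i else w $ (i - m))" if "i < q" for i
    using u w that m by (auto simp: index_append_vec)
  show "u = 0\<^sub>v m"
  proof (rule eq_vecI)
    fix i assume "i < dim_vec (0\<^sub>v m)"
    then show "u $ i = 0\<^sub>v m $ i" using 1[of i] e m by simp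
  qed (use u in simp)
  show "w = 0\<^sub>v (q - m)"
  proof (rule eq_vecI)
    fix i assume "i < dim_vec (0\<^sub>v (q - m))"
    then show "w $ i = 0\<^sub>v (q - m) $ i" using 1[of "m + i"] e m by simp
  qed (use w in simp)
qed

text \<open>The energy is nonnegative on the stable and nonpositive on the antistable subspace, and it is
  nondegenerate on \<open>0 \<oplus> \<real>\<^sup>q\<close>; by Sylvester's law of inertia the number of stable states is its
  positive index.\<close>

theorem stable_dimension:
  assumes "\<And>i. i < q \<Longrightarrow> \<rho> i \<noteq> 0"
  shows "m = card {i. i < q \<and> \<rho> i < 0}"
proof (rule ccontr)
  define J where "J b = {i. i < q \<and> (if b then \<rho> i < 0 else 0 < \<rho> i)}" for b
  have J: "finite (J b)" for b by (simp add: J_def)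
  have "card (J True) + card (J False) = card (J True \<union> J False)"
    using J by (intro card_Un_disjoint[symmetric]) (auto simp: J_def)
  also have "J True \<union> J False = {..<q}" using assms by (force simp: J_def)
  finally have card: "card (J True) + card (J False) = q" by simp
  \<comment> \<open>With first state 0 the energy is diagonal. If x' vanishes where the diagonal
    coefficient has one sign, the energy has the other sign, so the opposite inequality forces x' to
    be zero. The Boolean treats both signs at once.\<close>
  have zero: "x' $ i = 0"
    if x': "x' \<in> carrier_vec q" and J0: "\<And>i. i \<in> J b \<Longrightarrow> x' $ i = 0"
      and e: "if b then 0 \<le> energy (0\<^sub>v n) x' else energy (0\<^sub>v n) x' \<le> 0" and i: "i < q" for x' b i
  proof -
    define f where "f i = (if b then 1 else -1) * (\<rho> i * d i) * (x' $ i)\<^sup>2" for i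
    have f0: "0 \<le> f i" if "i < q" for i
      using J0[of i] that d_pos[of i] unfolding f_def n_def J_def
      by (cases "i \<in> J b") (auto simp: J_def n_def mult_le_0_iff zero_le_mult_iff not_less)
    have "energy (0\<^sub>v n) x' = (if b then -1 else 1) * (\<Sum>i<q. f i)"
      unfolding energy_zero[OF x'] f_def by (simp add: sum_distrib_left sum_negf)
    then have "(\<Sum>i<q. f i) \<le> 0" using e by (auto split: if_splits)
    moreover have "0 \<le> (\<Sum>i<q. f i)" using f0 by (intro sum_nonneg) auto
    ultimately have "(\<Sum>i<q. f i) = 0" by simp
    then have "f i = 0" using f0 i by (subst (asm) sum_nonneg_eq_0_iff) auto
    then show ?thesis using assms[OF i] d_pos[of i] i by (auto simp: f_def n_def split: if_splits)
  qed
  have S_row: "emb u w $ i = (\<Sum>j<q. S $$ (i, j) * (u @\<^sub>v w) $ j)"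
    if "u \<in> carrier_vec m" "w \<in> carrier_vec (q - m)" "i < q" for u w i
    using carrier_vecD[OF append_carrier[OF that(1,2)]] that(3) carrier_matD[OF S(1)]
    by (simp add: emb_def scalar_prod_def lessThan_atLeast0 del: index_append_vec)
  assume "m \<noteq> card {i. i < q \<and> \<rho> i < 0}"
  then have "card (J True) \<noteq> m" by (simp add: J_def)
  \<comment> \<open>In either case one of the two invariant subspaces has larger dimension than the
    number of coordinates to be annihilated, and so contains a nonzero vector to which
    \<open>zero\<close> applies.\<close>
  then consider "card (J True) < m" | "card (J False) < q - m"
    using card m by linarith
  then show False
  proof cases
    case 1
    obtain u where u: "u \<in> carrier_vec m" "u \<noteq> 0\<^sub>v m"
      "\<And>i. i \<in> J True \<Longrightarrow> (\<Sum>j<m. S $$ (i, j) * u $ j) = 0"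
      using homogeneous_system[OF J 1, of "\<lambda>i j. S $$ (i, j)"] by blast
    let ?w = "0\<^sub>v (q - m)"
    have "emb u ?w $ i = (\<Sum>j<m. S $$ (i, j) * u $ j)" if "i < q" for i
    proof -
      have "(\<Sum>j<q. S $$ (i, j) * (u @\<^sub>v ?w) $ j) = (\<Sum>j<m. S $$ (i, j) * (u @\<^sub>v ?w) $ j)"
        by (rule sum.mono_neutral_right) (use m u(1) in \<open>auto simp: index_append_vec\<close>)
      also have "\<dots> = (\<Sum>j<m. S $$ (i, j) * u $ j)"
        using u(1) by (intro sum.cong) (auto simp: index_append_vec)
      finally show ?thesis using S_row[OF u(1) _ that, of ?w] by simp
    qed
    then have "emb u ?w $ i = 0" if "i < q" for i
      using zero[of "emb u ?w" True i] u energy_stable_nonneg[OF u(1)] that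
      by (auto simp: J_def)
    then show False using emb_eq_0(1)[OF u(1), of ?w] u(2) by simp
  next
    case 2
    obtain w where w: "w \<in> carrier_vec (q - m)" "w \<noteq> 0\<^sub>v (q - m)"
      "\<And>i. i \<in> J False \<Longrightarrow> (\<Sum>j<q - m. S $$ (i, m + j) * w $ j) = 0"
      using homogeneous_system[OF J 2, of "\<lambda>i j. S $$ (i, m + j)"] by blast
    let ?u = "0\<^sub>v m"
    have "emb ?u w $ i = (\<Sum>j<q - m. S $$ (i, m + j) * w $ j)" if "i < q" for i
    proof -
      have "(\<Sum>j<q. S $$ (i, j) * (?u @\<^sub>v w) $ j) = (\<Sum>j\<in>{m..<q}. S $$ (i, j) * (?u @\<^sub>v w) $ j)"
        by (rule sum.mono_neutral_right) (use m w(1) in \<open>auto simp: index_append_vec\<close>)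
      also have "\<dots> = (\<Sum>j<q - m. S $$ (i, m + j) * w $ j)"
        by (rule sum.reindex_bij_witness[of _ "\<lambda>j. m + j" "\<lambda>j. j - m"])
          (use w(1) in \<open>auto simp: index_append_vec\<close>)
      finally show ?thesis using S_row[OF _ w(1) that, of ?u] by simp
    qed
    then have "emb ?u w $ i = 0" if "i < q" for i
      using zero[of "emb ?u w" False i] w energy_antistable_nonpos[OF w(1)] that
      by (auto simp: J_def)
    then show False using emb_eq_0(2)[OF _ w(1), of ?u] w(2) by simp
  qed
qed

lemma emb_inverse:
  assumes u: "u \<in> carrier_vec m" and w: "w \<in> carrier_vec (q - m)"
  shows "S_inv *\<^sub>v emb u w = u @\<^sub>v w"
proof -
  have uw: "u @\<^sub>v w \<in> carrier_vec q" using append_carrier u w by blast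
  show ?thesis
    unfolding emb_def using assoc_mult_mat_vec[OF S(2,1) uw] uw by (simp add: S_inverse)
qed

text \<open>With second state 0 the energy is x^T D x, a Lyapunov function for A. Its positive
  weights bound every coordinate of the orbit.\<close>

lemma iter_bounded:
  obtains C where "\<And>k i. i < n \<Longrightarrow> \<bar>iter A k (unit_vec n q) $ i\<bar> \<le> C"
proof -
  define E where "E k = (\<Sum>i<n. d i * (iter A k (unit_vec n q) $ i)\<^sup>2)" for k
  have emb0: "emb (0\<^sub>v m) (0\<^sub>v (q - m)) = 0\<^sub>v q"
  proof -
    have "0\<^sub>v m @\<^sub>v 0\<^sub>v (q - m) = (0\<^sub>v q :: real vec)" using m by (intro eq_vecI) auto
    then show ?thesis using iter_zero[OF S(1), of 1] by (simp add: emb_def)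
  qed
  have E: "energy (iter A k (unit_vec n q)) (emb (0\<^sub>v m) (0\<^sub>v (q - m))) = E k" for k
    unfolding energy_def emb0 E_def by simp
  have "E (Suc k) \<le> E k" for k
  proof -
    have "E (Suc k) + (\<alpha> \<bullet> iter A k (unit_vec n q))\<^sup>2 = E k"
      using energy_free_step[of "iter A k (unit_vec n q)" "0\<^sub>v m" "0\<^sub>v (q - m)"]
        iter_zero[OF blocks(1), of 1] iter_zero[OF blocks(2), of 1] E[of k] E[of "Suc k"]
      by simp
    then show ?thesis using zero_le_power2[of "\<alpha> \<bullet> iter A k (unit_vec n q)"] by linarith
  qed
  then have E_le: "E k \<le> E 0" for k
    using decseqD[OF decseq_SucI, of E 0 k] by simp
  have E0: "0 \<le> E 0" unfolding E_def using d_pos by (intro sum_nonneg) (simp add: less_imp_le)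
  show thesis
  proof (rule that)
    fix k i assume i: "i < n"
    let ?y = "iter A k (unit_vec n q) $ i"
    have "d i * ?y\<^sup>2 \<le> E k"
      unfolding E_def using i d_pos
      by (intro member_le_sum[of i "{..<n}" "\<lambda>i. d i * (iter A k (unit_vec n q) $ i)\<^sup>2"])
        (auto simp: less_imp_le)
    then have "d i * ?y\<^sup>2 \<le> E 0" using E_le[of k] by linarith
    then have "?y\<^sup>2 \<le> E 0 / d i" using d_pos[OF i] by (simp add: field_simps)
    \<comment> \<open>The sum over all coordinates replaces a maximum and makes the bound
      independent of i.\<close>
    also have "\<dots> \<le> (\<Sum>i<n. E 0 / d i)"
      using i E0 d_pos by (intro member_le_sum[of i "{..<n}" "\<lambda>i. E 0 / d i"]) (auto simp: less_imp_le)
    finally have "?y\<^sup>2 \<le> (\<Sum>i<n. E 0 / d i)" .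
    then show "\<bar>?y\<bar> \<le> sqrt (\<Sum>i<n. E 0 / d i)"
      using real_sqrt_le_mono by fastforce
  qed
qed

text \<open>The rank-\<open>m\<close> Hankel matrix annihilates the Schmidt vector belonging to \<open>s\<close>: by the Sylvester
  equation, the stable coordinates of the truncations of \<open>A\<^sup>k e\<^sub>q\<close> form a trajectory that is driven
  by this vector, starts at \<open>0\<close>, and decays.\<close>

theorem Schmidt_vector_annihilated:
  "(\<lambda>j. (\<alpha>\<^sub>p \<bullet> iter A\<^sub>p (i + j) \<beta>\<^sub>p) * iter A j \<beta> $ q) sums 0"
proof -
  define y where "y k = iter A k (unit_vec n q)" for k
  define r where "r k = vec q (\<lambda>i. y k $ i)" for k
  define b where "b k = iter A k \<beta> $ q" for k
  have qn: "q < n" by (simp add: n_def)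
  have y: "y k \<in> carrier_vec n" for k by (simp add: y_def)
  have r: "r k \<in> carrier_vec q" for k by (simp add: r_def)
  have b: "\<beta> \<bullet> y k = b k" for k
  proof -
    have "\<beta> \<bullet> y k = iter A k \<beta> \<bullet> unit_vec n q"
      using iter_symmetric[OF A A_symmetric \<beta>, of "unit_vec n q" k] by (simp add: y_def)
    then show ?thesis using qn by (simp add: b_def scalar_prod_right_unit[of _ n])
  qed
  \<comment> \<open>The Sylvester equation applied to \<open>y k\<close>. As \<open>A\<close> maps
    \<open>y k\<close> to \<open>y (Suc k)\<close>, the auxiliary dynamics runs towards smaller k,
    and the input \<open>b k\<close> is the Schmidt vector up to a factor.\<close>
  have r_step: "r k = A' *\<^sub>v r (Suc k) + b k \<cdot>\<^sub>v \<beta>'" for k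
  proof (rule eq_vecI)
    fix i assume "i < dim_vec (A' *\<^sub>v r (Suc k) + b k \<cdot>\<^sub>v \<beta>')"
    then have i: "i < q" by simp
    have yS: "y (Suc k) $ l = (\<Sum>j<n. A $$ (l, j) * y k $ j)" if "l < q" for l
      using that carrier_vecD[OF y[of k]]
      by (simp add: y_def n_def scalar_prod_def lessThan_atLeast0[symmetric])
    have \<beta>y: "\<beta> \<bullet> y k = (\<Sum>j<n. \<beta> $ j * y k $ j)"
      using carrier_vecD[OF y[of k]] by (simp add: scalar_prod_def lessThan_atLeast0)
    have "r k $ i = (\<Sum>j<n. (if i = j then 1 else 0) * y k $ j)"
      using i by (simp add: r_def n_def if_distrib[of "\<lambda>x. x * _"] cong: if_cong)
    also have "\<dots> = (\<Sum>j<n. ((\<Sum>l<q. A' $$ (i, l) * A $$ (l, j)) + \<beta>' $ i * \<beta> $ j) * y k $ j)"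
      using sylvester[OF i] by (intro sum.cong) auto
    also have "\<dots> = (\<Sum>j<n. \<Sum>l<q. A' $$ (i, l) * A $$ (l, j) * y k $ j) + \<beta>' $ i * (\<beta> \<bullet> y k)"
      unfolding \<beta>y by (simp add: distrib_right sum.distrib sum_distrib_left sum_distrib_right mult.assoc)
    also have "(\<Sum>j<n. \<Sum>l<q. A' $$ (i, l) * A $$ (l, j) * y k $ j) =
        (\<Sum>l<q. \<Sum>j<n. A' $$ (i, l) * A $$ (l, j) * y k $ j)" by (rule sum.swap)
    also have "\<dots> = (\<Sum>l<q. A' $$ (i, l) * y (Suc k) $ l)"
      using yS by (simp add: sum_distrib_left mult.assoc)
    also have "\<dots> + \<beta>' $ i * (\<beta> \<bullet> y k) = (A' *\<^sub>v r (Suc k) + b k \<cdot>\<^sub>v \<beta>') $ i"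
      using i b[of k] by (simp add: r_def scalar_prod_def lessThan_atLeast0)
    finally show "r k $ i = (A' *\<^sub>v r (Suc k) + b k \<cdot>\<^sub>v \<beta>') $ i" .
  qed (simp add: r_def)
  have "\<exists>u w. u \<in> carrier_vec m \<and> w \<in> carrier_vec (q - m) \<and> S_inv *\<^sub>v r k = u @\<^sub>v w" for k
    using split_vec[of "S_inv *\<^sub>v r k" m "q - m"] mult_mat_vec_carrier[OF S(2) r[of k]] m
    by (metis le_add_diff_inverse)
  then obtain u w where uw: "\<And>k. u k \<in> carrier_vec m" "\<And>k. w k \<in> carrier_vec (q - m)"
    "\<And>k. S_inv *\<^sub>v r k = u k @\<^sub>v w k" by metis
  have r_emb: "r k = emb (u k) (w k)" for k
    unfolding emb_def uw(3)[symmetric]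
    using assoc_mult_mat_vec[OF S r[of k]] r[of k] by (simp add: S_inverse)
  have u_step: "u k = A\<^sub>p *\<^sub>v u (Suc k) + b k \<cdot>\<^sub>v \<beta>\<^sub>p" for k
  proof -
    let ?u = "A\<^sub>p *\<^sub>v u (Suc k) + b k \<cdot>\<^sub>v \<beta>\<^sub>p" and ?w = "A\<^sub>m *\<^sub>v w (Suc k) + b k \<cdot>\<^sub>v \<beta>\<^sub>m"
    have c: "?u \<in> carrier_vec m" "?w \<in> carrier_vec (q - m)"
      using mult_mat_vec_carrier[OF blocks(1) uw(1)] mult_mat_vec_carrier[OF blocks(2) uw(2)]
      by (auto intro!: add_carrier_vec)
    have "emb (u k) (w k) = emb ?u ?w"
      using r_step[of k] emb_step[OF uw(1,2), of "Suc k" "Suc k" "b k"] by (simp add: r_emb)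
    then have "u k @\<^sub>v w k = ?u @\<^sub>v ?w"
      using emb_inverse[OF uw(1,2), of k k] emb_inverse[OF c] by metis
    then show ?thesis using append_vec_eq[OF uw(1) c(1)] by metis
  qed
  have u_drive: "u k = iter A\<^sub>p N (u (k + N)) + drive A\<^sub>p \<beta>\<^sub>p (\<lambda>j. b (k + j)) N" for k N
  proof (induction N arbitrary: k)
    case 0
    show ?case using uw(1)[of k] by (simp add: carrier_vecD[OF blocks(5)])
  next
    case (Suc N)
    have 1: "iter A\<^sub>p N (u (Suc k + N)) \<in> carrier_vec m"
      "drive A\<^sub>p \<beta>\<^sub>p (\<lambda>j. b (Suc k + j)) N \<in> carrier_vec m" using uw(1) by simp_all
    have "u k = A\<^sub>p *\<^sub>v (iter A\<^sub>p N (u (Suc k + N)) + drive A\<^sub>p \<beta>\<^sub>p (\<lambda>j. b (Suc k + j)) N) + b k \<cdot>\<^sub>v \<beta>\<^sub>p"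
      using u_step[of k] Suc.IH[of "Suc k"] by simp
    also have "\<dots> = A\<^sub>p *\<^sub>v iter A\<^sub>p N (u (Suc k + N))
        + (A\<^sub>p *\<^sub>v drive A\<^sub>p \<beta>\<^sub>p (\<lambda>j. b (Suc k + j)) N + b k \<cdot>\<^sub>v \<beta>\<^sub>p)"
      unfolding mult_add_distrib_mat_vec[OF blocks(1) 1]
      by (rule assoc_add_vec[of _ m])
        (use mult_mat_vec_carrier[OF blocks(1) 1(1)] mult_mat_vec_carrier[OF blocks(1) 1(2)] in simp_all)
    finally show ?case by simp
  qed
  obtain C where C: "\<And>k i. i < n \<Longrightarrow> \<bar>y k $ i\<bar> \<le> C"
    using iter_bounded unfolding y_def by blast
  define K where "K = (\<Sum>l<q. \<Sum>j<q. \<bar>S_inv $$ (l, j)\<bar> * C)"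
  have C0: "0 \<le> C" using C[OF qn, of 0] by linarith
  have u_bound: "\<bar>u k $ l\<bar> \<le> K" if l: "l < m" for k l
  proof -
    have lq: "l < q" using l m by simp
    have "u k $ l = (S_inv *\<^sub>v r k) $ l"
      unfolding uw(3) using l uw(1,2)[of k] by simp
    also have "\<dots> = (\<Sum>j<q. S_inv $$ (l, j) * y k $ j)"
      using lq carrier_matD[OF S(2)] by (simp add: r_def scalar_prod_def lessThan_atLeast0)
    also have "\<bar>\<dots>\<bar> \<le> (\<Sum>j<q. \<bar>S_inv $$ (l, j) * y k $ j\<bar>)" by (rule sum_abs)
    also have "\<dots> \<le> (\<Sum>j<q. \<bar>S_inv $$ (l, j)\<bar> * C)"
      using C by (intro sum_mono) (simp add: abs_mult mult_left_mono n_def)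
    also have "\<dots> \<le> K"
      unfolding K_def using lq C0
      by (intro member_le_sum[of l "{..<q}" "\<lambda>l. \<Sum>j<q. \<bar>S_inv $$ (l, j)\<bar> * C"])
        (auto intro!: sum_nonneg mult_nonneg_nonneg)
    finally show ?thesis .
  qed
  have u0: "u 0 = 0\<^sub>v m"
  proof (rule emb_eq_0(1)[OF uw(1,2)])
    show "emb (u 0) (w 0) $ i = 0" if "i < q" for i
      using that by (simp add: r_emb[symmetric] r_def y_def n_def unit_vec_def)
  qed
  \<comment> \<open>The stable state at index 0 is zero, so the contribution of the inputs cancels
    that of the far state \<open>u N\<close>, which stable powers damp while it stays
    bounded.\<close>
  have "(\<Sum>j<N. (\<alpha>\<^sub>p \<bullet> iter A\<^sub>p (i + j) \<beta>\<^sub>p) * b j) = - (\<alpha>\<^sub>p \<bullet> iter A\<^sub>p (N + i) (u N))" for N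
  proof -
    have c: "iter A\<^sub>p N (u N) \<in> carrier_vec m" "drive A\<^sub>p \<beta>\<^sub>p b N \<in> carrier_vec m" using uw(1) by simp_all
    have "0\<^sub>v m = iter A\<^sub>p i (iter A\<^sub>p N (u N) + drive A\<^sub>p \<beta>\<^sub>p b N)"
      using u_drive[of 0 N] u0 iter_zero[OF blocks(1), of i] by simp
    also have "\<dots> = iter A\<^sub>p (i + N) (u N) + iter A\<^sub>p i (drive A\<^sub>p \<beta>\<^sub>p b N)"
      using iter_add_vec[OF blocks(1) c] by (simp add: iter_iter)
    finally have "\<alpha>\<^sub>p \<bullet> 0\<^sub>v m = \<alpha>\<^sub>p \<bullet> iter A\<^sub>p (i + N) (u N) + \<alpha>\<^sub>p \<bullet> iter A\<^sub>p i (drive A\<^sub>p \<beta>\<^sub>p b N)"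
      using scalar_prod_add_distrib[OF blocks(3) iter_carrier[OF blocks(1) uw(1)] iter_carrier[OF blocks(1) c(2)]]
      by metis
    then show ?thesis
      using scalar_prod_iter_drive[OF blocks(1,5,3), of i b N] by (simp add: add.commute)
  qed
  moreover have "(\<lambda>N. - (\<alpha>\<^sub>p \<bullet> iter A\<^sub>p (N + i) (u N))) \<longlonglongrightarrow> 0"
  proof -
    \<comment> \<open>The truncated difference is only a device: after the shift by i its argument
      is exactly N.\<close>
    have "(\<lambda>k. iter A\<^sub>p k (u (k - i)) $ l) \<longlonglongrightarrow> 0" if "l < m" for l
      by (rule stable_iter_bounded_tendsto_0[OF blocks(1) stable]) (use uw(1) u_bound that in auto)
    from LIMSEQ_ignore_initial_segment[OF this, of _ i]
    have 1: "(\<lambda>N. iter A\<^sub>p (N + i) (u N) $ l) \<longlonglongrightarrow> 0" if "l < m" for l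
      using that by simp
    have "(\<lambda>N. - (\<Sum>l = 0..<m. \<alpha>\<^sub>p $ l * iter A\<^sub>p (N + i) (u N) $ l)) \<longlonglongrightarrow>
        - (\<Sum>l = 0..<m. \<alpha>\<^sub>p $ l * 0)"
      using 1 by (intro tendsto_intros) auto
    then show ?thesis
      using carrier_vecD[OF iter_carrier[OF blocks(1) uw(1)]] by (simp add: scalar_prod_def)
  qed
  ultimately show ?thesis unfolding sums_def b_def by presburger
qed

end

section \<open>Operators on square-summable sequences\<close>

lemma ell2_summable_mult:
  assumes "x \<in> ell2" "y \<in> ell2"
  shows "summable (\<lambda>i. x i * y i)"
proof (rule summable_comparison_test')
  show "summable (\<lambda>i. (x i)\<^sup>2 + (y i)\<^sup>2)"
    using assms by (auto simp: ell2_def intro: summable_add)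
  show "norm (x i * y i) \<le> (x i)\<^sup>2 + (y i)\<^sup>2" if "0 \<le> i" for i
  proof -
    have "0 \<le> (\<bar>x i\<bar> - \<bar>y i\<bar>)\<^sup>2" by simp
    then have "2 * (\<bar>x i\<bar> * \<bar>y i\<bar>) \<le> (x i)\<^sup>2 + (y i)\<^sup>2" by (simp add: power2_diff)
    moreover have "0 \<le> \<bar>x i\<bar> * \<bar>y i\<bar>" by simp
    ultimately have "\<bar>x i\<bar> * \<bar>y i\<bar> \<le> (x i)\<^sup>2 + (y i)\<^sup>2" by linarith
    then show ?thesis by (simp add: abs_mult)
  qed
qed

lemma bounded_sections:
  fixes K :: inf_mat
  assumes symmetric: "\<And>i j. K i j = K j i" and s: "0 \<le> s"
    and sections: "\<And>I N x. (\<Sum>i<I. (\<Sum>j<N. K i j * x j)\<^sup>2) \<le> s\<^sup>2 * (\<Sum>j<N. (x j)\<^sup>2)"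
    and x: "x \<in> ell2"
  shows "summable (\<lambda>j. K i j * x j)" "inf_mat_apply K x \<in> ell2"
    "ell2_norm (inf_mat_apply K x) \<le> s * ell2_norm x"
proof -
  have row: "K i \<in> ell2" for i
  proof -
    \<comment> \<open>The unit vector at i as input bounds column i, and by symmetry row i.
      Square-summable rows make all the series of the operator converge.\<close>
    have "(\<Sum>j<J. (K i j)\<^sup>2) \<le> s\<^sup>2" for J
      using sections[where I = J and N = "Suc i" and x = "\<lambda>j. if j = i then 1 else 0"]
      by (simp add: symmetric[of i] if_distrib[of "\<lambda>x. _ * x"] if_distrib[of "\<lambda>x. x\<^sup>2"] cong: if_cong)
    then show ?thesis unfolding ell2_def
      by (auto intro!: summableI_nonneg_bounded[of "\<lambda>j. (K i j)\<^sup>2" "s\<^sup>2"])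
  qed
  have summable: "summable (\<lambda>j. K i j * x j)" for i
    using ell2_summable_mult[OF row x] .
  then show "summable (\<lambda>j. K i j * x j)" .
  have bound: "(\<Sum>i<I. (inf_mat_apply K x i)\<^sup>2) \<le> s\<^sup>2 * (\<Sum>j. (x j)\<^sup>2)" for I
  proof (rule LIMSEQ_le_const2)
    show "(\<lambda>N. \<Sum>i<I. (\<Sum>j<N. K i j * x j)\<^sup>2) \<longlonglongrightarrow> (\<Sum>i<I. (inf_mat_apply K x i)\<^sup>2)"
      unfolding inf_mat_apply_def by (intro tendsto_intros summable_LIMSEQ summable)
    have "(\<Sum>i<I. (\<Sum>j<N. K i j * x j)\<^sup>2) \<le> s\<^sup>2 * (\<Sum>j. (x j)\<^sup>2)" for N
    proof -
      have "(\<Sum>j<N. (x j)\<^sup>2) \<le> (\<Sum>j. (x j)\<^sup>2)"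
        using x by (intro sum_le_suminf) (auto simp: ell2_def)
      then show ?thesis
        using sections[where I = I and N = N and x = x] by (meson mult_left_mono order_trans zero_le_power2)
    qed
    then show "\<exists>N. \<forall>n\<ge>N. (\<Sum>i<I. (\<Sum>j<n. K i j * x j)\<^sup>2) \<le> s\<^sup>2 * (\<Sum>j. (x j)\<^sup>2)" by blast
  qed
  have sq: "summable (\<lambda>i. (inf_mat_apply K x i)\<^sup>2)"
    using bound by (intro summableI_nonneg_bounded) auto
  then show "inf_mat_apply K x \<in> ell2" by (simp add: ell2_def)
  have "(\<Sum>i. (inf_mat_apply K x i)\<^sup>2) \<le> s\<^sup>2 * (\<Sum>j. (x j)\<^sup>2)"
    using sq bound by (intro suminf_le_const)
  then have "ell2_norm (inf_mat_apply K x) \<le> sqrt (s\<^sup>2 * (\<Sum>j. (x j)\<^sup>2))"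
    unfolding ell2_norm_def by (rule real_sqrt_le_mono)
  then show "ell2_norm (inf_mat_apply K x) \<le> s * ell2_norm x"
    using s by (simp add: ell2_norm_def real_sqrt_mult)
qed

lemma spectral_norm_eqI:
  assumes bound: "\<And>x. x \<in> ell2 \<Longrightarrow> ell2_norm (inf_mat_apply K x) \<le> s * ell2_norm x" and s: "0 \<le> s"
    and v: "v \<in> ell2" "ell2_norm v = 1" "ell2_norm (inf_mat_apply K v) = s"
  shows "spectral_norm K = s"
  unfolding spectral_norm_def
proof (rule cSup_eq_maximum)
  show "s \<in> {ell2_norm (inf_mat_apply K x) |x. x \<in> ell2 \<and> ell2_norm x \<le> 1}"
    using v by fastforce
  fix y assume "y \<in> {ell2_norm (inf_mat_apply K x) |x. x \<in> ell2 \<and> ell2_norm x \<le> 1}"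
  then obtain x where x: "x \<in> ell2" "ell2_norm x \<le> 1" "y = ell2_norm (inf_mat_apply K x)" by blast
  then show "y \<le> s" using bound[OF x(1)] mult_left_mono[OF x(2) s] by simp
qed

lemma orthonormal_columns_sums:
  assumes "orthonormal_columns n V" "l < n" "l' < n"
  shows "(\<lambda>j. V j l * V j l') sums (if l = l' then 1 else 0)"
proof -
  have "(\<lambda>j. V j l) \<in> ell2" "(\<lambda>j. V j l') \<in> ell2"
    and e: "(\<Sum>j. V j l * V j l') = (if l = l' then 1 else 0)"
    using assms unfolding orthonormal_columns_def by blast+
  from summable_sums[OF ell2_summable_mult[OF this(1,2)]] show ?thesis unfolding e .
qed

lemma compact_svd_apply:
  assumes svd: "compact_svd n M U \<sigma> V" and l: "l < n"
  shows "(\<lambda>j. M i j * V j l) sums (\<sigma> l * U i l)"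
proof -
  have V: "orthonormal_columns n V" and M: "\<And>j. M i j = (\<Sum>l<n. U i l * \<sigma> l * V j l)"
    using svd unfolding compact_svd_def by blast+
  have "(\<lambda>j. \<Sum>l'<n. U i l' * \<sigma> l' * (V j l' * V j l)) sums
      (\<Sum>l'<n. U i l' * \<sigma> l' * (if l' = l then 1 else 0))"
    using orthonormal_columns_sums[OF V _ l] by (intro sums_sum sums_mult) simp
  moreover have "(\<Sum>l'<n. U i l' * \<sigma> l' * (if l' = l then 1 else 0)) = \<sigma> l * U i l"
    using l by (simp add: if_distrib[of "\<lambda>x. _ * x"] cong: if_cong)
  ultimately show ?thesis by (simp add: M sum_distrib_right mult.assoc)
qed

section \<open>Gramians\<close>

locale gramian =
  fixes n :: nat and A :: "real mat" and b :: "real vec" and d :: "nat \<Rightarrow> real"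
  assumes A: "A \<in> carrier_mat n n" and A_symmetric: "A\<^sup>T = A" and b: "b \<in> carrier_vec n"
    and d_pos: "\<And>i. i < n \<Longrightarrow> 0 < d i"
    and gram: "\<And>i j. i < n \<Longrightarrow> j < n \<Longrightarrow>
      (\<lambda>p. iter A p b $ i * iter A p b $ j) sums (if i = j then d i else 0)"
begin

text \<open>In the Gramian series, the terms from p = 1 on sum to A D A, and the term p = 0 is the
  outer product of \<open>b\<close> with itself.\<close>

lemma lyapunov:
  assumes i: "i < n" and j: "j < n"
  shows "(\<Sum>k<n. A $$ (i, k) * d k * A $$ (k, j)) + b $ i * b $ j = (if i = j then d i else 0)"
proof -
  have step: "iter A (Suc p) b $ i = (\<Sum>k<n. A $$ (i, k) * iter A p b $ k)" if "i < n" for p i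
    using that carrier_matD[OF A] carrier_vecD[OF iter_carrier[OF A b, of p]]
    by (simp add: scalar_prod_def lessThan_atLeast0)
  have 1: "(\<lambda>p. \<Sum>k<n. \<Sum>l<n. A $$ (i, k) * A $$ (j, l) * (iter A p b $ k * iter A p b $ l)) sums
      (\<Sum>k<n. \<Sum>l<n. A $$ (i, k) * A $$ (j, l) * (if k = l then d k else 0))"
    using gram by (intro sums_sum sums_mult) auto
  have 2: "(\<Sum>k<n. \<Sum>l<n. A $$ (i, k) * A $$ (j, l) * (iter A p b $ k * iter A p b $ l)) =
      iter A (Suc p) b $ i * iter A (Suc p) b $ j" for p
    unfolding step[OF i] step[OF j] by (simp add: sum_product mult_ac)
  have 3: "(\<Sum>k<n. \<Sum>l<n. A $$ (i, k) * A $$ (j, l) * (if k = l then d k else 0)) =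
      (\<Sum>k<n. A $$ (i, k) * d k * A $$ (k, j))"
    using symmetric_index[OF A A_symmetric] j
    by (intro sum.cong refl) (simp add: if_distrib[of "\<lambda>x. _ * x"] mult_ac cong: if_cong)
  from 1 have "(\<lambda>p. iter A (Suc p) b $ i * iter A (Suc p) b $ j) sums
      (\<Sum>k<n. A $$ (i, k) * d k * A $$ (k, j))" unfolding 2 3 .
  then have "(\<lambda>p. iter A p b $ i * iter A p b $ j) sums
      ((\<Sum>k<n. A $$ (i, k) * d k * A $$ (k, j)) + b $ i * b $ j)"
    by (subst (asm) sums_Suc_iff) simp
  then show ?thesis using gram[OF i j] sums_unique2 by blast
qed

lemma decay:
  assumes "i < n"
  shows "(\<lambda>p. iter A p b $ i) \<longlonglongrightarrow> 0"
proof -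
  have "(\<lambda>p. (iter A p b $ i)\<^sup>2) \<longlonglongrightarrow> 0"
    using gram[OF assms assms] by (auto simp: power2_eq_square intro: summable_LIMSEQ_zero sums_summable)
  then show ?thesis by simp
qed

lemma nonzero:
  assumes "0 < n"
  shows "b \<noteq> 0\<^sub>v n"
proof
  assume "b = 0\<^sub>v n"
  then have "(\<lambda>p. 0) sums d 0" using gram[OF assms assms] assms by (simp add: iter_zero[OF A])
  then have "d 0 = 0" by (rule sums_unique2) simp
  then show False using d_pos[OF assms] by simp
qed

text \<open>For such x the numbers x . A^p b are 2-periodic in p by symmetry and tend to 0, so they
  all vanish. Pairing x with the Gramian then gives \<open>x $ j * d j = 0\<close>.\<close>

lemma no_period_two:
  assumes x: "x \<in> carrier_vec n" and period: "A *\<^sub>v (A *\<^sub>v x) = x"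
  shows "x = 0\<^sub>v n"
proof -
  define w where "w p = x \<bullet> iter A p b" for p
  have "w (Suc (Suc p)) = w p" for p
  proof -
    have "w (Suc (Suc p)) = iter A 2 x \<bullet> iter A p b"
      using iter_symmetric[OF A A_symmetric x, of "iter A p b" 2] A b
      by (simp add: w_def iter_iter numeral_2_eq_2)
    then show ?thesis using period by (simp add: w_def numeral_2_eq_2)
  qed
  then have w_period: "w (p + 2 * k) = w p" for p k
    by (induction k) simp_all
  have w_sum: "w p = (\<Sum>i<n. x $ i * iter A p b $ i)" for p
    using carrier_vecD[OF iter_carrier[OF A b, of p]] by (simp add: w_def scalar_prod_def lessThan_atLeast0)
  have "w \<longlonglongrightarrow> (\<Sum>i<n. x $ i * 0)"
    unfolding w_sum by (intro tendsto_intros decay) simp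
  then have w_lim: "w \<longlonglongrightarrow> 0" by simp
  have w0: "w p = 0" for p
  proof -
    have "filterlim (\<lambda>k. p + 2 * k) sequentially sequentially"
      by (intro filterlim_subseq strict_monoI) simp
    from filterlim_compose[OF w_lim this] have "(\<lambda>k. w p) \<longlonglongrightarrow> 0" by (simp add: w_period)
    then show ?thesis by (simp add: LIMSEQ_const_iff)
  qed
  show ?thesis
  proof (rule eq_vecI)
    fix j assume "j < dim_vec (0\<^sub>v n)"
    then have j: "j < n" by simp
    have "(\<lambda>p. \<Sum>i<n. x $ i * (iter A p b $ i * iter A p b $ j)) sums
        (\<Sum>i<n. x $ i * (if i = j then d i else 0))"
      using gram j by (intro sums_sum sums_mult) auto
    moreover have "(\<Sum>i<n. x $ i * (iter A p b $ i * iter A p b $ j)) = 0" for p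
      using w0[of p] unfolding w_sum by (simp add: mult.assoc[symmetric] sum_distrib_right[symmetric])
    moreover have "(\<Sum>i<n. x $ i * (if i = j then d i else 0)) = x $ j * d j"
      using j by (simp add: if_distrib[of "\<lambda>x. _ * x"] cong: if_cong)
    ultimately have "(\<lambda>p. 0) sums (x $ j * d j)" by simp
    then have "x $ j * d j = 0" by (rule sums_unique2) simp
    then show "x $ j = 0\<^sub>v n $ j" using d_pos[OF j] j by simp
  qed (use x in simp)
qed

end

section \<open>The automata of the construction\<close>

lemma wfa_fun_iter: "is_wfa n W \<Longrightarrow> wfa_fun W x = init_wt W \<bullet> iter (trans_wt W) x (final_wt W)"
  unfolding wfa_fun_def is_wfa_def using pow_mat_mult_vec by metis

lemma backward_row_iter: "is_wfa n W \<Longrightarrow> backward_row W s = iter (trans_wt W) s (final_wt W)"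
  unfolding backward_row_def is_wfa_def using pow_mat_mult_vec by metis

lemma forward_row_iter:
  assumes W: "is_wfa n W" and symmetric: "(trans_wt W)\<^sup>T = trans_wt W" and l: "l < n"
  shows "forward_row W p $ l = iter (trans_wt W) p (init_wt W) $ l"
proof -
  have A: "trans_wt W \<in> carrier_mat n n" and a: "init_wt W \<in> carrier_vec n"
    using W by (auto simp: is_wfa_def)
  have Ap: "trans_wt W ^\<^sub>m p \<in> carrier_mat n n" using A by simp
  have "forward_row W p $ l = forward_row W p \<bullet> unit_vec n l"
    using l Ap a by (simp add: forward_row_def scalar_prod_right_unit[of _ n])
  also have "\<dots> = init_wt W \<bullet> ((trans_wt W ^\<^sub>m p) *\<^sub>v unit_vec n l)"
    unfolding forward_row_def by (rule transpose_vec_mult_scalar[OF Ap _ a]) simp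
  also have "\<dots> = iter (trans_wt W) p (init_wt W) \<bullet> unit_vec n l"
    using iter_symmetric[OF A symmetric a, of "unit_vec n l" p] pow_mat_mult_vec[OF A, of "unit_vec n l" p]
    by simp
  also have "\<dots> = iter (trans_wt W) p (init_wt W) $ l"
    using l iter_carrier[OF A a, of p] by (simp add: scalar_prod_right_unit[of _ n])
  finally show ?thesis .
qed

lemma sum_permutes_lessThan:
  fixes f :: "nat \<Rightarrow> real"
  shows "\<pi> permutes {..<n} \<Longrightarrow> (\<Sum>i<n. f (\<pi> i)) = (\<Sum>i<n. f i)"
  using sum.permute[of \<pi> "{..<n}" f] by (simp add: comp_def)

lemma permutes_less: "\<pi> permutes {..<n} \<Longrightarrow> i < n \<Longrightarrow> \<pi> i < (n :: nat)"
  by (metis lessThan_iff permutes_in_image)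

lemma iter_reorder:
  assumes \<pi>: "\<pi> permutes {..<n}" and A: "A \<in> carrier_mat n n" and v: "v \<in> carrier_vec n"
  shows "iter (mat n n (\<lambda>(i, j). A $$ (\<pi> i, \<pi> j))) k (vec n (\<lambda>i. v $ \<pi> i)) = vec n (\<lambda>i. iter A k v $ \<pi> i)"
proof (induction k)
  case (Suc k)
  have "mat n n (\<lambda>(i, j). A $$ (\<pi> i, \<pi> j)) *\<^sub>v vec n (\<lambda>i. iter A k v $ \<pi> i) =
      vec n (\<lambda>i. (A *\<^sub>v iter A k v) $ \<pi> i)" (is "?l = ?r")
  proof (rule eq_vecI)
    fix i assume "i < dim_vec ?r"
    then have i: "i < n" by simp
    have "?l $ i = (\<Sum>j<n. A $$ (\<pi> i, \<pi> j) * iter A k v $ \<pi> j)"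
      using i by (simp add: scalar_prod_def lessThan_atLeast0)
    also have "\<dots> = (\<Sum>j<n. A $$ (\<pi> i, j) * iter A k v $ j)"
      using sum_permutes_lessThan[OF \<pi>, of "\<lambda>j. A $$ (\<pi> i, j) * iter A k v $ j"] .
    also have "\<dots> = ?r $ i"
      using i permutes_less[OF \<pi> i] carrier_matD[OF A] carrier_vecD[OF iter_carrier[OF A v, of k]]
      by (simp add: scalar_prod_def lessThan_atLeast0)
    finally show "?l $ i = ?r $ i" .
  qed simp
  then show ?case using Suc by simp
qed simp

lemma wfa_fun_reorder:
  assumes \<pi>: "\<pi> permutes {..<n}" and W: "is_wfa n W"
  shows "is_wfa n (reorder n \<pi> W)" "wfa_fun (reorder n \<pi> W) x = wfa_fun W x"
proof -
  show R: "is_wfa n (reorder n \<pi> W)" by (simp add: is_wfa_def reorder_def)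
  have A: "trans_wt W \<in> carrier_mat n n" and a: "init_wt W \<in> carrier_vec n"
    and b: "final_wt W \<in> carrier_vec n"
    using W by (auto simp: is_wfa_def)
  have "wfa_fun (reorder n \<pi> W) x =
      (\<Sum>i<n. init_wt W $ \<pi> i * iter (trans_wt W) x (final_wt W) $ \<pi> i)"
    unfolding wfa_fun_iter[OF R]
    by (simp add: reorder_def iter_reorder[OF \<pi> A b] scalar_prod_def lessThan_atLeast0)
  also have "\<dots> = wfa_fun W x"
    unfolding wfa_fun_iter[OF W]
    using sum_permutes_lessThan[OF \<pi>, of "\<lambda>i. init_wt W $ i * iter (trans_wt W) x (final_wt W) $ i"]
      carrier_vecD[OF iter_carrier[OF A b, of x]]
    by (simp add: scalar_prod_def lessThan_atLeast0)
  finally show "wfa_fun (reorder n \<pi> W) x = wfa_fun W x" .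
qed

lemma gramian_reorder:
  assumes \<pi>: "\<pi> permutes {..<n}" and A: "A \<in> carrier_mat n n" and A_symmetric: "A\<^sup>T = A"
    and v: "v \<in> carrier_vec n" and V: "orthonormal_columns n V" and \<sigma>: "\<And>l. l < n \<Longrightarrow> 0 < \<sigma> l"
    and iter: "\<And>p l. l < n \<Longrightarrow> iter A p v $ l = V p l * sqrt (\<sigma> l)"
  shows "gramian n (mat n n (\<lambda>(i, j). A $$ (\<pi> i, \<pi> j))) (vec n (\<lambda>i. v $ \<pi> i)) (\<lambda>i. \<sigma> (\<pi> i))"
proof
  show "(mat n n (\<lambda>(i, j). A $$ (\<pi> i, \<pi> j)))\<^sup>T = mat n n (\<lambda>(i, j). A $$ (\<pi> i, \<pi> j))"
    using symmetric_index[OF A A_symmetric] permutes_less[OF \<pi>] by (intro eq_matI) auto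
  show "0 < \<sigma> (\<pi> i)" if "i < n" for i using \<sigma> permutes_less[OF \<pi> that] by blast
  fix i j assume i: "i < n" and j: "j < n"
  have l: "\<pi> i < n" "\<pi> j < n" using permutes_less[OF \<pi>] i j by blast+
  have "\<pi> i = \<pi> j \<longleftrightarrow> i = j" using permutes_inj[OF \<pi>] by (auto dest: injD)
  moreover have "(\<lambda>p. sqrt (\<sigma> (\<pi> i)) * sqrt (\<sigma> (\<pi> j)) * (V p (\<pi> i) * V p (\<pi> j))) sums
      (sqrt (\<sigma> (\<pi> i)) * sqrt (\<sigma> (\<pi> j)) * (if \<pi> i = \<pi> j then 1 else 0))"
    by (intro sums_mult orthonormal_columns_sums[OF V l])
  ultimately show "(\<lambda>p. iter (mat n n (\<lambda>(i, j). A $$ (\<pi> i, \<pi> j))) p (vec n (\<lambda>i. v $ \<pi> i)) $ i *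
      iter (mat n n (\<lambda>(i, j). A $$ (\<pi> i, \<pi> j))) p (vec n (\<lambda>i. v $ \<pi> i)) $ j) sums
      (if i = j then \<sigma> (\<pi> i) else 0)"
    using i j l iter \<sigma>[of "\<pi> i"] by (simp add: iter_reorder[OF \<pi> A v] mult_ac split: if_splits)
qed auto

lemma outer_product_eq:
  fixes \<alpha> \<beta> :: "real vec"
  assumes \<alpha>: "\<alpha> \<in> carrier_vec n" and \<beta>: "\<beta> \<in> carrier_vec n" "\<beta> \<noteq> 0\<^sub>v n"
    and eq: "\<And>i j. i < n \<Longrightarrow> j < n \<Longrightarrow> \<alpha> $ i * \<alpha> $ j = \<beta> $ i * \<beta> $ j"
  obtains t where "t * t = 1" "\<alpha> = t \<cdot>\<^sub>v \<beta>"
proof -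
  obtain j where j: "j < n" "\<beta> $ j \<noteq> 0" using \<beta> by (metis carrier_vecD eq_vecI index_zero_vec)
  define t where "t = \<alpha> $ j / \<beta> $ j"
  have t: "t * t = 1" using eq[OF j(1) j(1)] j(2) by (simp add: t_def field_simps)
  have "\<alpha> $ i = t * \<beta> $ i" if "i < n" for i
  proof -
    have "t * \<alpha> $ i = \<beta> $ i" using eq[OF that j(1)] j(2) by (simp add: t_def field_simps)
    then have "t * t * \<alpha> $ i = t * \<beta> $ i" by simp
    then show ?thesis using t by simp
  qed
  then have "\<alpha> = t \<cdot>\<^sub>v \<beta>" using \<alpha> \<beta>(1) by (intro eq_vecI) auto
  then show thesis using that t by blast
qed

lemma row_mat_carrier: "v \<in> carrier_vec n \<Longrightarrow> row_mat v \<in> carrier_mat 1 n"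
  using col_mat_carrier[of v n] by (simp add: row_mat_eq)

lemma of_mat_row_mat: "of_mat (row_mat v) = tr (of_vec v)"
  by (simp add: row_mat_eq of_mat_transpose of_vec_def)

text \<open>Where \<beta>2 is nonzero, substituting the formula for \<beta>' into that for
  \<open>A'\<close> gives both blocks. Where it is zero, the second block is the condition on A12
  and the first is the explicit solvability requirement.\<close>

lemma auxiliary_sylvester:
  assumes aux: "auxiliary_wfa q 1 A\<^sub>1\<^sub>1 A\<^sub>1\<^sub>2 \<alpha>\<^sub>1 \<alpha>\<^sub>2 \<beta>\<^sub>1 \<beta>\<^sub>2 R W'"
    and A\<^sub>1\<^sub>1: "A\<^sub>1\<^sub>1 \<in> carrier_mat q q" and A\<^sub>1\<^sub>2: "A\<^sub>1\<^sub>2 \<in> carrier_mat q 1"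
    and \<beta>\<^sub>1: "\<beta>\<^sub>1 \<in> carrier_vec q" and \<beta>\<^sub>2: "\<beta>\<^sub>2 \<in> carrier_vec 1" and \<alpha>\<^sub>2: "\<alpha>\<^sub>2 = t \<cdot>\<^sub>v \<beta>\<^sub>2" and t: "t * t = 1"
  shows "trans_wt W' * A\<^sub>1\<^sub>1 + col_mat (final_wt W') * row_mat \<beta>\<^sub>1 = 1\<^sub>m q"
    and "trans_wt W' * A\<^sub>1\<^sub>2 + col_mat (final_wt W') * row_mat \<beta>\<^sub>2 = 0\<^sub>m q 1"
proof -
  define A' where "A' = trans_wt W'"
  define b where "b = col_mat (final_wt W')"
  have A': "A' \<in> carrier_mat q q" and b: "b \<in> carrier_mat q 1"
    using aux col_mat_carrier by (auto simp: auxiliary_wfa_def is_wfa_def A'_def b_def)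
  note r1 = row_mat_carrier[OF \<beta>\<^sub>1] and r2 = row_mat_carrier[OF \<beta>\<^sub>2]
  have "of_mat A' * of_mat A\<^sub>1\<^sub>1 + of_mat b * of_mat (row_mat \<beta>\<^sub>1) = of_mat (1\<^sub>m q) \<and>
    of_mat A' * of_mat A\<^sub>1\<^sub>2 + of_mat b * of_mat (row_mat \<beta>\<^sub>2) = 0"
  proof (cases "\<alpha>\<^sub>2 = 0\<^sub>v 1")
    case False
    then have "\<beta>\<^sub>2 \<noteq> 0\<^sub>v 1" using \<alpha>\<^sub>2 by auto
    note p = pseudo_inverse_row_mat[OF \<beta>\<^sub>2 this]
    define p where "p = pseudo_inverse (row_mat \<beta>\<^sub>2)"
    note p = p[folded p_def]
    \<comment> \<open>Here multiplicity one enters: both factors are 1 x 1, so the right inverse of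
      the row is also a left inverse.\<close>
    have "p * row_mat \<beta>\<^sub>2 = row_mat \<beta>\<^sub>2 * p"
      by (rule eq_matI) (use p(1) r2 in \<open>auto simp: scalar_prod_def\<close>)
    then have "of_mat p * of_mat (row_mat \<beta>\<^sub>2) = of_mat (1\<^sub>m 1)"
      using p(2) of_mat_mult[OF p(1) r2] by simp
    moreover have "of_mat A\<^sub>1\<^sub>2 * of_mat (1\<^sub>m 1) = of_mat A\<^sub>1\<^sub>2"
      using of_mat_mult[OF A\<^sub>1\<^sub>2 one_carrier_mat] A\<^sub>1\<^sub>2 by simp
    ultimately have a12: "of_mat A\<^sub>1\<^sub>2 * (of_mat p * of_mat (row_mat \<beta>\<^sub>2)) = of_mat A\<^sub>1\<^sub>2" by simp
    have e: "b = - (A' * A\<^sub>1\<^sub>2 * p)" "A' * (A\<^sub>1\<^sub>1 - A\<^sub>1\<^sub>2 * p * row_mat \<beta>\<^sub>1) = 1\<^sub>m q"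
      using aux False by (auto simp: auxiliary_wfa_def Let_def A'_def b_def p_def)
    have c: "A\<^sub>1\<^sub>2 * p \<in> carrier_mat q 1" "A\<^sub>1\<^sub>2 * p * row_mat \<beta>\<^sub>1 \<in> carrier_mat q q" "A' * A\<^sub>1\<^sub>2 \<in> carrier_mat q 1"
      using A\<^sub>1\<^sub>2 p(1) r1 A' by auto
    have fb: "of_mat b = - (of_mat A' * of_mat A\<^sub>1\<^sub>2 * of_mat p)"
      unfolding e(1) of_mat_uminus of_mat_mult[OF c(3) p(1)] of_mat_mult[OF A' A\<^sub>1\<^sub>2] ..
    have "of_mat A' * (of_mat A\<^sub>1\<^sub>1 - of_mat A\<^sub>1\<^sub>2 * of_mat p * of_mat (row_mat \<beta>\<^sub>1)) = of_mat (1\<^sub>m q)"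
      unfolding e(2)[symmetric] of_mat_mult[OF A' minus_carrier_mat[OF c(2)]]
        of_mat_minus[OF A\<^sub>1\<^sub>1 c(2)] of_mat_mult[OF c(1) r1] of_mat_mult[OF A\<^sub>1\<^sub>2 p(1)] ..
    then show ?thesis
      unfolding fb using a12 by (simp add: algebra_simps)
  next
    case True
    have "\<beta>\<^sub>2 = t \<cdot>\<^sub>v \<alpha>\<^sub>2" using t unfolding \<alpha>\<^sub>2 by (simp add: smult_smult_assoc)
    then have "of_mat (row_mat \<beta>\<^sub>2) = 0" using True by (simp add: of_mat_row_mat of_vec_smult of_vec_zero)
    moreover have e: "A' * A\<^sub>1\<^sub>2 = 0\<^sub>m q 1" "b * row_mat \<beta>\<^sub>1 = 1\<^sub>m q - A' * A\<^sub>1\<^sub>1"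
      using aux True by (auto simp: auxiliary_wfa_def Let_def A'_def b_def)
    moreover have "of_mat A' * of_mat A\<^sub>1\<^sub>2 = 0"
      using of_mat_mult[OF A' A\<^sub>1\<^sub>2] e(1) by (simp add: of_mat_zero)
    moreover have "of_mat b * of_mat (row_mat \<beta>\<^sub>1) = of_mat (1\<^sub>m q) - of_mat A' * of_mat A\<^sub>1\<^sub>1"
      using of_mat_mult[OF b r1] e(2) of_mat_minus[OF one_carrier_mat mult_carrier_mat[OF A' A\<^sub>1\<^sub>1]]
        of_mat_mult[OF A' A\<^sub>1\<^sub>1] by simp
    ultimately show ?thesis by simp
  qed
  then have "of_mat (A' * A\<^sub>1\<^sub>1 + b * row_mat \<beta>\<^sub>1) = of_mat (1\<^sub>m q)"
    "of_mat (A' * A\<^sub>1\<^sub>2 + b * row_mat \<beta>\<^sub>2) = of_mat (0\<^sub>m q 1)"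
    by (simp_all add: of_mat_add[OF mult_carrier_mat[OF A' A\<^sub>1\<^sub>1] mult_carrier_mat[OF b r1]]
        of_mat_add[OF mult_carrier_mat[OF A' A\<^sub>1\<^sub>2] mult_carrier_mat[OF b r2]]
        of_mat_mult[OF A' A\<^sub>1\<^sub>1] of_mat_mult[OF b r1] of_mat_mult[OF A' A\<^sub>1\<^sub>2] of_mat_mult[OF b r2] of_mat_zero)
  then show "trans_wt W' * A\<^sub>1\<^sub>1 + col_mat (final_wt W') * row_mat \<beta>\<^sub>1 = 1\<^sub>m q"
    "trans_wt W' * A\<^sub>1\<^sub>2 + col_mat (final_wt W') * row_mat \<beta>\<^sub>2 = 0\<^sub>m q 1"
    unfolding A'_def[symmetric] b_def[symmetric]
    using A' A\<^sub>1\<^sub>1 A\<^sub>1\<^sub>2 b r1 r2 by (auto elim!: of_mat_inject)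
qed

text \<open>Symmetry of R A' moves R to the left of A' in either formula. The rest is a block of the
  Sylvester equation, which leaves \<open>final_wt W'\<close> times a row against the pseudo-inverse
  of the same row up to the sign t.\<close>

lemma auxiliary_initial:
  assumes aux: "auxiliary_wfa q 1 A\<^sub>1\<^sub>1 A\<^sub>1\<^sub>2 \<alpha>\<^sub>1 \<alpha>\<^sub>2 \<beta>\<^sub>1 \<beta>\<^sub>2 R W'"
    and A\<^sub>1\<^sub>1: "A\<^sub>1\<^sub>1 \<in> carrier_mat q q" and A\<^sub>1\<^sub>2: "A\<^sub>1\<^sub>2 \<in> carrier_mat q 1" and R: "R \<in> carrier_mat q q"
    and \<beta>\<^sub>1: "\<beta>\<^sub>1 \<in> carrier_vec q" and \<beta>\<^sub>2: "\<beta>\<^sub>2 \<in> carrier_vec 1"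
    and \<alpha>\<^sub>1: "\<alpha>\<^sub>1 = t \<cdot>\<^sub>v \<beta>\<^sub>1" and \<alpha>\<^sub>2: "\<alpha>\<^sub>2 = t \<cdot>\<^sub>v \<beta>\<^sub>2" and t: "t * t = 1"
    and nonzero: "\<beta>\<^sub>1 \<noteq> 0\<^sub>v q \<or> \<beta>\<^sub>2 \<noteq> 0\<^sub>v 1"
    and RA': "R * trans_wt W' = (trans_wt W')\<^sup>T * R"
  shows "of_vec (init_wt W') = - t *\<^sub>R (of_mat R * of_vec (final_wt W'))"
proof -
  define A' where "A' = trans_wt W'"
  define b where "b = of_vec (final_wt W')"
  have A': "A' \<in> carrier_mat q q" and fb: "final_wt W' \<in> carrier_vec q"
    using aux by (auto simp: auxiliary_wfa_def is_wfa_def A'_def)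
  have A'T: "A'\<^sup>T \<in> carrier_mat q q" using A' by simp
  note c = col_mat_carrier[OF fb] row_mat_carrier[OF \<beta>\<^sub>1] row_mat_carrier[OF \<beta>\<^sub>2]
  have s1: "of_mat A' * of_mat A\<^sub>1\<^sub>1 + b * tr (of_vec \<beta>\<^sub>1) = of_mat (1\<^sub>m q)"
    and s2: "of_mat A' * of_mat A\<^sub>1\<^sub>2 + b * tr (of_vec \<beta>\<^sub>2) = 0"
    using arg_cong[OF auxiliary_sylvester(1)[OF aux A\<^sub>1\<^sub>1 A\<^sub>1\<^sub>2 \<beta>\<^sub>1 \<beta>\<^sub>2 \<alpha>\<^sub>2 t], of of_mat]
      arg_cong[OF auxiliary_sylvester(2)[OF aux A\<^sub>1\<^sub>1 A\<^sub>1\<^sub>2 \<beta>\<^sub>1 \<beta>\<^sub>2 \<alpha>\<^sub>2 t], of of_mat]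
    unfolding A'_def[symmetric]
      of_mat_add[OF mult_carrier_mat[OF A' A\<^sub>1\<^sub>1] mult_carrier_mat[OF c(1,2)]]
      of_mat_add[OF mult_carrier_mat[OF A' A\<^sub>1\<^sub>2] mult_carrier_mat[OF c(1,3)]]
      of_mat_mult[OF A' A\<^sub>1\<^sub>1] of_mat_mult[OF A' A\<^sub>1\<^sub>2] of_mat_mult[OF c(1,2)] of_mat_mult[OF c(1,3)]
    by (simp_all add: of_mat_zero of_mat_row_mat b_def of_vec_def)
  have fRA': "of_mat (A'\<^sup>T) * of_mat R = of_mat R * of_mat A'"
    using RA' of_mat_mult[OF A'T R] of_mat_mult[OF R A'] by (simp add: A'_def)
  \<comment> \<open>The pseudo-inverse is taken of t v but applied to v; the factor 1 / t is t
    because t squared is 1.\<close>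
  have pinv: "pseudo_inverse (row_mat (t \<cdot>\<^sub>v v)) \<in> carrier_mat k 1"
    "tr (of_vec v) * of_mat (pseudo_inverse (row_mat (t \<cdot>\<^sub>v v))) = t *\<^sub>R unit00"
    if v: "v \<in> carrier_vec k" "v \<noteq> 0\<^sub>v k" for v k
  proof -
    have "t \<cdot>\<^sub>v (t \<cdot>\<^sub>v v) = v" using t by (simp add: smult_smult_assoc)
    moreover have "t \<cdot>\<^sub>v 0\<^sub>v k = 0\<^sub>v k" by (rule eq_vecI) auto
    ultimately have tv: "t \<cdot>\<^sub>v v \<in> carrier_vec k" "t \<cdot>\<^sub>v v \<noteq> 0\<^sub>v k" using v by auto
    note p = pseudo_inverse_row_mat[OF tv]
    show "pseudo_inverse (row_mat (t \<cdot>\<^sub>v v)) \<in> carrier_mat k 1" by (rule p(1))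
    have "of_mat (1\<^sub>m 1) = unit00"
      by (rule fmat_eqI) (auto simp: of_mat.rep_eq unit00.rep_eq)
    then have "t *\<^sub>R (tr (of_vec v) * of_mat (pseudo_inverse (row_mat (t \<cdot>\<^sub>v v)))) = unit00"
      using arg_cong[OF p(2), of of_mat] of_mat_mult[OF row_mat_carrier[OF tv(1)] p(1)]
      by (simp add: of_mat_row_mat of_vec_smult)
    from arg_cong[OF this, of "\<lambda>x. t *\<^sub>R x"] t
    show "tr (of_vec v) * of_mat (pseudo_inverse (row_mat (t \<cdot>\<^sub>v v))) = t *\<^sub>R unit00" by simp
  qed
  have b_col: "b * unit00 = b" using is_col_of_vec[of "final_wt W'"] by (simp add: b_def is_col_def)
  show ?thesis
  proof (cases "\<alpha>\<^sub>2 = 0\<^sub>v 1")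
    case False
    then have "\<beta>\<^sub>2 \<noteq> 0\<^sub>v 1" using \<alpha>\<^sub>2 by auto
    note p = pinv[OF \<beta>\<^sub>2 this, folded \<alpha>\<^sub>2]
    have "col_mat (init_wt W') = A'\<^sup>T * R * A\<^sub>1\<^sub>2 * pseudo_inverse (row_mat \<alpha>\<^sub>2)"
      using aux False by (auto simp: auxiliary_wfa_def Let_def A'_def)
    from arg_cong[OF this, of of_mat]
    have "of_vec (init_wt W') =
        of_mat (A'\<^sup>T) * of_mat R * of_mat A\<^sub>1\<^sub>2 * of_mat (pseudo_inverse (row_mat \<alpha>\<^sub>2))"
      unfolding of_mat_mult[OF mult_carrier_mat[OF mult_carrier_mat[OF A'T R] A\<^sub>1\<^sub>2] p(1)]
        of_mat_mult[OF mult_carrier_mat[OF A'T R] A\<^sub>1\<^sub>2] of_mat_mult[OF A'T R] of_vec_def .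
    also have "\<dots> = of_mat R * (of_mat A' * of_mat A\<^sub>1\<^sub>2) * of_mat (pseudo_inverse (row_mat \<alpha>\<^sub>2))"
      unfolding fRA' by (simp add: mult.assoc)
    also have "of_mat A' * of_mat A\<^sub>1\<^sub>2 = - (b * tr (of_vec \<beta>\<^sub>2))"
      using s2 by (simp add: eq_neg_iff_add_eq_0)
    also have "of_mat R * - (b * tr (of_vec \<beta>\<^sub>2)) * of_mat (pseudo_inverse (row_mat \<alpha>\<^sub>2)) =
        - (of_mat R * (b * (tr (of_vec \<beta>\<^sub>2) * of_mat (pseudo_inverse (row_mat \<alpha>\<^sub>2)))))"
      by (simp add: mult.assoc)
    also have "\<dots> = - t *\<^sub>R (of_mat R * b)" unfolding p(2) using b_col by simp
    finally show ?thesis by (simp add: b_def)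
  next
    case True
    have "\<beta>\<^sub>2 = t \<cdot>\<^sub>v \<alpha>\<^sub>2" using t unfolding \<alpha>\<^sub>2 by (simp add: smult_smult_assoc)
    then have "\<beta>\<^sub>2 = 0\<^sub>v 1" using True by auto
    then have "\<beta>\<^sub>1 \<noteq> 0\<^sub>v q" using nonzero by blast
    note p = pinv[OF \<beta>\<^sub>1 this, folded \<alpha>\<^sub>1]
    have c3: "A'\<^sup>T * R * A\<^sub>1\<^sub>1 \<in> carrier_mat q q" using A'T R A\<^sub>1\<^sub>1 by auto
    have "col_mat (init_wt W') = - ((R - A'\<^sup>T * R * A\<^sub>1\<^sub>1) * pseudo_inverse (row_mat \<alpha>\<^sub>1))"
      using aux True by (auto simp: auxiliary_wfa_def Let_def A'_def)
    from arg_cong[OF this, of of_mat]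
    have "of_vec (init_wt W') = - ((of_mat R - of_mat (A'\<^sup>T) * of_mat R * of_mat A\<^sub>1\<^sub>1) *
        of_mat (pseudo_inverse (row_mat \<alpha>\<^sub>1)))"
      unfolding of_mat_uminus of_mat_mult[OF minus_carrier_mat[OF c3] p(1)] of_mat_minus[OF R c3]
        of_mat_mult[OF mult_carrier_mat[OF A'T R] A\<^sub>1\<^sub>1] of_mat_mult[OF A'T R] of_vec_def .
    also have "of_mat R - of_mat (A'\<^sup>T) * of_mat R * of_mat A\<^sub>1\<^sub>1 =
        of_mat R * (of_mat (1\<^sub>m q) - of_mat A' * of_mat A\<^sub>1\<^sub>1)"
      unfolding fRA' using of_mat_mult[OF R one_carrier_mat] R by (simp add: algebra_simps)
    also have "of_mat (1\<^sub>m q) - of_mat A' * of_mat A\<^sub>1\<^sub>1 = b * tr (of_vec \<beta>\<^sub>1)"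
      unfolding s1[symmetric] by simp
    also have "of_mat R * (b * tr (of_vec \<beta>\<^sub>1)) * of_mat (pseudo_inverse (row_mat \<alpha>\<^sub>1)) =
        of_mat R * (b * (tr (of_vec \<beta>\<^sub>1) * of_mat (pseudo_inverse (row_mat \<alpha>\<^sub>1))))"
      by (simp add: mult.assoc)
    also have "\<dots> = t *\<^sub>R (of_mat R * b)" unfolding p(2) using b_col by simp
    finally show ?thesis by (simp add: b_def)
  qed
qed

theorem theorem3p8:
  fixes n k r m :: nat and \<sigma> :: "nat \<Rightarrow> real" and \<pi> :: "nat \<Rightarrow> nat" and W W' :: wfa
    and A\<^sub>1\<^sub>1 A\<^sub>1\<^sub>2 A\<^sub>2\<^sub>2 \<Sigma> R S S_inv A\<^sub>p A\<^sub>m :: "real mat"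
    and \<alpha>\<^sub>1 \<alpha>\<^sub>2 \<beta>\<^sub>1 \<beta>\<^sub>2 \<alpha>\<^sub>p \<alpha>\<^sub>m \<beta>\<^sub>p \<beta>\<^sub>m :: "real vec"
  assumes sva: "minimal_wfa n W" "sva_form n W \<sigma>"
    and rho: "spectral_radius (complexify (trans_wt W)) < 1"
    and k: "k < n"
    and multiplicity: "0 < r" "k + r \<le> n"
      "\<forall>i<n. (i < k \<longrightarrow> \<sigma> i > \<sigma> k) \<and> (k \<le> i \<and> i < k + r \<longrightarrow> \<sigma> i = \<sigma> k) \<and>
             (k + r \<le> i \<longrightarrow> \<sigma> i < \<sigma> k)"
    and ordering: "\<pi> permutes {..<n}" "\<pi> ` {n - r..<n} = {k..<k + r}"
    and dims: "A\<^sub>1\<^sub>1 \<in> carrier_mat (n - r) (n - r)" "A\<^sub>1\<^sub>2 \<in> carrier_mat (n - r) r"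
      "A\<^sub>2\<^sub>2 \<in> carrier_mat r r"
      "\<alpha>\<^sub>1 \<in> carrier_vec (n - r)" "\<alpha>\<^sub>2 \<in> carrier_vec r"
      "\<beta>\<^sub>1 \<in> carrier_vec (n - r)" "\<beta>\<^sub>2 \<in> carrier_vec r"
    and partition: "trans_wt (reorder n \<pi> W) = four_block_mat A\<^sub>1\<^sub>1 A\<^sub>1\<^sub>2 A\<^sub>1\<^sub>2\<^sup>T A\<^sub>2\<^sub>2"
      "init_wt (reorder n \<pi> W) = \<alpha>\<^sub>1 @\<^sub>v \<alpha>\<^sub>2"
      "final_wt (reorder n \<pi> W) = \<beta>\<^sub>1 @\<^sub>v \<beta>\<^sub>2"
    and Sigma: "\<Sigma> = mat_diag (n - r) (\<lambda>i. \<sigma> (\<pi> i))"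
    and R: "R = (\<sigma> k)\<^sup>2 \<cdot>\<^sub>m 1\<^sub>m (n - r) - \<Sigma> * \<Sigma>"
    and auxiliary: "auxiliary_wfa (n - r) r A\<^sub>1\<^sub>1 A\<^sub>1\<^sub>2 \<alpha>\<^sub>1 \<alpha>\<^sub>2 \<beta>\<^sub>1 \<beta>\<^sub>2 R W'"
    and no_unimodular: "\<forall>z. eigenvalue (complexify (trans_wt W')) z \<longrightarrow> cmod z \<noteq> 1"
    and minimal_diff: "minimal_wfa (n + (n - r)) (wfa_diff (reorder n \<pi> W) W')"
    and m: "m \<le> n - r"
    and blocks: "A\<^sub>p \<in> carrier_mat m m" "A\<^sub>m \<in> carrier_mat (n - r - m) (n - r - m)"
      "\<alpha>\<^sub>p \<in> carrier_vec m" "\<alpha>\<^sub>m \<in> carrier_vec (n - r - m)"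
      "\<beta>\<^sub>p \<in> carrier_vec m" "\<beta>\<^sub>m \<in> carrier_vec (n - r - m)"
    and S: "S \<in> carrier_mat (n - r) (n - r)" "S_inv \<in> carrier_mat (n - r) (n - r)"
      "S * S_inv = 1\<^sub>m (n - r)" "S_inv * S = 1\<^sub>m (n - r)"
    and block_diag: "S_inv * trans_wt W' * S =
      four_block_mat A\<^sub>p (0\<^sub>m m (n - r - m)) (0\<^sub>m (n - r - m) m) A\<^sub>m"
    and stable: "\<forall>z. eigenvalue (complexify A\<^sub>p) z \<longrightarrow> cmod z < 1"
    and antistable: "\<forall>z. eigenvalue (complexify A\<^sub>m) z \<longrightarrow> cmod z > 1"
    and split: "S\<^sup>T *\<^sub>v init_wt W' = \<alpha>\<^sub>p @\<^sub>v \<alpha>\<^sub>m" "S_inv *\<^sub>v final_wt W' = \<beta>\<^sub>p @\<^sub>v \<beta>\<^sub>m"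
  defines "W\<^sub>k \<equiv> \<lparr>init_wt = \<alpha>\<^sub>p, trans_wt = A\<^sub>p, final_wt = \<beta>\<^sub>p\<rparr>"
  shows "is_wfa k W\<^sub>k \<and>
    bounded_operator (\<lambda>i j. hankel W i j - hankel W\<^sub>k i j) \<and>
    spectral_norm (\<lambda>i j. hankel W i j - hankel W\<^sub>k i j) = \<sigma> k"
proof -
  define A where "A = trans_wt (reorder n \<pi> W)"
  define \<alpha> where "\<alpha> = init_wt (reorder n \<pi> W)"
  define \<beta> where "\<beta> = final_wt (reorder n \<pi> W)"
  define d where "d = (\<lambda>i. \<sigma> (\<pi> i))"
  define A' where "A' = trans_wt W'"
  define \<beta>' where "\<beta>' = final_wt W'"
  note block_dims = dims
  have W: "is_wfa n W" using sva by (simp add: minimal_wfa_def)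
  have carriers: "trans_wt W \<in> carrier_mat n n" "init_wt W \<in> carrier_vec n" "final_wt W \<in> carrier_vec n"
    using W by (auto simp: is_wfa_def)
  obtain U V where svd: "compact_svd n (hankel W) U \<sigma> V"
    and forward: "\<And>p l. l < n \<Longrightarrow> forward_row W p $ l = U p l * sqrt (\<sigma> l)"
    and backward: "\<And>s l. l < n \<Longrightarrow> backward_row W s $ l = V s l * sqrt (\<sigma> l)"
    and symmetric: "(trans_wt W)\<^sup>T = trans_wt W"
    using sva(2) unfolding sva_form_def by blast
  have orthonormal: "orthonormal_columns n U" "orthonormal_columns n V"
    and \<sigma>_pos: "\<And>l. l < n \<Longrightarrow> 0 < \<sigma> l"
    using svd unfolding compact_svd_def by blast+
  have iter_init: "iter (trans_wt W) p (init_wt W) $ l = U p l * sqrt (\<sigma> l)" if "l < n" for p l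
    using forward[OF that] forward_row_iter[OF W symmetric that] by simp
  have iter_final: "iter (trans_wt W) p (final_wt W) $ l = V p l * sqrt (\<sigma> l)" if "l < n" for p l
    using backward[OF that] backward_row_iter[OF W] by simp
  have reorder_W: "A = mat n n (\<lambda>(i, j). trans_wt W $$ (\<pi> i, \<pi> j))"
    "\<alpha> = vec n (\<lambda>i. init_wt W $ \<pi> i)" "\<beta> = vec n (\<lambda>i. final_wt W $ \<pi> i)"
    by (simp_all add: A_def \<alpha>_def \<beta>_def reorder_def)
  interpret F: gramian n A \<alpha> d
    unfolding reorder_W d_def
    by (rule gramian_reorder[OF ordering(1) carriers(1) symmetric carriers(2) orthonormal(1) \<sigma>_pos iter_init])
  interpret B: gramian n A \<beta> d
    unfolding reorder_W d_def
    by (rule gramian_reorder[OF ordering(1) carriers(1) symmetric carriers(3) orthonormal(2) \<sigma>_pos iter_final])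
  have \<beta>_nonzero: "\<beta> \<noteq> 0\<^sub>v n" using B.nonzero k by simp
  \<comment> \<open>The two Lyapunov equations have the same Gramian, so the outer squares of
    \<alpha> and \<beta> coincide.\<close>
  obtain t where t: "t * t = 1" and \<alpha>_eq: "\<alpha> = t \<cdot>\<^sub>v \<beta>"
  proof (rule outer_product_eq[OF F.b B.b \<beta>_nonzero])
    show "\<alpha> $ i * \<alpha> $ j = \<beta> $ i * \<beta> $ j" if "i < n" "j < n" for i j
      using F.lyapunov[OF that] B.lyapunov[OF that] by simp
  qed
  interpret balanced n A \<beta> d
    by unfold_locales (use B.A B.A_symmetric B.b \<beta>_nonzero B.d_pos B.lyapunov B.no_period_two in blast)+

  have d_last: "d i = \<sigma> k" if "n - r \<le> i" "i < n" for i
  proof -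
    have "\<pi> i \<in> {k..<k + r}" using ordering(2) that by auto
    then show ?thesis using multiplicity(2) spec[OF multiplicity(3), of "\<pi> i"] by (simp add: d_def)
  qed
  have r: "r = 1"
  proof (rule ccontr)
    assume "r \<noteq> 1"
    \<comment> \<open>With r at least 2, the last two coordinates would share the singular number
      \<open>\<sigma> k\<close>.\<close>
    then have "n - 1 = n - 2"
      using multiplicity(1,2) d_last by (intro simple_singular_number) auto
    then show False using \<open>r \<noteq> 1\<close> multiplicity(1,2) by linarith
  qed
  define q where "q = n - r"
  have n: "n = Suc q" and q: "n - 1 = q" using r k by (auto simp: q_def)
  have "\<pi> ` {q..<n} = {k..<k + 1}" using ordering(2) r by (simp add: q_def)
  then have \<pi>_q: "\<pi> q = k" by (simp add: n)
  have \<pi>_neq: "\<pi> i \<noteq> k" if "i < q" for i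
    using permutes_inj[OF ordering(1)] \<pi>_q that by (metis injD less_irrefl)

  note block_dims = block_dims[folded q_def, unfolded r]
  note aux = auxiliary[folded q_def, unfolded r]
  have A': "A' \<in> carrier_mat q q" and \<beta>': "\<beta>' \<in> carrier_vec q" and \<alpha>': "init_wt W' \<in> carrier_vec q"
    using aux by (auto simp: auxiliary_wfa_def is_wfa_def A'_def \<beta>'_def)
  have A_index: "A $$ (i, j) = (if j < q then A\<^sub>1\<^sub>1 $$ (i, j) else A\<^sub>1\<^sub>2 $$ (i, 0))" if "i < q" "j < n" for i j
    using partition(1) block_dims that by (auto simp: A_def n)
  have \<beta>_split: "\<beta> = \<beta>\<^sub>1 @\<^sub>v \<beta>\<^sub>2" and \<alpha>_split: "\<alpha> = \<alpha>\<^sub>1 @\<^sub>v \<alpha>\<^sub>2"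
    using partition(2,3) by (auto simp: \<alpha>_def \<beta>_def)
  have \<beta>_index: "\<beta> $ j = (if j < q then \<beta>\<^sub>1 $ j else \<beta>\<^sub>2 $ 0)" if "j < n" for j
    using \<beta>_split block_dims that by (auto simp: n)
  have "t \<cdot>\<^sub>v \<beta> = (t \<cdot>\<^sub>v \<beta>\<^sub>1) @\<^sub>v (t \<cdot>\<^sub>v \<beta>\<^sub>2)"
    unfolding \<beta>_split by (rule eq_vecI) auto
  then have \<alpha>_parts: "\<alpha>\<^sub>1 = t \<cdot>\<^sub>v \<beta>\<^sub>1" "\<alpha>\<^sub>2 = t \<cdot>\<^sub>v \<beta>\<^sub>2"
    using \<alpha>_eq \<alpha>_split append_vec_eq[of \<alpha>\<^sub>1 q "t \<cdot>\<^sub>v \<beta>\<^sub>1" \<alpha>\<^sub>2 "t \<cdot>\<^sub>v \<beta>\<^sub>2"] block_dims by auto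
  note sylvester_blocks = auxiliary_sylvester[OF aux block_dims(1,2,6,7) \<alpha>_parts(2) t,
      folded A'_def \<beta>'_def]
  have sylvester: "(\<Sum>l<q. A' $$ (i, l) * A $$ (l, j)) + \<beta>' $ i * \<beta> $ j = (if i = j then 1 else 0)"
    if i: "i < q" and j: "j < n" for i j
  proof (cases "j < q")
    case True
    have "(A' * A\<^sub>1\<^sub>1 + col_mat \<beta>' * row_mat \<beta>\<^sub>1) $$ (i, j) = 1\<^sub>m q $$ (i, j)"
      unfolding sylvester_blocks ..
    then show ?thesis
      using True i j A' \<beta>' block_dims carrier_matD[OF col_mat_carrier[OF \<beta>']]
        carrier_matD[OF row_mat_carrier[OF block_dims(6)]]
      by (simp add: A_index \<beta>_index scalar_prod_def lessThan_atLeast0 row_mat_def mat_of_rows_index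
          col_mat_index)
  next
    case False
    then have "j = q" using j by (simp add: n)
    have "(A' * A\<^sub>1\<^sub>2 + col_mat \<beta>' * row_mat \<beta>\<^sub>2) $$ (i, 0) = 0\<^sub>m q 1 $$ (i, 0)"
      unfolding sylvester_blocks ..
    then show ?thesis
      using \<open>j = q\<close> i j A' \<beta>' block_dims carrier_matD[OF col_mat_carrier[OF \<beta>']]
        carrier_matD[OF row_mat_carrier[OF block_dims(7)]]
      by (simp add: A_index \<beta>_index scalar_prod_def lessThan_atLeast0 row_mat_def mat_of_rows_index
          col_mat_index)
  qed
  interpret sylvester_solution n A \<beta> d q A' \<beta>' "\<sigma> k"
  proof unfold_locales
    show "d q = \<sigma> k" by (simp add: d_def \<pi>_q)
  qed (fact n A' \<beta>' sylvester)+

  have R_index: "R $$ (i, j) = (if i = j then \<rho> i else 0)" if "i < q" "j < q" for i j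
  proof -
    have "(\<Sigma> * \<Sigma>) $$ (i, j) = (if i = j then (d i)\<^sup>2 else 0)"
      using that unfolding Sigma q_def[symmetric] d_def
      by (simp add: mat_diag_diag) (simp add: mat_diag_def power2_eq_square)
    then show ?thesis
      using that unfolding R q_def[symmetric] by (simp add: \<rho>_def Sigma q_def[symmetric] mat_diag_def)
  qed
  have R_carrier: "R \<in> carrier_mat q q"
    unfolding R Sigma q_def[symmetric] by (auto simp: mat_diag_def)
  have R_fmat: "of_mat R = fdiag q \<rho>"
    by (rule fmat_eqI) (use R_carrier in \<open>auto simp: of_mat.rep_eq fdiag.rep_eq R_index\<close>)
  have "R * A' = A'\<^sup>T * R"
  proof (rule of_mat_inject)
    have "of_mat (R * A') = fdiag q \<rho> * of_mat A'"
      using of_mat_mult[OF R_carrier A'] R_fmat by simp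
    also have "\<dots> = tr (of_mat A') * fdiag q \<rho>"
      by (rule fmat_eqI)
        (auto simp: entry_fdiag_times entry_times_fdiag tr.rep_eq entry_A' \<rho>_symmetric)
    also have "\<dots> = of_mat (A'\<^sup>T * R)"
      using of_mat_mult[of "A'\<^sup>T" q q R q] A' R_carrier R_fmat by (simp add: of_mat_transpose)
    finally show "of_mat (R * A') = of_mat (A'\<^sup>T * R)" .
  qed (use A' R_carrier in auto)
  moreover have "\<beta>\<^sub>1 \<noteq> 0\<^sub>v q \<or> \<beta>\<^sub>2 \<noteq> 0\<^sub>v 1"
  proof (rule ccontr)
    assume "\<not> ?thesis"
    then have "\<beta> = 0\<^sub>v n" by (intro eq_vecI) (auto simp: \<beta>_index n)
    then show False using \<beta>_nonzero by simp
  qed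
  ultimately have "of_vec (init_wt W') = - t *\<^sub>R (fdiag q \<rho> * of_vec \<beta>')"
    using auxiliary_initial[OF aux block_dims(1,2) R_carrier block_dims(6,7) \<alpha>_parts t] R_fmat
    by (simp add: A'_def \<beta>'_def)
  then have entry_eq: "entry (of_vec (init_wt W')) i 0 = entry (- t *\<^sub>R (fdiag q \<rho> * of_vec \<beta>')) i 0" for i
    by (rule arg_cong)
  have \<alpha>'_eq: "init_wt W' $ i = - (t * \<rho> i * \<beta>' $ i)" if "i < q" for i
    using that carrier_vecD[OF \<alpha>'] entry_eq[of i]
    by (simp add: entry_of_vec entry_simps entry_fdiag_times mult.assoc)

  interpret split_solution n A \<beta> d q A' \<beta>' "\<sigma> k" \<alpha> "init_wt W'" t m S S_inv A\<^sub>p A\<^sub>m \<alpha>\<^sub>p \<alpha>\<^sub>m \<beta>\<^sub>p \<beta>\<^sub>m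
    using t \<alpha>_eq \<alpha>' \<alpha>'_eq B.decay m blocks S block_diag stable antistable split
    by unfold_locales (simp_all add: A'_def \<beta>'_def q_def)

  \<comment> \<open>Among the remaining singular numbers, those above \<open>\<sigma> k\<close> are
    exactly the k with smaller index, so the count of negative entries of R becomes k.\<close>
  have \<rho>_sign: "\<rho> i < 0 \<longleftrightarrow> \<pi> i < k" "\<rho> i \<noteq> 0" if "i < q" for i
  proof -
    have i: "\<pi> i < n" using permutes_less[OF ordering(1)] that by (simp add: n)
    have "\<sigma> (\<pi> i) > \<sigma> k \<and> \<pi> i < k \<or> \<sigma> (\<pi> i) < \<sigma> k \<and> \<not> \<pi> i < k"
      using spec[OF multiplicity(3), of "\<pi> i"] i \<pi>_neq[OF that] r by (cases "\<pi> i < k") auto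
    moreover have "0 < \<sigma> (\<pi> i)" "0 < \<sigma> k" using \<sigma>_pos i k by blast+
    moreover have "\<rho> i = (\<sigma> k)\<^sup>2 - (\<sigma> (\<pi> i))\<^sup>2" unfolding \<rho>_def by (simp add: d_def)
    ultimately show "\<rho> i < 0 \<longleftrightarrow> \<pi> i < k" "\<rho> i \<noteq> 0"
      using power_strict_mono[of "\<sigma> k" "\<sigma> (\<pi> i)" 2] power_strict_mono[of "\<sigma> (\<pi> i)" "\<sigma> k" 2] by auto
  qed
  have "bij_betw \<pi> {i. i < q \<and> \<pi> i < k} {..<k}"
    unfolding bij_betw_def
  proof
    show "inj_on \<pi> {i. i < q \<and> \<pi> i < k}"
      using permutes_inj[OF ordering(1)] by (rule inj_on_subset) simp
    show "\<pi> ` {i. i < q \<and> \<pi> i < k} = {..<k}"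
    proof (intro equalityI subsetI)
      fix l assume l: "l \<in> {..<k}"
      then have "l \<in> \<pi> ` {..<n}" using permutes_image[OF ordering(1)] k by auto
      then obtain i where "i < n" "l = \<pi> i" by auto
      then show "l \<in> \<pi> ` {i. i < q \<and> \<pi> i < k}"
        using l \<pi>_q by (cases "i = q") (auto simp: n)
    qed auto
  qed
  then have "card {i. i < q \<and> \<pi> i < k} = k" using bij_betw_same_card by fastforce
  moreover have "{i. i < q \<and> \<rho> i < 0} = {i. i < q \<and> \<pi> i < k}" using \<rho>_sign(1) by auto
  ultimately have m_eq: "m = k" using stable_dimension \<rho>_sign(2) by simp

  have W\<^sub>k: "is_wfa k W\<^sub>k" using blocks m_eq by (simp add: W\<^sub>k_def is_wfa_def)
  define K where "K = (\<lambda>i j. hankel W i j - hankel W\<^sub>k i j)"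
  have hankel_W: "hankel W i j = \<alpha> \<bullet> iter A (i + j) \<beta>" for i j
    using wfa_fun_reorder[OF ordering(1) W] wfa_fun_iter
    by (metis A_def \<alpha>_def \<beta>_def hankel_def)
  have hankel_W\<^sub>k: "hankel W\<^sub>k i j = \<alpha>\<^sub>p \<bullet> iter A\<^sub>p (i + j) \<beta>\<^sub>p" for i j
    using wfa_fun_iter[OF W\<^sub>k] by (simp add: hankel_def W\<^sub>k_def)
  have K_symmetric: "K i j = K j i" for i j by (simp add: K_def hankel_def add.commute)
  have s: "0 \<le> \<sigma> k" using \<sigma>_pos[OF k] by simp
  have sections: "(\<Sum>i<I. (\<Sum>j<N. K i j * x j)\<^sup>2) \<le> (\<sigma> k)\<^sup>2 * (\<Sum>j<N. (x j)\<^sup>2)" for I N x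
    unfolding K_def hankel_W hankel_W\<^sub>k by (rule section_bound)
  note bounded = bounded_sections[of K, OF K_symmetric s sections]
  have "bounded_operator K"
    unfolding bounded_operator_def using bounded by (intro exI[of _ "\<sigma> k"]) blast
  moreover have "spectral_norm K = \<sigma> k"
  proof (rule spectral_norm_eqI)
    define v where "v = (\<lambda>j. V j k)"
    show "v \<in> ell2" using orthonormal(2) k unfolding orthonormal_columns_def v_def by blast
    have unit: "(\<Sum>j. (V j k)\<^sup>2) = 1" "(\<Sum>j. (U j k)\<^sup>2) = 1"
      using orthonormal k unfolding orthonormal_columns_def by (auto simp: power2_eq_square)
    then show "ell2_norm v = 1" by (simp add: ell2_norm_def v_def)
    \<comment> \<open>Coordinate q after renumbering is the old coordinate k, so the input of
      \<open>Schmidt_vector_annihilated\<close> is the right singular vector up to a positive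
      factor. On this vector H - G acts as H does and attains the bound.\<close>
    have "iter A j \<beta> $ q = V j k * sqrt (\<sigma> k)" for j
      using iter_final[OF k] \<pi>_q unfolding reorder_W iter_reorder[OF ordering(1) carriers(1,3)]
      by (simp add: n)
    then have "(\<lambda>j. sqrt (\<sigma> k) * (hankel W\<^sub>k i j * V j k)) sums 0" for i
      using Schmidt_vector_annihilated[of i] by (simp add: hankel_W\<^sub>k mult_ac)
    then have "(\<lambda>j. hankel W\<^sub>k i j * V j k) sums 0" for i
      using \<sigma>_pos[OF k] sums_mult_D[of "sqrt (\<sigma> k)"] by fastforce
    then have "(\<lambda>j. hankel W i j * V j k - hankel W\<^sub>k i j * V j k) sums (\<sigma> k * U i k - 0)" for i
      by (intro sums_diff compact_svd_apply[OF svd k])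
    then have "inf_mat_apply K v i = \<sigma> k * U i k" for i
      unfolding inf_mat_apply_def K_def v_def left_diff_distrib by (simp add: sums_iff)
    moreover have "summable (\<lambda>i. (U i k)\<^sup>2)"
      using orthonormal(1) k by (simp add: orthonormal_columns_def ell2_def)
    ultimately show "ell2_norm (inf_mat_apply K v) = \<sigma> k"
      using unit s by (simp add: ell2_norm_def power_mult_distrib suminf_mult)
  qed (use bounded s in auto)
  ultimately show ?thesis using W\<^sub>k by (simp add: K_def)
qed

end
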